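(* Let $(\mathtt{a}_1^{(i)},\mathtt{a}_2^{(i)},\mathtt{b}_1^{(i)},\mathtt{b}_2^{(i)},\mathtt{c}_1^{(i)},\mathtt{c}_2^{(i)})_{i\ge 1}$ be arbitrary nonzero complex Boltzmann weights, and let $\overline{\mathfrak S}_{\lambda/\mu}$ and $\overline{\mathfrak S}^*_{\lambda/\mu}$ be the two six-vertex models with these weights defined in the context. (a) There exist complex parameters $s_k^{(j)}$ ($k\ge 1$, $j\ge 1$) such that $$Z(\overline{\mathfrak S}_{\lambda/\mu})=\prod_{i=1}^N(\mathtt{a}_1^{(i)})^{M+1-\ell(\lambda)}(\mathtt{b}_1^{(i)})^{\ell(\lambda)}\cdot\langle\mu|e^{H_+}|\lambda\rangle$$ for all strict partitions $\lambda,\mu$, all $N\ge 1$ and all $M\ge\max(\lambda_1,\mu_1)$, if and only if the weights are free fermionic, i.e. $\mathtt{a}_1^{(i)}\mathtt{a}_2^{(i)}+\mathtt{b}_1^{(i)}\mathtt{b}_2^{(i)}=\mathtt{c}_1^{(i)}\mathtt{c}_2^{(i)}$ for all $i$. Likewise, there exist complex parameters $s_{-k}^{(j)}$ ($k,j\ge1$) such that $$Z(\overline{\mathfrak S}^*_{\lambda/\mu})=\prod_{i=1}^N(\mathtt{a}_1^{(i)})^{M+1-\ell(\lambda)}(\mathtt{b}_1^{(i)})^{\ell(\lambda)}\cdot\langle\lambda|e^{H_-}|\mu\rangle$$ for all strict $\lambda,\mu$ and all such $M,N$, if and only if the weights are free fermionic. (b) If the weights are free fermionic, then for all partitions $\lambda,\mu$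 with $\ell(\lambda)=\ell(\mu)=\ell$, all $N\ge 1$ and all $M\ge \max((\lambda+\rho)_1,(\mu+\rho)_1)$, both $Z(\overline{\mathfrak S}_{\lambda+\rho/\mu+\rho})$ and $Z(\overline{\mathfrak S}^*_{\lambda+\rho/\mu+\rho})$ are equal to $$\prod_{i=1}^N(\mathtt{a}_1^{(i)})^{M+1-\ell}(\mathtt{b}_1^{(i)})^{\ell}\cdot s_{\lambda/\mu}\left[\left.\frac{\mathtt{b}_2^{(1)}}{\mathtt{a}_1^{(1)}},\ldots,\frac{\mathtt{b}_2^{(N)}}{\mathtt{a}_1^{(N)}}\right|\frac{\mathtt{a}_2^{(1)}}{\mathtt{b}_1^{(1)}},\ldots,\frac{\mathtt{a}_2^{(N)}}{\mathtt{b}_1^{(N)}}\right],$$ where $s_{\lambda/\mu}[\boldsymbol x|\boldsymbol y]$ is the skew supersymmetric Schur function.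
   Context: Partitions. A partition $\lambda$ of length $\ell=\ell(\lambda)$ is a sequence $\lambda_1\ge\dots\ge\lambda_\ell\ge0$ (trailing zeros are allowed and count toward the length); it is strict if $\lambda_1>\dots>\lambda_\ell\ge 0$. $\rho=\rho_\ell=(\ell-1,\dots,1,0)$, and $\lambda+\rho$ means $\lambda+\rho_{\ell(\lambda)}$, a strict partition. Fock space. The Fock space has as basis the semi-infinite wedges $u_{m_1}\wedge u_{m_2}\wedge\cdots$ with integers $m_1>m_2>\cdots$ such that, for some integer $c$, $m_r=c-r$ for all large $r$; wedges satisfy $u_a\wedge u_b=-u_b\wedge u_a$. For a strict partition $\lambda$ put $|\lambda\rangle=u_{\lambda_1}\wedge\dots\wedge u_{\lambda_\ell}\wedge u_{-1}\wedge u_{-2}\wedge\cdots$; for an operator $X$, $\langle\mu|X|\lambda\rangle$ is the coefficient of the basis vector $|\mu\rangle$ in $X|\lambda\rangle$. For $k\ne0$ the current operator is $J_k(u_{m_1}\wedge u_{m_2}\wedge\cdots)=\sum_{i\ge1}u_{m_1}\wedge\dots\wedge u_{m_{i-1}}\wedge u_{m_i-k}\wedge u_{m_{i+1}}\wedge\cdots$. For given $N$, $H_\pm=\sum_{k\ge1}\sum_{j=1}^N s^{(j)}_{\pm k}J_{\pm k}$ and $e^{H_\pm}=\sum_{m\ge0}H_\pm^m/m!$ (each matrix coefficient is a finite sum). Lattice models. A model is a rectangular grid whose edges carry spins $+$ or $-$; boundary spins are fixed. A state assigns spins to interior edges; its weight is the product over vertices of the Boltzmann weight of the vertex, which is $0$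 if the vertex is not admissible. $Z$ is the sum of weights of all states. Write a vertex as (left, top, right, bottom) spins. Admissible vertices in row $i$ of $\overline{\mathfrak S}$: $\mathtt a_1^{(i)}=(+,+,+,+)$, $\mathtt a_2^{(i)}=(-,-,-,-)$, $\mathtt b_1^{(i)}=(+,-,+,-)$, $\mathtt b_2^{(i)}=(-,+,-,+)$, $\mathtt c_1^{(i)}=(-,+,+,-)$, $\mathtt c_2^{(i)}=(+,-,-,+)$. For $\overline{\mathfrak S}^*$ the $\mathtt a,\mathtt b$ vertices are the same and $\mathtt c_1^{(i)}=(+,+,-,-)$, $\mathtt c_2^{(i)}=(-,-,+,+)$. The same symbols denote the weights. $\overline{\mathfrak S}_{\lambda/\mu}$ ($\lambda,\mu$ strict): $N$ rows labelled $1,\dots,N$ from bottom to top; $M+1$ columns labelled $0,\dots,M$ from left to right, $M\ge\max(\lambda_1,\mu_1)$; left and right boundary edges all $+$; bottom boundary edges $-$ exactly in the columns that are parts of $\lambda$; top boundary edges $-$ exactly in the columns that are parts of $\mu$. $\overline{\mathfrak S}^*_{\lambda/\mu}$: rows labelled $1,\dots,N$ from top to bottom; columns $0,\dots,M$ from left to right; left and right boundary all $+$; top boundary $-$ exactly on parts of $\lambda$; bottom boundary $-$ exactly on parts of $\mu$. Supersymmetric Schur functions. For partitions with $\mu\subseteq\lambda$, $s_{\lambda/\mu}[x_1,\dots,x_N|y_1,\dots,y_N]=\sum_T\prod_i x_i^{m_i(T)}\prod_j y_j^{n_j(T)}$, summed over fillings $T$ of the skew diagram $\lambda/\mu$ with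 entries $1<\dots<N<1'<\dots<N'$, weakly increasing along rows and down columns, with at most one $j'$ in each row and at most one $i$ in each column (for each $i,j$); $m_i(T)$, $n_j(T)$ are the numbers of entries $i$ and $j'$. If $\mu\not\subseteq\lambda$ it is $0$. *)

theory Defs
  imports Complex_Main "HOL-Library.FuncSet" "HOL-Library.Groups_Big_Fun"
begin

section \<open>Partitions\<close>

text \<open>
  A partition is a list of naturals; trailing zeros are significant, and the length of the
  partition is the length of the list.
\<close>

definition is_partition :: "nat list \<Rightarrow> bool" where
  "is_partition p \<longleftrightarrow> sorted_wrt (\<ge>) p"

definition strict_partition :: "nat list \<Rightarrow> bool" where
  "strict_partition p \<longleftrightarrow> sorted_wrt (>) p"

text \<open>Parts are counted from 0 (so the largest part is \<open>part p 0\<close>) and vanish beyond the length.\<close>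

definition part :: "nat list \<Rightarrow> nat \<Rightarrow> nat" where
  "part p i = (if i < length p then p ! i else 0)"

definition plus_rho :: "nat list \<Rightarrow> nat list" where
  "plus_rho p = map (\<lambda>i. p ! i + (length p - 1 - i)) [0..<length p]"


section \<open>Fock space\<close>

text \<open>
  The basis wedge of a strictly decreasing sequence is indexed by the sequence itself (entries
  counted from 0). A vector is given by its coefficients. Finite support is not imposed, because
  the operators \<open>H_minus\<close> and \<open>exp_op\<close> below produce infinite combinations of basis vectors. All
  vectors built from \<open>ket\<close> by these operators vanish outside \<open>fock_basis\<close>.
\<close>

definition fock_basis :: "(nat \<Rightarrow> int) set" where
  "fock_basis = {m. (\<forall>i j. i < j \<longrightarrow> m j < m i) \<and> (\<exists>c. \<forall>\<^sub>F r in sequentially. m r = c - int r)}"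

type_synonym fock = "(nat \<Rightarrow> int) \<Rightarrow> complex"

text \<open>
  The wedge of a not necessarily decreasing sequence \<open>m\<close> that is eventually of the form
  \<open>c - int r\<close>. By antisymmetry it is zero if \<open>m\<close> has a repeated entry; otherwise it is the basis
  wedge of the decreasing rearrangement \<open>n\<close> of \<open>m\<close>, times the sign of the rearrangement, and that
  sign is given by the (finite) number of pairs of entries in the wrong order.
\<close>

definition wedge :: "(nat \<Rightarrow> int) \<Rightarrow> fock" where
  "wedge m n =
     (if inj m \<and> n \<in> fock_basis \<and> range n = range m
      then (-1) ^ card {(i, j). i < j \<and> m i < m j} else 0)"

definition ket_seq :: "nat list \<Rightarrow> nat \<Rightarrow> int" where
  "ket_seq p r = (if r < length p then int (p ! r) else int (length p) - 1 - int r)"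

definition ket :: "nat list \<Rightarrow> fock" where
  "ket p = wedge (ket_seq p)"

text \<open>
  \<open>Sum_any\<close> is the sum of a function of finite support. In \<open>J\<close>, the inner sum applies the current
  operator to the basis wedge of \<open>m\<close>, and the outer sum extends this linearly. For \<open>k \<noteq> 0\<close> and the
  vectors obtained from \<open>ket\<close>, all coefficientwise sums here and below have finite support.
\<close>

definition J :: "int \<Rightarrow> fock \<Rightarrow> fock" where
  "J k v n = Sum_any (\<lambda>m. v m * Sum_any (\<lambda>i. wedge (m(i := m i - k)) n))"

text \<open>The parameter with upper index \<open>j\<close> and lower index \<open>k\<close> is \<open>s j k\<close>.\<close>

definition H_plus :: "nat \<Rightarrow> (nat \<Rightarrow> int \<Rightarrow> complex) \<Rightarrow> fock \<Rightarrow> fock" where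
  "H_plus N s v n =
     Sum_any (\<lambda>k::nat. if k \<ge> 1 then (\<Sum>j=1..N. s j (int k) * J (int k) v n) else 0)"

definition H_minus :: "nat \<Rightarrow> (nat \<Rightarrow> int \<Rightarrow> complex) \<Rightarrow> fock \<Rightarrow> fock" where
  "H_minus N s v n =
     Sum_any (\<lambda>k::nat. if k \<ge> 1 then (\<Sum>j=1..N. s j (- int k) * J (- int k) v n) else 0)"

definition exp_op :: "(fock \<Rightarrow> fock) \<Rightarrow> fock \<Rightarrow> fock" where
  "exp_op X v n = Sum_any (\<lambda>m::nat. (X ^^ m) v n / fact m)"

definition matrix_coeff :: "nat list \<Rightarrow> (fock \<Rightarrow> fock) \<Rightarrow> nat list \<Rightarrow> complex" where
  "matrix_coeff mu X lam = X (ket lam) (ket_seq mu)"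


section \<open>Lattice models\<close>

datatype spin = Plus | Minus

datatype vertex = A1 | A2 | B1 | B2 | C1 | C2

text \<open>The spins of a vertex are listed in the order left, top, right, bottom.\<close>

fun vertex_S :: "spin \<Rightarrow> spin \<Rightarrow> spin \<Rightarrow> spin \<Rightarrow> vertex option" where
  "vertex_S Plus  Plus  Plus  Plus  = Some A1"
| "vertex_S Minus Minus Minus Minus = Some A2"
| "vertex_S Plus  Minus Plus  Minus = Some B1"
| "vertex_S Minus Plus  Minus Plus  = Some B2"
| "vertex_S Minus Plus  Plus  Minus = Some C1"
| "vertex_S Plus  Minus Minus Plus  = Some C2"
| "vertex_S _ _ _ _ = None"

fun vertex_S_star :: "spin \<Rightarrow> spin \<Rightarrow> spin \<Rightarrow> spin \<Rightarrow> vertex option" where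
  "vertex_S_star Plus  Plus  Plus  Plus  = Some A1"
| "vertex_S_star Minus Minus Minus Minus = Some A2"
| "vertex_S_star Plus  Minus Plus  Minus = Some B1"
| "vertex_S_star Minus Plus  Minus Plus  = Some B2"
| "vertex_S_star Plus  Plus  Minus Minus = Some C1"
| "vertex_S_star Minus Minus Plus  Plus  = Some C2"
| "vertex_S_star _ _ _ _ = None"

text \<open>\<open>w t i\<close> is the Boltzmann weight of a vertex of type \<open>t\<close> in the row labelled \<open>i\<close> (\<open>i \<ge> 1\<close>).\<close>

type_synonym weights = "vertex \<Rightarrow> nat \<Rightarrow> complex"

definition boltzmann :: "weights \<Rightarrow> nat \<Rightarrow> vertex option \<Rightarrow> complex" where
  "boltzmann w i x = (case x of None \<Rightarrow> 0 | Some t \<Rightarrow> w t i)"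

definition free_fermionic :: "weights \<Rightarrow> bool" where
  "free_fermionic w \<longleftrightarrow> (\<forall>i\<ge>1. w A1 i * w A2 i + w B1 i * w B2 i = w C1 i * w C2 i)"

definition boundary_spin :: "nat list \<Rightarrow> nat \<Rightarrow> spin" where
  "boundary_spin p c = (if c \<in> set p then Minus else Plus)"

text \<open>
  States of the grid with \<open>N\<close> rows, here counted \<open>1, \<dots>, N\<close> from top to bottom, and columns
  \<open>0, \<dots>, M\<close>. A state is a pair \<open>(h, v)\<close> of spin assignments to horizontal and vertical edges,
  boundary edges included: \<open>h (r, c)\<close> and \<open>h (r, c + 1)\<close> are the spins left and right of the vertex
  in row \<open>r\<close> and column \<open>c\<close>, while \<open>v (r - 1, c)\<close> and \<open>v (r, c)\<close> are the spins above and below it.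
\<close>

definition states ::
  "nat \<Rightarrow> nat \<Rightarrow> (nat \<Rightarrow> spin) \<Rightarrow> (nat \<Rightarrow> spin) \<Rightarrow> ((nat \<times> nat \<Rightarrow> spin) \<times> (nat \<times> nat \<Rightarrow> spin)) set"
  where
  "states N M top_spin bottom_spin =
     {(h, v).
        h \<in> ({1..N} \<times> {0..M + 1}) \<rightarrow>\<^sub>E UNIV \<and>
        v \<in> ({0..N} \<times> {0..M}) \<rightarrow>\<^sub>E UNIV \<and>
        (\<forall>r\<in>{1..N}. h (r, 0) = Plus \<and> h (r, M + 1) = Plus) \<and>
        (\<forall>c\<in>{0..M}. v (0, c) = top_spin c \<and> v (N, c) = bottom_spin c)}"

text \<open>In \<open>Z_S\<close>, the row at position \<open>r\<close> from the top carries the label \<open>N + 1 - r\<close>.\<close>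

definition Z_S :: "weights \<Rightarrow> nat \<Rightarrow> nat \<Rightarrow> nat list \<Rightarrow> nat list \<Rightarrow> complex" where
  "Z_S w N M lam mu =
     (\<Sum>(h, v) \<in> states N M (boundary_spin mu) (boundary_spin lam).
        \<Prod>r=1..N. \<Prod>c=0..M.
          boltzmann w (N + 1 - r) (vertex_S (h (r, c)) (v (r - 1, c)) (h (r, c + 1)) (v (r, c))))"

definition Z_S_star :: "weights \<Rightarrow> nat \<Rightarrow> nat \<Rightarrow> nat list \<Rightarrow> nat list \<Rightarrow> complex" where
  "Z_S_star w N M lam mu =
     (\<Sum>(h, v) \<in> states N M (boundary_spin lam) (boundary_spin mu).
        \<Prod>r=1..N. \<Prod>c=0..M.
          boltzmann w r (vertex_S_star (h (r, c)) (v (r - 1, c)) (h (r, c + 1)) (v (r, c))))"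


section \<open>Supersymmetric Schur functions\<close>

datatype entry = Unprimed nat | Primed nat

fun entry_le :: "entry \<Rightarrow> entry \<Rightarrow> bool" where
  "entry_le (Unprimed i) (Unprimed j) \<longleftrightarrow> i \<le> j"
| "entry_le (Unprimed i) (Primed j) \<longleftrightarrow> True"
| "entry_le (Primed i) (Unprimed j) \<longleftrightarrow> False"
| "entry_le (Primed i) (Primed j) \<longleftrightarrow> i \<le> j"

definition contained :: "nat list \<Rightarrow> nat list \<Rightarrow> bool" where
  "contained mu lam \<longleftrightarrow> (\<forall>i. part mu i \<le> part lam i)"

text \<open>Cells are pairs (row, column), both counted from 0.\<close>

definition skew_diagram :: "nat list \<Rightarrow> nat list \<Rightarrow> (nat \<times> nat) set" where
  "skew_diagram lam mu = {(i, j). part mu i \<le> j \<and> j < part lam i}"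

definition super_tableaux :: "nat \<Rightarrow> nat list \<Rightarrow> nat list \<Rightarrow> (nat \<times> nat \<Rightarrow> entry) set" where
  "super_tableaux N lam mu =
     {T \<in> skew_diagram lam mu \<rightarrow>\<^sub>E (Unprimed ` {1..N} \<union> Primed ` {1..N}).
        (\<forall>i j j'. (i, j) \<in> skew_diagram lam mu \<and> (i, j') \<in> skew_diagram lam mu \<and> j < j' \<longrightarrow>
           entry_le (T (i, j)) (T (i, j')) \<and>
           (\<forall>k. \<not> (T (i, j) = Primed k \<and> T (i, j') = Primed k))) \<and>
        (\<forall>i i' j. (i, j) \<in> skew_diagram lam mu \<and> (i', j) \<in> skew_diagram lam mu \<and> i < i' \<longrightarrow>
           entry_le (T (i, j)) (T (i', j)) \<and>
           (\<forall>k. \<not> (T (i, j) = Unprimed k \<and> T (i', j) = Unprimed k)))}"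

definition super_schur ::
  "nat \<Rightarrow> nat list \<Rightarrow> nat list \<Rightarrow> (nat \<Rightarrow> complex) \<Rightarrow> (nat \<Rightarrow> complex) \<Rightarrow> complex" where
  "super_schur N lam mu x y =
     (if contained mu lam then
        (\<Sum>T \<in> super_tableaux N lam mu.
           (\<Prod>i=1..N. x i ^ card {b \<in> skew_diagram lam mu. T b = Unprimed i}) *
           (\<Prod>j=1..N. y j ^ card {b \<in> skew_diagram lam mu. T b = Primed j}))
      else 0)"

end

theory Submission
  imports Defs "HOL-Computational_Algebra.Formal_Power_Series" "HOL-Computational_Algebra.Polynomial"
begin

unbundle fps_syntax

text \<open>
  Everything is compared with the minors \<open>det (h_(a_i - b_j))\<close> of a Toeplitz matrix, indexed by
  strict partitions \<open>a\<close>, \<open>b\<close> and depending on one power series \<open>h\<close>.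

  The matrix coefficients of the exponential of a combination of currents are such minors for
  \<open>h(z) = exp (\<Sum>k. s_k z^k)\<close>: replacing \<open>s\<close> by \<open>t s\<close>, the minor satisfies the linear differential
  equation in \<open>t\<close> whose solution is the exponential, because a current acts on a wedge as a
  derivation. Raising currents are the adjoints of lowering ones.

  Reading one row of the lattice column by column shows that, for free fermionic weights, the row
  acts on wedges by multiplication of \<open>h\<close> with \<open>(1 + y z) / (1 - x z)\<close>, where \<open>x = b2/a1\<close> and
  \<open>y = a2/b1\<close>. Likewise, removing the largest entry of a tableau multiplies \<open>h\<close> with
  \<open>1 / (1 - x z)\<close> (horizontal strips) or \<open>1 + y z\<close> (vertical strips). Since power series commute,
  the order of the factors is irrelevant.

  Conversely, every minor of this kind satisfies \<open>D (2 1, 1 0) = (D (1, 0))^2 - D (2, 0)\<close>; adding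
  one row to the lattice turns this relation into the free fermion condition for that row.
\<close>

section \<open>Determinants and Toeplitz minors\<close>

text \<open>Semi-infinite wedges reduce to finite determinants because all negative levels are
  filled: a lowering current that pushes an entry below 0 hits an occupied level and gives zero.
  Lowering currents thus preserve the finite span of strict partitions of fixed length with bounded
  parts. Raising currents leave every such span, but by adjointness the coefficients of the powers
  of \<open>H_minus\<close> inside it depend only on each other. Dividing every weight by a1 or b1
  according to the spin below the vertex leaves x, y and the product of the two scaled c weights,
  and the free fermion condition says that this product is x + y. Minus spins are conserved from row
  to row, so every row contributes the same power of its a1 and b1; this is the prefactor. The
  parameters are the coefficients of the logarithm of (1 + y z) / (1 - x z); those of row j do not
  depend on N. For the converse nothing relates the series h for N rows to the one for N + 1 rows.
  The quadratic relation holds for each N separately, and its increment contains only the weights of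
  the new row.\<close>

definition delete_nth :: "nat \<Rightarrow> 'a list \<Rightarrow> 'a list" where
  "delete_nth i xs = take i xs @ drop (Suc i) xs"

lemma length_delete_nth [simp]: "i < length xs \<Longrightarrow> length (delete_nth i xs) = length xs - 1"
  by (auto simp: delete_nth_def)

lemma delete_nth_map: "delete_nth i (map f xs) = map f (delete_nth i xs)"
  by (simp add: delete_nth_def take_map drop_map)

lemma delete_nth_simps [simp]:
  "delete_nth 0 (x # xs) = xs"
  "delete_nth (Suc i) (x # xs) = x # delete_nth i xs"
  "delete_nth i [] = []"
  by (simp_all add: delete_nth_def)

lemma delete_nth_append:
  "delete_nth i (p @ u # r) =
     (if i < length p then delete_nth i p @ u # r
      else if i = length p then p @ r else p @ u # delete_nth (i - Suc (length p)) r)"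
proof (induction p arbitrary: i)
  case Nil
  then show ?case by (cases i) auto
next
  case (Cons a p)
  then show ?case by (cases i) auto
qed

lemma delete_nth_list_update:
  "delete_nth i (xs[k := y]) =
     (if k < i then (delete_nth i xs)[k := y]
      else if k = i then delete_nth i xs else (delete_nth i xs)[k - 1 := y])"
proof (induction xs arbitrary: i k)
  case (Cons a xs)
  show ?case
  proof (cases i)
    case 0
    then show ?thesis by (cases k) auto
  next
    case (Suc j)
    then show ?thesis using Cons by (cases k; cases "k - 1") auto
  qed
qed simp

lemma nth_delete_nth:
  "k < length xs - 1 \<Longrightarrow> delete_nth i xs ! k = xs ! (if k < i then k else Suc k)"
  by (auto simp: delete_nth_def nth_append min_def)

text \<open>Laplace expansion along the column \<open>c\<close>. A row is a function, so that it can
  be treated as one factor of a wedge and changed inside the list \<open>p @ u # r\<close>. Lists of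
  different lengths give 0, which matches the orthogonality of wedges of different charge.\<close>

fun ldet :: "(nat \<Rightarrow> 'a :: comm_ring_1) list \<Rightarrow> nat list \<Rightarrow> 'a" where
  "ldet vs [] = (if vs = [] then 1 else 0)"
| "ldet vs (c # cs) = (\<Sum>i<length vs. (-1) ^ i * (vs ! i) c * ldet (delete_nth i vs) cs)"

lemma ldet_add:
  "ldet (p @ (\<lambda>q. u q + v q) # r) cs = ldet (p @ u # r) cs + ldet (p @ v # r) cs"
  by (induction cs arbitrary: p r)
     (auto simp: delete_nth_append nth_append nth_Cons' algebra_simps simp flip: sum.distrib
           intro!: sum.cong)

lemma ldet_scale: "ldet (p @ (\<lambda>q. a * u q) # r) cs = a * ldet (p @ u # r) cs"
  by (induction cs arbitrary: p r)
     (auto simp: delete_nth_append nth_append nth_Cons' algebra_simps sum_distrib_left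
           intro!: sum.cong)

text \<open>In the expansion along the first column, deleting a row outside the equal pair leaves
  the pair adjacent, so the induction hypothesis applies. The two remaining terms have the same
  minor and opposite signs.\<close>

lemma ldet_adjacent_equal: "ldet (p @ u # u # r) cs = 0"
proof (induction cs arbitrary: p r)
  case (Cons c cs)
  let ?vs = "p @ u # u # r" and ?k = "length p"
  let ?f = "\<lambda>i. (-1) ^ i * (?vs ! i) c * ldet (delete_nth i ?vs) cs"
  have "?f i = 0" if "i \<notin> {?k, Suc ?k}" for i
  proof (cases "i < ?k")
    case True then show ?thesis using Cons.IH by (simp add: delete_nth_append)
  next
    case False
    have "delete_nth i ?vs = p @ u # u # delete_nth (i - Suc (Suc ?k)) r"
      using False that delete_nth_append[of i "p @ [u]" u r] by simp
    then show ?thesis using Cons.IH by simp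
  qed
  then have "sum ?f {..<length ?vs} = sum ?f {?k, Suc ?k}"
    by (intro sum.mono_neutral_right) auto
  also have "delete_nth (Suc ?k) ?vs = p @ u # r"
    using delete_nth_append[of "Suc ?k" "p @ [u]" u r] by simp
  then have "sum ?f {?k, Suc ?k} = 0"
    by (simp add: delete_nth_append nth_append nth_Cons')
  finally show ?case by simp
qed simp

lemma ldet_swap: "ldet (p @ u # v # r) cs = - ldet (p @ v # u # r) cs"
proof -
  let ?s = "\<lambda>q. u q + v q"
  have "0 = ldet (p @ ?s # ?s # r) cs"
    by (simp add: ldet_adjacent_equal)
  also have "\<dots> = ldet (p @ u # v # r) cs + ldet (p @ v # u # r) cs"
    using ldet_add[of "p @ [u]" u v r cs] ldet_add[of "p @ [v]" u v r cs]
    by (simp add: ldet_add ldet_adjacent_equal)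
  finally show ?thesis by (simp add: eq_neg_iff_add_eq_0)
qed

lemma ldet_zero: "ldet (p @ (\<lambda>q. 0) # r) cs = 0"
  using ldet_scale[of p 0 "\<lambda>q. 0" r cs] by simp

lemma ldet_sum:
  "finite I \<Longrightarrow> ldet (p @ (\<lambda>q. \<Sum>i\<in>I. f i q) # r) cs = (\<Sum>i\<in>I. ldet (p @ f i # r) cs)"
  by (induction I rule: finite_induct) (auto simp: ldet_zero ldet_add)

lemma ldet_move: "ldet (p @ u # qs @ r) cs = (-1) ^ length qs * ldet (p @ qs @ u # r) cs"
proof (induction qs arbitrary: p)
  case (Cons a qs)
  have "ldet (p @ u # (a # qs) @ r) cs = - ldet ((p @ [a]) @ u # qs @ r) cs"
    using ldet_swap[of p u a "qs @ r" cs] by simp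
  also have "\<dots> = (-1) ^ length (a # qs) * ldet (p @ (a # qs) @ u # r) cs"
    by (subst Cons.IH) simp
  finally show ?case .
qed simp

lemma ldet_not_distinct:
  assumes "\<not> distinct vs"
  shows "ldet vs cs = 0"
proof -
  obtain p u qs r where "vs = p @ u # qs @ u # r"
    using not_distinct_decomp[OF assms] by auto
  then show ?thesis
    using ldet_move[of p u qs "u # r" cs] ldet_adjacent_equal[of "p @ qs" u r cs] by simp
qed

lemma set_delete_nth_subset: "set (delete_nth i xs) \<subseteq> set xs"
  unfolding delete_nth_def by (auto dest: in_set_takeD in_set_dropD)

lemma sorted_wrt_delete_nth: "sorted_wrt P xs \<Longrightarrow> sorted_wrt P (delete_nth i xs)"
proof (induction xs arbitrary: i)
  case (Cons a xs)
  then show ?case using set_delete_nth_subset[of _ xs] by (cases i) auto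
qed simp

text \<open>Only row 0 can contribute. If \<open>c\<close> stands further back in \<open>a\<close>,
  the minor keeps the entry \<open>a ! 0\<close>, which exceeds \<open>c\<close> and hence every
  element of \<open>cs\<close>.\<close>

lemma ldet_indicator:
  assumes "strict_partition a" "strict_partition b"
  shows "ldet (map (\<lambda>n q. of_bool (n = q)) a) b = of_bool (a = b)"
  using assms
proof (induction b arbitrary: a)
  case (Cons c cs)
  define f where "f i = (-1) ^ i * of_bool (a ! i = c) *
    ldet (map (\<lambda>n q. of_bool (n = q) :: 'a) (delete_nth i a)) cs" for i
  have *: "f i = of_bool (i = 0 \<and> a = c # cs)" if "i < length a" for i
  proof (cases "a ! i = c")
    case True
    have IH: "ldet (map (\<lambda>n q. of_bool (n = q) :: 'a) (delete_nth i a)) cs = of_bool (delete_nth i a = cs)"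
      using Cons.prems by (intro Cons.IH) (auto simp: strict_partition_def sorted_wrt_delete_nth)
    show ?thesis
    proof (cases i)
      case 0
      then show ?thesis using True IH that
        by (cases a) (auto simp: f_def delete_nth_def)
    next
      case (Suc j)
      have "a ! 0 > c"
        using Cons.prems(1) True Suc that by (auto simp: strict_partition_def sorted_wrt_iff_nth_less)
      moreover have "a ! 0 \<in> set (delete_nth i a)"
        using Suc that by (cases a) (auto simp: delete_nth_def)
      moreover have "\<forall>x\<in>set cs. x < c"
        using Cons.prems(2) by (auto simp: strict_partition_def)
      ultimately have "delete_nth i a \<noteq> cs" by force
      then show ?thesis using Suc IH by (simp add: f_def)
    qed
  next
    case False
    then show ?thesis using that by (auto simp: f_def)
  qed
  have "ldet (map (\<lambda>n q. of_bool (n = q) :: 'a) a) (c # cs) = (\<Sum>i<length a. f i)"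
    by (auto simp: f_def delete_nth_map intro!: sum.cong)
  also have "\<dots> = (\<Sum>i<length a. of_bool (i = 0 \<and> a = c # cs))"
    by (intro sum.cong) (use * in auto)
  also have "\<dots> = (if a = c # cs then (\<Sum>i<length a. if i = 0 then 1 else 0) else 0)"
    by (auto intro!: sum.cong)
  also have "\<dots> = of_bool (a = c # cs)"
    by (subst sum.delta) auto
  finally show ?case .
qed auto

lemma sum_remove_nth_index:
  fixes f :: "nat \<Rightarrow> 'a :: comm_monoid_add"
  assumes "i < n"
  shows "(\<Sum>k\<in>{..<n} - {i}. f k) = (\<Sum>k<n - 1. f (if k < i then k else Suc k))"
  by (rule sum.reindex_bij_witness[where j = "\<lambda>k. if k < i then k else k - 1"
        and i = "\<lambda>k. if k < i then k else Suc k"]) (use assms in auto)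

section \<open>Derivatives of determinants with polynomial entries\<close>

lemma pderiv_sum: "pderiv (\<Sum>i\<in>I. f i) = (\<Sum>i\<in>I. pderiv (f i))"
  by (induction I rule: infinite_finite_induct) (auto simp: pderiv_add)

text \<open>Leibniz rule: in the i-th term of the expansion, differentiating the entry contributes k
  = i, and differentiating the minor contributes all other k, with the indices from i on shifted by
  the deleted row.\<close>

lemma pderiv_ldet:
  fixes vs :: "(nat \<Rightarrow> 'a :: idom poly) list"
  shows "pderiv (ldet vs cs) = (\<Sum>k<length vs. ldet (vs[k := (\<lambda>q. pderiv ((vs ! k) q))]) cs)"
proof (induction cs arbitrary: vs)
  case (Cons c cs)
  let ?d = "\<lambda>k vs. vs[k := (\<lambda>q. pderiv ((vs ! k) q))]"
  let ?n = "length vs"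
  let ?t = "\<lambda>i vs. (-1) ^ i * (vs ! i) c * ldet (delete_nth i vs) cs"
  have sgn: "pderiv ((-1) ^ i :: 'a poly) = 0" for i :: nat
    by (cases "even i") (auto simp: pderiv_minus)
  have "pderiv (?t i vs) = (\<Sum>k<?n. ?t i (?d k vs))" if "i < ?n" for i
  proof -
    let ?r = "delete_nth i vs"
    have *: "ldet (?d k ?r) cs = ldet (delete_nth i (?d (if k < i then k else Suc k) vs)) cs"
      if "k < ?n - 1" for k
      using that \<open>i < ?n\<close>
      by (auto simp: delete_nth_list_update nth_delete_nth)
    have "pderiv (?t i vs) = (-1) ^ i * pderiv ((vs ! i) c) * ldet ?r cs +
        (-1) ^ i * (vs ! i) c * (\<Sum>k<?n - 1. ldet (?d k ?r) cs)"
      using that by (simp add: sgn pderiv_mult Cons.IH that algebra_simps)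
    also have "(\<Sum>k<?n - 1. ldet (?d k ?r) cs) = (\<Sum>k\<in>{..<?n} - {i}. ldet (delete_nth i (?d k vs)) cs)"
      by (subst sum_remove_nth_index[OF that]) (use * in auto)
    also have "(-1) ^ i * (vs ! i) c * \<dots> = (\<Sum>k\<in>{..<?n} - {i}. ?t i (?d k vs))"
      by (auto simp: sum_distrib_left intro!: sum.cong)
    also have "(-1) ^ i * pderiv ((vs ! i) c) * ldet ?r cs = ?t i (?d i vs)"
      using that by (simp add: delete_nth_list_update)
    also have "?t i (?d i vs) + (\<Sum>k\<in>{..<?n} - {i}. ?t i (?d k vs)) = (\<Sum>k<?n. ?t i (?d k vs))"
      using that by (subst (2) sum.remove[of _ i]) auto
    finally show ?thesis .
  qed
  then have "pderiv (ldet vs (c # cs)) = (\<Sum>i<?n. \<Sum>k<?n. ?t i (?d k vs))"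
    by (simp add: pderiv_sum)
  also have "\<dots> = (\<Sum>k<?n. \<Sum>i<?n. ?t i (?d k vs))"
    by (rule sum.swap)
  finally show ?case by simp
qed (auto simp: pderiv_1)

lemma poly_ldet: "poly (ldet vs cs) z = ldet (map (\<lambda>v q. poly (v q) z) vs) cs"
  by (induction cs arbitrary: vs) (auto simp: poly_sum delete_nth_map)

text \<open>Row n is the image of the n-th basis vector when the coefficients of \<open>f\<close>
  multiply the lowering operators. The guard matters because truncated subtraction would put
  \<open>f $ 0\<close> at every q > n.\<close>

definition toeplitz :: "'a :: comm_ring_1 fps \<Rightarrow> nat \<Rightarrow> nat \<Rightarrow> 'a" where
  "toeplitz f n q = (if q \<le> n then f $ (n - q) else 0)"

definition toeplitz_det :: "'a :: comm_ring_1 fps \<Rightarrow> nat list \<Rightarrow> nat list \<Rightarrow> 'a" where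
  "toeplitz_det f a b = ldet (map (toeplitz f) a) b"

lemma toeplitz_det_1:
  assumes "strict_partition a" "strict_partition b"
  shows "toeplitz_det 1 a b = of_bool (a = b)"
proof -
  have "toeplitz 1 = (\<lambda>n q. of_bool (n = q) :: 'a)"
    by (auto simp: toeplitz_def fun_eq_iff)
  then show ?thesis using ldet_indicator[OF assms] by (simp add: toeplitz_det_def)
qed

text \<open>Multiplication by X delays rows by one. With G = F this yields the recursion of
  horizontal strips and with G = g that of vertical strips; a lattice row uses it twice, for a path
  inside the row and for the final sum.\<close>

lemma toeplitz_shift:
  assumes "F = g + fps_const x * fps_X * G"
  shows "toeplitz F 0 = toeplitz g 0"
    and "toeplitz F (Suc n) = (\<lambda>q. toeplitz g (Suc n) q + x * toeplitz G n q)"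
proof -
  have 0: "F $ 0 = g $ 0" by (simp add: assms mult.assoc)
  have Suc: "F $ Suc k = g $ Suc k + x * G $ k" for k by (simp add: assms mult.assoc)
  show "toeplitz F 0 = toeplitz g 0"
    using 0 by (auto simp: toeplitz_def fun_eq_iff)
  show "toeplitz F (Suc n) = (\<lambda>q. toeplitz g (Suc n) q + x * toeplitz G n q)"
    using 0 Suc by (auto simp: toeplitz_def fun_eq_iff Suc_diff_le le_Suc_eq)
qed

section \<open>Currents acting on basis wedges\<close>

definition decreasing :: "(nat \<Rightarrow> int) \<Rightarrow> bool" where
  "decreasing m \<longleftrightarrow> (\<forall>i j. i < j \<longrightarrow> m j < m i)"

lemma decreasing_less_iff: "decreasing m \<Longrightarrow> m i < m j \<longleftrightarrow> j < i"
  unfolding decreasing_def by (metis less_asym linorder_neqE_nat)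

lemma decreasing_inj: "decreasing m \<Longrightarrow> inj m"
  by (rule linorder_injI) (metis decreasing_def less_irrefl)

text \<open>If the sequences agree before i, then m i occurs in n at an index not before i, so m i
  \<le> n i; exchanging the roles gives equality.\<close>

lemma decreasing_eqI:
  assumes "decreasing m" "decreasing n" "range m = range n"
  shows "m = n"
proof
  fix i
  have *: "m i \<le> n i" if eq: "\<And>j. j < i \<Longrightarrow> m j = n j" and m: "decreasing m"
    and n: "decreasing n" and ran: "range m = range n"
    for m n :: "nat \<Rightarrow> int" and i
  proof -
    obtain j where j: "m i = n j"
      using ran by (metis rangeE rangeI)
    have "\<not> j < i"
      using eq[of j] j decreasing_inj[OF m] by (metis injD less_irrefl)
    then show ?thesis
      using j decreasing_less_iff[OF n, of i j] by linarith
  qed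
  show "m i = n i"
  proof (induction i rule: less_induct)
    case (less i)
    then show ?case using *[of i m n] *[of i n m] assms by (auto intro: antisym)
  qed
qed

lemma fock_basis_decreasing: "m \<in> fock_basis \<Longrightarrow> decreasing m"
  by (simp add: fock_basis_def decreasing_def)

lemma range_ket_seq: "range (ket_seq a) = int ` set a \<union> {..<0}"
proof (intro equalityI subsetI)
  fix x assume "x \<in> range (ket_seq a)"
  then show "x \<in> int ` set a \<union> {..<0}" by (auto simp: ket_seq_def)
next
  fix x assume "x \<in> int ` set a \<union> {..<0}"
  then consider y where "y \<in> set a" "x = int y" | "x < 0" by auto
  then show "x \<in> range (ket_seq a)"
  proof cases
    case 1
    then obtain i where "i < length a" "a ! i = y" by (auto simp: in_set_conv_nth)
    then have "ket_seq a i = x" using 1 by (simp add: ket_seq_def)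
    then show ?thesis by blast
  next
    case 2
    then have "ket_seq a (nat (int (length a) - 1 - x)) = x" by (simp add: ket_seq_def)
    then show ?thesis by (metis rangeI)
  qed
qed

lemma decreasing_ket_seq: "strict_partition a \<Longrightarrow> decreasing (ket_seq a)"
  by (auto simp: decreasing_def ket_seq_def strict_partition_def sorted_wrt_iff_nth_less)

lemma ket_seq_fock_basis: "strict_partition a \<Longrightarrow> ket_seq a \<in> fock_basis"
  using decreasing_ket_seq[of a]
  by (auto simp: fock_basis_def decreasing_def ket_seq_def eventually_sequentially
        intro!: exI[of _ "int (length a) - 1"] exI[of _ "length a"])

lemma ket_seq_eq_iff: "ket_seq a = ket_seq b \<longleftrightarrow> a = b"
proof
  assume eq: "ket_seq a = ket_seq b"
  have "ket_seq a (length a + length b) = ket_seq b (length a + length b)"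
    by (simp add: eq)
  then have len: "length a = length b" by (simp add: ket_seq_def)
  have "a ! i = b ! i" if "i < length a" for i
    using fun_cong[OF eq, of i] that len by (simp add: ket_seq_def)
  then show "a = b" using len by (simp add: nth_equalityI)
qed simp

lemma inj_ket_seq: "distinct a \<Longrightarrow> inj (ket_seq a)"
  by (rule injI) (auto simp: ket_seq_def nth_eq_iff_index_eq split: if_splits)

lemma inj_ket_seqD:
  assumes "inj (ket_seq a)"
  shows "distinct a"
  unfolding distinct_conv_nth
proof (intro allI impI)
  fix i j assume "i < length a" "j < length a" "i \<noteq> j"
  moreover from this have "ket_seq a i \<noteq> ket_seq a j"
    using assms by (auto simp: inj_eq)
  ultimately show "a ! i \<noteq> a ! j" by (auto simp: ket_seq_def)
qed

lemma wedge_decreasing: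
  assumes "m \<in> fock_basis"
  shows "wedge m n = of_bool (n = m)"
proof -
  have none: "{(i, j). i < j \<and> m i < m j} = {}"
    using fock_basis_decreasing[OF assms] by (auto simp: decreasing_less_iff)
  show ?thesis
    unfolding wedge_def none
    using assms decreasing_eqI[of n m] fock_basis_decreasing[of n] fock_basis_decreasing[of m]
    by (auto simp: decreasing_inj)
qed

lemma ket_strict: "strict_partition a \<Longrightarrow> ket a n = of_bool (n = ket_seq a)"
  by (simp add: ket_def wedge_decreasing ket_seq_fock_basis)

lemma inj_fun_upd_iff: "inj m \<Longrightarrow> inj (m(i := y)) \<longleftrightarrow> y \<notin> m ` (- {i})"
  unfolding inj_def by (auto simp: image_iff)

lemma range_fun_upd: "inj m \<Longrightarrow> range (m(i := y)) = insert y (range m - {m i})"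
  by (auto simp: inj_eq image_iff)

text \<open>Only pairs containing i can become inverted, namely those whose other entry lies
  strictly between the old and the new value. Counting values instead of indices allows the sign to
  be compared with that of the reverse move in \<open>Jcoeff_adjoint\<close>.\<close>

lemma card_inversions_fun_upd:
  assumes "decreasing m"
  shows "card {(a, b). a < b \<and> (m(i := y)) a < (m(i := y)) b} =
    card {z \<in> range m. min y (m i) < z \<and> z < max y (m i)}" (is "card ?I = card ?R")
proof -
  let ?C = "{c. min y (m i) < m c \<and> m c < max y (m i)}"
  let ?f = "\<lambda>c. if i < c then (i, c) else (c, i)"
  have "?I = ?f ` ?C"
  proof (intro equalityI subsetI)
    fix ab assume "ab \<in> ?I"
    then obtain a b where ab: "ab = (a, b)" "a < b" "(m(i := y)) a < (m(i := y)) b" by auto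
    then have "m b < m a" using assms by (simp add: decreasing_def)
    then consider "a = i" "b > i" "y < m b" "m b < m i" | "b = i" "a < i" "m a < y" "m i < m a"
      using ab by (fastforce split: if_splits)
    then show "ab \<in> ?f ` ?C"
    proof cases
      case 1
      then have "ab = ?f b" "b \<in> ?C" using ab by auto
      then show ?thesis by blast
    next
      case 2
      then have "ab = ?f a" "a \<in> ?C" using ab by auto
      then show ?thesis by blast
    qed
  next
    fix ab assume "ab \<in> ?f ` ?C"
    then obtain c where c: "ab = ?f c" "c \<in> ?C" by blast
    then have "c \<noteq> i" by auto
    then show "ab \<in> ?I"
      using c decreasing_less_iff[OF assms, of i c] decreasing_less_iff[OF assms, of c i]
      by (auto simp: min_def max_def split: if_splits)
  qed
  moreover have "inj_on ?f ?C"
    by (auto simp: inj_on_def split: if_splits)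
  moreover have "?R = m ` ?C" by auto
  moreover have "inj_on m ?C"
    using decreasing_inj[OF assms] by (rule inj_on_subset) simp
  ultimately show ?thesis by (simp only: card_image)
qed

lemma wedge_fun_upd:
  assumes "m \<in> fock_basis" "n \<in> fock_basis" "y \<noteq> m i"
  shows "wedge (m(i := y)) n =
    (if y \<notin> range m \<and> range n = insert y (range m - {m i})
     then (-1) ^ card {z \<in> range m. min y (m i) < z \<and> z < max y (m i)} else 0)"
proof -
  have "y \<in> m ` (- {i}) \<longleftrightarrow> y \<in> range m" using assms(3) by auto
  then show ?thesis
    using assms(2) decreasing_inj[OF fock_basis_decreasing[OF assms(1)]]
      card_inversions_fun_upd[OF fock_basis_decreasing[OF assms(1)], of i y]
    by (simp add: wedge_def inj_fun_upd_iff range_fun_upd del: fun_upd_apply)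
qed

lemma wedge_not_fock_basis: "n \<notin> fock_basis \<Longrightarrow> wedge m n = 0"
  by (simp add: wedge_def)

definition Jcoeff :: "int \<Rightarrow> (nat \<Rightarrow> int) \<Rightarrow> fock" where
  "Jcoeff k m n = Sum_any (\<lambda>i. wedge (m(i := m i - k)) n)"

lemma Sum_any_single:
  assumes "\<And>j. j \<noteq> i \<Longrightarrow> f j = 0"
  shows "Sum_any f = f i"
  using Sum_any.expand_superset[of "{i}" f] assms by auto

text \<open>Two decreasing sequences are related by a single move of size k in at most one way, and
  the reverse move relates them in the opposite direction. Both signs count the entries strictly
  between the two ends of the move, and these entries are common to \<open>m\<close> and
  \<open>n\<close>.\<close>

lemma Jcoeff_adjoint:
  assumes m: "m \<in> fock_basis" and n: "n \<in> fock_basis" and k: "k \<noteq> 0"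
  shows "Jcoeff (- k) m n = Jcoeff k n m"
proof -
  define P :: "int \<Rightarrow> (nat \<Rightarrow> int) \<Rightarrow> (nat \<Rightarrow> int) \<Rightarrow> nat \<Rightarrow> bool" where
    "P k m n i \<longleftrightarrow> m i - k \<notin> range m \<and> range n = insert (m i - k) (range m - {m i})" for k m n i
  have zero: "wedge (m(i := m i - k)) n = 0"
    if "m \<in> fock_basis" "n \<in> fock_basis" "k \<noteq> 0" "\<not> P k m n i" for k m n i
    using that by (subst wedge_fun_upd) (auto simp: P_def)
  have unique: "j = i" if "m \<in> fock_basis" "P k m n i" "P k m n j" "k \<noteq> 0" for k m n i j
  proof -
    have "range m - range n = {m i}" "range m - range n = {m j}"
      using that unfolding P_def by auto
    then show ?thesis
      using decreasing_inj[OF fock_basis_decreasing[OF that(1)]] by (auto simp: inj_eq)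
  qed
  have transfer: "\<exists>j. P (- k) n m j \<and> n j = m i - k"
    if P: "P k m n i" and k: "k \<noteq> 0" for k m n i
  proof -
    obtain j where "n j = m i - k" using P unfolding P_def by (metis insertI1 rangeE)
    then show ?thesis using P k unfolding P_def by (intro exI[of _ j]) auto
  qed
  show ?thesis
  proof (cases "\<exists>i. P k n m i")
    case True
    then obtain i where i: "P k n m i" by blast
    from transfer[OF i k] obtain j where j: "P (- k) m n j" "m j = n i - k" by auto
    have "Jcoeff (- k) m n = wedge (m(j := m j - (- k))) n"
      unfolding Jcoeff_def
      by (intro Sum_any_single zero) (use unique[OF m j(1)] m n k in auto)
    moreover have "Jcoeff k n m = wedge (n(i := n i - k)) m"
      unfolding Jcoeff_def
      by (intro Sum_any_single zero) (use unique[OF n i] m n k in auto)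
    moreover have "{z \<in> range m. min (n i) (m j) < z \<and> z < max (n i) (m j)} =
        {z \<in> range n. min (m j) (n i) < z \<and> z < max (m j) (n i)}"
      using i j(2) unfolding P_def by (auto simp: min_def max_def split: if_splits)
    ultimately show ?thesis
      using i j k m n by (simp add: wedge_fun_upd P_def del: fun_upd_apply)
  next
    case False
    then have "\<not> P (- k) m n j" for j
      using transfer[of "- k" m n j] k by auto
    then have "wedge (m(j := m j - (- k))) n = 0" for j
      using m n k by (intro zero) auto
    moreover have "wedge (n(i := n i - k)) m = 0" for i
      using False m n k by (intro zero) auto
    ultimately show ?thesis by (simp add: Jcoeff_def)
  qed
qed

section \<open>The finite sectors preserved by lowering currents\<close>

definition strict_partitions :: "nat \<Rightarrow> nat \<Rightarrow> nat list set" where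
  "strict_partitions l M = {a. strict_partition a \<and> length a = l \<and> set a \<subseteq> {..M}}"

lemma finite_strict_partitions: "finite (strict_partitions l M)"
  by (rule finite_subset[OF _ finite_lists_length_eq[of "{..M}" l]])
     (auto simp: strict_partitions_def)

lemma strict_partitionsD: "a \<in> strict_partitions l M \<Longrightarrow> strict_partition a"
  by (simp add: strict_partitions_def)

text \<open>The point is that one integer \<open>e\<close> serves both the wedge and every
  determinant: both vanish on a collision, and both change sign once for each part that the lowered
  part passes.\<close>

lemma ket_lower_part:
  assumes a: "a \<in> strict_partitions l M" and i: "i < l" and k: "k \<ge> 1" "k \<le> a ! i"
  obtains b and e :: int where
    "b \<in> strict_partitions l M"
    "\<And>n. ket (a[i := a ! i - k]) n = of_int e * of_bool (n = ket_seq b)"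
    "\<And>(v :: nat \<Rightarrow> nat \<Rightarrow> 'a :: comm_ring_1) cs.
       ldet (map v (a[i := a ! i - k])) cs = of_int e * ldet (map v b) cs"
proof (cases "distinct (a[i := a ! i - k])")
  case False
  then have "\<not> inj (ket_seq (a[i := a ! i - k]))"
    using inj_ket_seqD by blast
  then have "ket (a[i := a ! i - k]) n = 0" for n
    by (simp add: ket_def wedge_def)
  moreover have "ldet (map v (a[i := a ! i - k])) cs = 0" for v :: "nat \<Rightarrow> nat \<Rightarrow> 'a" and cs
    using False by (intro ldet_not_distinct) (auto simp: distinct_map)
  \<comment> \<open>With \<open>e = 0\<close> the list \<open>b\<close> only has to lie in the
    sector, so \<open>a\<close> itself is taken.\<close>
  ultimately show ?thesis using that[of a 0] a by simp
next
  case True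
  define p where "p = take i a"
  define x where "x = a ! i"
  define y where "y = x - k"
  define s where "s = drop (Suc i) a"
  \<comment> \<open>\<open>q\<close> holds the parts that \<open>y\<close> passes when the list is
    sorted again; its length determines the sign.\<close>
  define q where "q = takeWhile (\<lambda>z. z > y) s"
  define r where "r = dropWhile (\<lambda>z. z > y) s"
  have l: "length a = l" and sa: "strict_partition a" using a by (auto simp: strict_partitions_def)
  have a_eq: "a = p @ x # s"
    unfolding p_def x_def s_def using i l by (simp add: id_take_nth_drop)
  have s_eq: "s = q @ r" by (simp add: q_def r_def)
  have upd: "a[i := a ! i - k] = p @ y # q @ r"
    unfolding x_def[symmetric] y_def[symmetric] s_eq[symmetric]
    using i l by (simp add: p_def s_def upd_conv_take_nth_drop)
  have sorted: "sorted_wrt (>) (p @ x # q @ r)"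
    using sa unfolding a_eq s_eq strict_partition_def .
  have "y < x" using k by (simp add: y_def x_def)
  have q: "\<forall>z\<in>set q. y < z" by (auto simp: q_def dest: set_takeWhileD)
  have r: "\<forall>z\<in>set r. z < y"
  proof (cases r)
    case (Cons z t)
    have "\<not> z > y" using Cons by (auto simp: r_def dropWhile_eq_Cons_conv)
    moreover have "z \<noteq> y" using True unfolding upd Cons by auto
    ultimately show ?thesis using sorted unfolding Cons by (auto simp: sorted_wrt_append)
  qed simp
  define b where "b = p @ q @ y # r"
  have sb: "strict_partition b"
    using sorted q r \<open>y < x\<close> unfolding b_def strict_partition_def
    by (auto simp: sorted_wrt_append)
  have "set b \<subseteq> {..M}" "length b = l"
    using a \<open>y < x\<close> l unfolding b_def strict_partitions_def a_eq s_eq by auto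
  then have b: "b \<in> strict_partitions l M" using sb by (simp add: strict_partitions_def)
  have seq: "ket_seq (p @ y # q @ r) = (ket_seq a)(i := int y)"
    unfolding upd[symmetric] using i l by (auto simp: ket_seq_def fun_eq_iff y_def x_def)
  have "ket_seq a i = int x" using i l by (simp add: ket_seq_def x_def)
  have "{z \<in> range (ket_seq a). min (int y) (ket_seq a i) < z \<and> z < max (int y) (ket_seq a i)}
      = int ` set q"
  proof -
    have iff: "z \<in> set a \<and> y < z \<and> z < x \<longleftrightarrow> z \<in> set q" for z
      unfolding a_eq s_eq using sorted q r by (auto simp: sorted_wrt_append)
    have minmax: "min (int y) (int x) = int y" "max (int y) (int x) = int x"
      using \<open>y < x\<close> by auto
    show ?thesis
      unfolding \<open>ket_seq a i = int x\<close> range_ket_seq minmax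
    proof (intro set_eqI iffI)
      fix w assume "w \<in> {z \<in> int ` set a \<union> {..<0}. int y < z \<and> z < int x}"
      then obtain z where "w = int z" "z \<in> set a" "int y < w" "w < int x" by fastforce
      then show "w \<in> int ` set q" using iff[of z] by simp
    next
      fix w assume "w \<in> int ` set q"
      then obtain z where "w = int z" "z \<in> set q" by blast
      then show "w \<in> {z \<in> int ` set a \<union> {..<0}. int y < z \<and> z < int x}"
        using iff[of z] by simp
    qed
  qed
  moreover have "card (int ` set q) = length q"
    using True unfolding upd by (simp add: card_image distinct_card)
  ultimately have "card {(u, v). u < v \<and> ket_seq (p @ y # q @ r) u < ket_seq (p @ y # q @ r) v}
      = length q"
    unfolding seq by (subst card_inversions_fun_upd) (simp_all add: decreasing_ket_seq sa)
  moreover have "range (ket_seq (p @ y # q @ r)) = range (ket_seq b)"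
    by (auto simp: range_ket_seq b_def)
  moreover have "n \<in> fock_basis \<and> range n = range (ket_seq b) \<longleftrightarrow> n = ket_seq b" for n
    using decreasing_eqI[of n "ket_seq b"] ket_seq_fock_basis[OF sb]
    by (auto simp: fock_basis_decreasing)
  ultimately have ket: "ket (a[i := a ! i - k]) n = of_int ((-1) ^ length q) * of_bool (n = ket_seq b)" for n
    using inj_ket_seq[OF True] unfolding upd by (auto simp: ket_def wedge_def)
  have "ldet (map v (a[i := a ! i - k])) cs = of_int ((-1) ^ length q) * ldet (map v b) cs"
    for v :: "nat \<Rightarrow> nat \<Rightarrow> 'a" and cs
    unfolding upd b_def using ldet_move[of "map v p" "v y" "map v q" "map v r" cs] by simp
  then show ?thesis using that b ket by blast
qed

lemma Jcoeff_ket_seq: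
  assumes a: "a \<in> strict_partitions l M" and k: "k \<ge> 1"
  shows "Jcoeff (int k) (ket_seq a) n = (\<Sum>i | i < l \<and> k \<le> a ! i. ket (a[i := a ! i - k]) n)"
proof -
  have l: "length a = l" and sa: "strict_partition a" using a by (auto simp: strict_partitions_def)
  let ?m = "\<lambda>i. (ket_seq a)(i := ket_seq a i - int k)"
  \<comment> \<open>A negative entry, or a part smaller than k, moves to a negative level, and all
    of these are already occupied.\<close>
  have zero: "wedge (?m i) n = 0" if "\<not> (i < l \<and> k \<le> a ! i)" for i
  proof -
    have "ket_seq a i - int k < 0"
      using that k l by (auto simp: ket_seq_def)
    then have "ket_seq a i - int k \<in> range (ket_seq a)" by (simp add: range_ket_seq)
    then have "ket_seq a i - int k \<in> ket_seq a ` (- {i})" using k by auto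
    then have "\<not> inj (?m i)"
      by (subst inj_fun_upd_iff) (use sa in \<open>auto intro: decreasing_inj decreasing_ket_seq\<close>)
    then show ?thesis by (simp add: wedge_def)
  qed
  have "?m i = ket_seq (a[i := a ! i - k])" if "i < l" "k \<le> a ! i" for i
    using that l by (auto simp: ket_seq_def fun_eq_iff of_nat_diff)
  then have eq: "wedge (?m i) n = ket (a[i := a ! i - k]) n" if "i < l" "k \<le> a ! i" for i
    using that by (simp add: ket_def)
  have "Jcoeff (int k) (ket_seq a) n = (\<Sum>i | i < l \<and> k \<le> a ! i. wedge (?m i) n)"
    unfolding Jcoeff_def by (intro Sum_any.expand_superset) (use zero in auto)
  then show ?thesis using eq by simp
qed

lemma Jcoeff_ket_seq_large:
  assumes "a \<in> strict_partitions l M" "k > M"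
  shows "Jcoeff (int k) (ket_seq a) n = 0"
proof -
  have "{i. i < l \<and> k \<le> a ! i} = {}"
    using assms by (fastforce simp: strict_partitions_def dest: nth_mem)
  then show ?thesis using assms by (subst Jcoeff_ket_seq[OF assms(1)]) (auto simp del: Collect_empty_eq)
qed

lemma ket_lower_part_expand:
  assumes "a \<in> strict_partitions l M" "i < l" "k \<ge> 1" "k \<le> a ! i"
  shows "ket (a[i := a ! i - k]) n =
    (\<Sum>b\<in>strict_partitions l M. ket (a[i := a ! i - k]) (ket_seq b) * of_bool (n = ket_seq b))"
proof -
  obtain b and e :: int where b: "b \<in> strict_partitions l M"
    and e: "\<And>n. ket (a[i := a ! i - k]) n = of_int e * of_bool (n = ket_seq b)"
    using ket_lower_part[OF assms] by metis
  have "(\<Sum>c\<in>strict_partitions l M. ket (a[i := a ! i - k]) (ket_seq c) * of_bool (n = ket_seq c)) =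
      (\<Sum>c\<in>strict_partitions l M. if c = b then of_int e * of_bool (n = ket_seq b) else 0)"
    by (intro sum.cong) (auto simp: e ket_seq_eq_iff)
  also have "\<dots> = ket (a[i := a ! i - k]) n"
    using b by (subst sum.delta) (simp_all add: finite_strict_partitions e)
  finally show ?thesis ..
qed

lemma Jcoeff_expand:
  assumes "a \<in> strict_partitions l M" "k \<ge> 1"
  shows "Jcoeff (int k) (ket_seq a) n =
    (\<Sum>b\<in>strict_partitions l M. Jcoeff (int k) (ket_seq a) (ket_seq b) * of_bool (n = ket_seq b))"
  unfolding Jcoeff_ket_seq[OF assms] sum_distrib_right
  by (subst sum.swap, intro sum.cong refl ket_lower_part_expand) (use assms in auto)

lemma ldet_lower_part:
  fixes v :: "nat \<Rightarrow> nat \<Rightarrow> complex poly"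
  assumes "a \<in> strict_partitions l M" "i < l" "k \<ge> 1" "k \<le> a ! i"
  shows "ldet (map v (a[i := a ! i - k])) cs =
    (\<Sum>b\<in>strict_partitions l M. [:ket (a[i := a ! i - k]) (ket_seq b):] * ldet (map v b) cs)"
proof -
  obtain b and e :: int where b: "b \<in> strict_partitions l M"
    and e: "\<And>n. ket (a[i := a ! i - k]) n = of_int e * of_bool (n = ket_seq b)"
      "\<And>(v :: nat \<Rightarrow> nat \<Rightarrow> complex poly) cs.
        ldet (map v (a[i := a ! i - k])) cs = of_int e * ldet (map v b) cs"
    using ket_lower_part[OF assms] by metis
  have "(\<Sum>c\<in>strict_partitions l M. [:ket (a[i := a ! i - k]) (ket_seq c):] * ldet (map v c) cs) =
      (\<Sum>c\<in>strict_partitions l M. if c = b then of_int e * ldet (map v b) cs else 0)"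
    by (intro sum.cong) (auto simp: e ket_seq_eq_iff of_int_poly)
  also have "\<dots> = ldet (map v (a[i := a ! i - k])) cs"
    using b by (subst sum.delta) (simp_all add: finite_strict_partitions e)
  finally show ?thesis ..
qed

section \<open>Exponentials of currents\<close>

text \<open>The bound k \<le> M loses nothing on a sector with parts at most M: a larger shift kills
  each of its basis wedges.\<close>

definition Hmat :: "(nat \<Rightarrow> complex) \<Rightarrow> nat \<Rightarrow> nat list \<Rightarrow> nat list \<Rightarrow> complex" where
  "Hmat S M a b = (\<Sum>k=1..M. S k * Jcoeff (int k) (ket_seq a) (ket_seq b))"

fun Hpow :: "(nat \<Rightarrow> complex) \<Rightarrow> nat \<Rightarrow> nat \<Rightarrow> nat \<Rightarrow> nat list \<Rightarrow> nat list \<Rightarrow> complex" where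
  "Hpow S l M 0 a b = of_bool (a = b)"
| "Hpow S l M (Suc m) a b = (\<Sum>c\<in>strict_partitions l M. Hmat S M a c * Hpow S l M m c b)"

text \<open>Both recursions are needed. Applying \<open>H_plus\<close> once more adds a factor at
  the output index, whereas the differential equation and the adjoint treatment of
  \<open>H_minus\<close> add it at the index \<open>a\<close>.\<close>

lemma Hpow_Suc_right:
  assumes "a \<in> strict_partitions l M" "b \<in> strict_partitions l M"
  shows "Hpow S l M (Suc m) a b = (\<Sum>c\<in>strict_partitions l M. Hpow S l M m a c * Hmat S M c b)"
  using assms(1)
proof (induction m arbitrary: a)
  case 0
  have "(\<Sum>c\<in>strict_partitions l M. Hmat S M a c * of_bool (c = b)) = Hmat S M a b"
    using assms(2) finite_strict_partitions by (simp add: of_bool_def if_distrib cong: if_cong)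
  moreover have "(\<Sum>c\<in>strict_partitions l M. of_bool (a = c) * Hmat S M c b) = Hmat S M a b"
    using 0 finite_strict_partitions by (simp add: of_bool_def if_distrib[of "\<lambda>x. x * _"] cong: if_cong)
  ultimately show ?case by simp
next
  case (Suc m)
  let ?Y = "strict_partitions l M"
  have "Hpow S l M (Suc (Suc m)) a b = (\<Sum>c\<in>?Y. Hmat S M a c * (\<Sum>d\<in>?Y. Hpow S l M m c d * Hmat S M d b))"
    by (subst Hpow.simps(2)) (use Suc.IH in \<open>auto intro!: sum.cong simp del: Hpow.simps\<close>)
  also have "\<dots> = (\<Sum>d\<in>?Y. \<Sum>c\<in>?Y. Hmat S M a c * Hpow S l M m c d * Hmat S M d b)"
    by (subst sum.swap) (simp add: sum_distrib_left mult.assoc)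
  finally show ?case by (simp add: sum_distrib_right)
qed

lemma Hpow_outside:
  assumes "a \<in> strict_partitions l M" "b \<notin> strict_partitions l M"
  shows "Hpow S l M m a b = 0"
  using assms(1)
proof (induction m arbitrary: a)
  case 0
  then show ?case using assms(2) by auto
next
  case (Suc m)
  then show ?case by simp
qed

text \<open>The power series \<open>exp (t S(z))\<close> in \<open>z\<close>, whose coefficients are polynomials in \<open>t\<close>.\<close>

definition exp_series :: "complex fps \<Rightarrow> complex poly fps" where
  "exp_series S = Abs_fps (\<lambda>d. \<Sum>m\<le>d. monom ((S ^ m) $ d / fact m) m)"

lemma poly_exp_series_0: "poly (exp_series S $ d) 0 = (1 :: complex fps) $ d"
proof -
  have "poly (exp_series S $ d) 0 = (\<Sum>m\<le>d. if m = 0 then 1 $ d else 0)"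
    by (auto simp: exp_series_def poly_sum poly_monom intro!: sum.cong)
  then show ?thesis by simp
qed

lemma poly_exp_series_1: "poly (exp_series S $ d) 1 = (fps_exp 1 oo S) $ d"
  by (simp add: exp_series_def poly_sum poly_monom fps_compose_nth atMost_atLeast0)

text \<open>This is the equation d/dt exp (t S) = S exp (t S), read off in degree d. The vanishing
  constant term removes k = 0, and since S^m starts in degree m it also makes the different
  truncations of the sum over m agree.\<close>

lemma pderiv_exp_series:
  assumes S: "S $ 0 = 0"
  shows "pderiv (exp_series S $ d) = (\<Sum>k=1..d. [:S $ k:] * exp_series S $ (d - k))"
proof (cases d)
  case 0
  then show ?thesis by (simp add: exp_series_def pderiv_monom)
next
  case (Suc e)
  have fact: "of_nat (Suc m) * (c / fact (Suc m)) = c / (fact m :: complex)" for m c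
    by (simp del: of_nat_Suc)
  have "pderiv (exp_series S $ d) = (\<Sum>m\<le>Suc e. pderiv (monom ((S ^ m) $ d / fact m) m))"
    by (simp add: exp_series_def pderiv_sum Suc del: sum.atMost_Suc)
  also have "\<dots> = (\<Sum>m\<le>e. monom ((S ^ Suc m) $ d / fact m) m)"
    by (subst sum.atMost_Suc_shift) (simp add: pderiv_monom times_divide_eq_right[symmetric] fact
        del: times_divide_eq_right of_nat_Suc power_Suc fact_Suc)
  also have "\<dots> = (\<Sum>m\<le>e. \<Sum>k=1..d. [:S $ k:] * monom ((S ^ m) $ (d - k) / fact m) m)"
  proof (intro sum.cong refl)
    fix m
    have "(S ^ Suc m) $ d = (\<Sum>k=0..d. S $ k * (S ^ m) $ (d - k))"
      by (simp add: fps_mult_nth)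
    also have "\<dots> = (\<Sum>k=1..d. S $ k * (S ^ m) $ (d - k))"
      using S by (subst sum.atLeast_Suc_atMost) auto
    finally show "monom ((S ^ Suc m) $ d / fact m) m =
        (\<Sum>k=1..d. [:S $ k:] * monom ((S ^ m) $ (d - k) / fact m) m)"
      by (simp add: sum_divide_distrib monom_sum smult_monom flip: sum_distrib_left)
  qed
  also have "\<dots> = (\<Sum>k=1..d. [:S $ k:] * (\<Sum>m\<le>e. monom ((S ^ m) $ (d - k) / fact m) m))"
    by (subst sum.swap) (simp only: sum_distrib_left)
  also have "\<dots> = (\<Sum>k=1..d. [:S $ k:] * exp_series S $ (d - k))"
  proof (intro sum.cong refl arg_cong2[of _ _ _ _ "(*)"])
    fix k assume "k \<in> {1..d}"
    then have "{..d - k} \<subseteq> {..e}" using Suc by auto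
    moreover have "(S ^ m) $ (d - k) = 0" if "m \<in> {..e} - {..d - k}" for m
      using startsby_zero_power_prefix[OF S] that by auto
    ultimately show "(\<Sum>m\<le>e. monom ((S ^ m) $ (d - k) / fact m) m) = exp_series S $ (d - k)"
      unfolding exp_series_def fps_nth_Abs_fps
      by (intro sum.mono_neutral_right) auto
  qed
  finally show ?thesis .
qed

text \<open>The sum runs to n, beyond its nonzero terms k \<le> n - q, so that its range does not
  depend on the column q and it can be pulled out of a row of a determinant.\<close>

lemma pderiv_toeplitz_exp_series:
  assumes "S $ 0 = 0"
  shows "pderiv (toeplitz (exp_series S) n q) = (\<Sum>k=1..n. [:S $ k:] * toeplitz (exp_series S) (n - k) q)"
proof (cases "q \<le> n")
  case True
  have "(\<Sum>k=1..n. [:S $ k:] * toeplitz (exp_series S) (n - k) q) =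
      (\<Sum>k=1..n - q. [:S $ k:] * toeplitz (exp_series S) (n - k) q)"
    by (rule sum.mono_neutral_right) (use True in \<open>auto simp: toeplitz_def\<close>)
  also have "\<dots> = (\<Sum>k=1..n - q. [:S $ k:] * exp_series S $ (n - q - k))"
    by (intro sum.cong) (use True in \<open>auto simp: toeplitz_def add.commute\<close>)
  finally show ?thesis
    using True pderiv_exp_series[OF assms, of "n - q"] by (simp add: toeplitz_def)
next
  case False
  then show ?thesis unfolding toeplitz_def by (subst sum.neutral) auto
qed

lemma sum_const_poly: "(\<Sum>i\<in>I. [:f i:]) = [:\<Sum>i\<in>I. f i:]"
  by (induction I rule: infinite_finite_induct) auto

text \<open>Differentiating row \<open>a ! i\<close> replaces it by a combination of the rows
  \<open>a ! i - k\<close>, that is, lowers part i by k. Summed over i this is the k-th current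
  acting on \<open>a\<close>.\<close>

lemma pderiv_toeplitz_det:
  assumes S: "S $ 0 = 0" and a: "a \<in> strict_partitions l M"
  shows "pderiv (toeplitz_det (exp_series S) a cs) =
    (\<Sum>b\<in>strict_partitions l M. [:Hmat (fps_nth S) M a b:] * toeplitz_det (exp_series S) b cs)"
proof -
  let ?w = "toeplitz (exp_series S)" and ?Y = "strict_partitions l M"
  let ?K = "\<lambda>i. {k. 1 \<le> k \<and> k \<le> a ! i}"
  let ?I = "\<lambda>k. {i. i < l \<and> k \<le> a ! i}"
  have l: "length a = l" using a by (simp add: strict_partitions_def)
  have le: "a ! i \<le> M" if "i < l" for i
    using a that nth_mem[of i a] by (auto simp: strict_partitions_def simp del: nth_mem)
  have row: "ldet ((map ?w a)[i := (\<lambda>q. pderiv ((map ?w a ! i) q))]) cs =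
      (\<Sum>k\<in>?K i. \<Sum>b\<in>?Y. [:S $ k * ket (a[i := a ! i - k]) (ket_seq b):] * ldet (map ?w b) cs)"
    if "i < l" for i
  proof -
    have "(map ?w a)[i := (\<lambda>q. pderiv ((map ?w a ! i) q))] =
        take i (map ?w a) @ (\<lambda>q. \<Sum>k=1..a ! i. [:S $ k:] * ?w (a ! i - k) q) # drop (Suc i) (map ?w a)"
      using that l by (simp add: upd_conv_take_nth_drop pderiv_toeplitz_exp_series[OF S])
    then have "ldet ((map ?w a)[i := (\<lambda>q. pderiv ((map ?w a ! i) q))]) cs =
        (\<Sum>k=1..a ! i. [:S $ k:] * ldet (take i (map ?w a) @ ?w (a ! i - k) # drop (Suc i) (map ?w a)) cs)"
      by (simp only: ldet_sum finite_atLeastAtMost ldet_scale)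
    also have "\<dots> = (\<Sum>k\<in>?K i. [:S $ k:] * ldet (map ?w (a[i := a ! i - k])) cs)"
      using that l
      by (intro sum.cong refl) (auto simp: upd_conv_take_nth_drop take_map drop_map)
    also have "\<dots> = (\<Sum>k\<in>?K i. [:S $ k:] *
        (\<Sum>b\<in>?Y. [:ket (a[i := a ! i - k]) (ket_seq b):] * ldet (map ?w b) cs))"
      by (intro sum.cong refl arg_cong2[of _ _ _ _ "(*)"] ldet_lower_part) (use a that in auto)
    finally show ?thesis by (simp add: sum_distrib_left mult.commute[of "fps_nth S _"])
  qed
  have "pderiv (toeplitz_det (exp_series S) a cs) =
      (\<Sum>i<l. \<Sum>k\<in>?K i. \<Sum>b\<in>?Y. [:S $ k * ket (a[i := a ! i - k]) (ket_seq b):] * ldet (map ?w b) cs)"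
    unfolding toeplitz_det_def pderiv_ldet length_map l
    by (intro sum.cong refl row) auto
  also have "\<dots> = (\<Sum>k=1..M. \<Sum>i\<in>?I k. \<Sum>b\<in>?Y. [:S $ k * ket (a[i := a ! i - k]) (ket_seq b):] * ldet (map ?w b) cs)"
  proof -
    have "(\<Sum>i<l. sum (g i) (?K i)) = (\<Sum>i<l. \<Sum>k | k \<in> {1..M} \<and> k \<le> a ! i. g i k)" for g :: "nat \<Rightarrow> nat \<Rightarrow> complex poly"
      using le by (intro sum.cong arg_cong2[of _ _ _ _ sum] refl) force
    also have "\<dots> g = (\<Sum>k=1..M. \<Sum>i | i \<in> {..<l} \<and> k \<le> a ! i. g i k)" for g :: "nat \<Rightarrow> nat \<Rightarrow> complex poly"
      by (rule sum.swap_restrict) auto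
    finally show ?thesis by simp
  qed
  also have "\<dots> = (\<Sum>k=1..M. \<Sum>b\<in>?Y. [:S $ k * Jcoeff (int k) (ket_seq a) (ket_seq b):] * ldet (map ?w b) cs)"
  proof (intro sum.cong refl)
    fix k assume "k \<in> {1..M}"
    then have k: "k \<ge> 1" by simp
    have "[:S $ k * Jcoeff (int k) (ket_seq a) (ket_seq b):] =
        (\<Sum>i\<in>?I k. [:S $ k * ket (a[i := a ! i - k]) (ket_seq b):])" for b
      unfolding Jcoeff_ket_seq[OF a k] sum_distrib_left sum_const_poly ..
    then show "(\<Sum>i\<in>?I k. \<Sum>b\<in>?Y. [:S $ k * ket (a[i := a ! i - k]) (ket_seq b):] * ldet (map ?w b) cs)
        = (\<Sum>b\<in>?Y. [:S $ k * Jcoeff (int k) (ket_seq a) (ket_seq b):] * ldet (map ?w b) cs)"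
      by (subst sum.swap) (simp only: sum_distrib_right)
  qed
  also have "\<dots> = (\<Sum>b\<in>?Y. (\<Sum>k=1..M. [:S $ k * Jcoeff (int k) (ket_seq a) (ket_seq b):]) * ldet (map ?w b) cs)"
    by (subst sum.swap) (simp only: sum_distrib_right)
  finally show ?thesis by (simp only: toeplitz_det_def Hmat_def sum_const_poly)
qed

text \<open>At t = 0 the series is 1 and the minors form the identity matrix. Comparing coefficients
  in the linear differential equation then produces one factor \<open>Hmat\<close> and one division
  by m + 1 at each step.\<close>

lemma coeff_toeplitz_det:
  assumes S: "S $ 0 = 0" and "a \<in> strict_partitions l M" and b: "strict_partition b"
  shows "coeff (toeplitz_det (exp_series S) a b) m = Hpow (fps_nth S) l M m a b / fact m"
  using assms(2)
proof (induction m arbitrary: a)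
  case 0
  have "coeff (toeplitz_det (exp_series S) a b) 0 =
      ldet (map (\<lambda>n q. poly (toeplitz (exp_series S) n q) 0) a) b"
    by (simp add: toeplitz_det_def poly_ldet comp_def flip: poly_0_coeff_0)
  also have "(\<lambda>n q. poly (toeplitz (exp_series S) n q) 0) = toeplitz 1"
    by (simp add: toeplitz_def fun_eq_iff poly_exp_series_0)
  finally show ?case
    using toeplitz_det_1[OF strict_partitionsD[OF 0] b, where 'a = complex]
    by (simp add: toeplitz_det_def)
next
  case (Suc m)
  let ?F = "\<lambda>a. toeplitz_det (exp_series S) a b"
  have "of_nat (Suc m) * coeff (?F a) (Suc m) = coeff (pderiv (?F a)) m"
    by (simp add: coeff_pderiv)
  also have "\<dots> = (\<Sum>c\<in>strict_partitions l M. Hmat (fps_nth S) M a c * coeff (?F c) m)"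
    by (simp add: pderiv_toeplitz_det[OF S Suc.prems] coeff_sum)
  also have "\<dots> = Hpow (fps_nth S) l M (Suc m) a b / fact m"
    by (simp add: Suc.IH sum_divide_distrib)
  finally show ?case by (simp add: field_simps del: of_nat_Suc Hpow.simps)
qed

text \<open>The minor is a polynomial in t, so only finitely many powers contribute; the exponential
  is its value at t = 1.\<close>

lemma Sum_any_Hpow:
  assumes S: "S $ 0 = 0" and a: "a \<in> strict_partitions l M" and b: "strict_partition b"
  shows "Sum_any (\<lambda>m. Hpow (fps_nth S) l M m a b / fact m) = toeplitz_det (fps_exp 1 oo S) a b"
proof -
  let ?F = "toeplitz_det (exp_series S) a b"
  have "Sum_any (\<lambda>m. Hpow (fps_nth S) l M m a b / fact m) = Sum_any (coeff ?F)"
    by (simp add: coeff_toeplitz_det[OF S a b, abs_def])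
  also have "\<dots> = (\<Sum>m\<le>degree ?F. coeff ?F m)"
    by (rule Sum_any.expand_superset) (auto simp: le_degree)
  also have "\<dots> = poly ?F 1" by (simp add: poly_altdef)
  also have "\<dots> = ldet (map (\<lambda>n q. poly (toeplitz (exp_series S) n q) 1) a) b"
    by (simp add: toeplitz_det_def poly_ldet comp_def)
  also have "(\<lambda>n q. poly (toeplitz (exp_series S) n q) 1) = toeplitz (fps_exp 1 oo S)"
    by (simp add: toeplitz_def fun_eq_iff poly_exp_series_1)
  finally show ?thesis by (simp add: toeplitz_det_def)
qed

section \<open>Powers of the current operators on the Fock space\<close>

lemma J_Jcoeff: "J k v n = Sum_any (\<lambda>m. v m * Jcoeff k m n)"
  by (simp add: J_def Jcoeff_def)

lemma strict_partition_bound: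
  assumes "strict_partition a" "part a 0 \<le> M"
  shows "a \<in> strict_partitions (length a) M"
proof (cases a)
  case (Cons x xs)
  then have "x \<le> M" using assms(2) by (simp add: Defs.part_def)
  then show ?thesis
    using assms(1) Cons by (fastforce simp: strict_partitions_def strict_partition_def)
qed (use assms in \<open>simp add: strict_partitions_def\<close>)


lemma H_plus_power_ket:
  fixes s :: "nat \<Rightarrow> int \<Rightarrow> complex" and N :: nat
  assumes a: "a \<in> strict_partitions l M"
  defines "S \<equiv> \<lambda>k. \<Sum>j=1..N. s j (int k)"
  shows "(H_plus N s ^^ m) (ket a) =
    (\<lambda>n. \<Sum>b\<in>strict_partitions l M. Hpow S l M m a b * of_bool (n = ket_seq b))"
proof (induction m)
  case 0
  have "ket a n = (\<Sum>b\<in>strict_partitions l M. if a = b then of_bool (n = ket_seq a) else 0)" for n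
    using a by (simp add: ket_strict strict_partitionsD finite_strict_partitions)
  also have "\<dots> n = (\<Sum>b\<in>strict_partitions l M. Hpow S l M 0 a b * of_bool (n = ket_seq b))" for n
    by (intro sum.cong) auto
  finally show ?case by auto
next
  case (Suc m)
  let ?Y = "strict_partitions l M" and ?c = "Hpow S l M m a"
  define v where "v = (\<lambda>n. \<Sum>b\<in>?Y. ?c b * of_bool (n = ket_seq b))"
  have v_ket: "v (ket_seq b) = ?c b" if "b \<in> ?Y" for b
  proof -
    have "v (ket_seq b) = (\<Sum>d\<in>?Y. if b = d then ?c b else 0)"
      unfolding v_def by (intro sum.cong) (auto simp: ket_seq_eq_iff)
    then show ?thesis using that by (simp add: finite_strict_partitions)
  qed
  have J: "J (int k) v n = (\<Sum>b\<in>?Y. ?c b * Jcoeff (int k) (ket_seq b) n)" for k n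
  proof -
    have "v m = 0" if "m \<notin> ket_seq ` ?Y" for m
      using that unfolding v_def by (intro sum.neutral) auto
    then have "J (int k) v n = (\<Sum>m\<in>ket_seq ` ?Y. v m * Jcoeff (int k) m n)"
      unfolding J_Jcoeff by (intro Sum_any.expand_superset) (auto simp: finite_strict_partitions)
    also have "\<dots> = (\<Sum>b\<in>?Y. v (ket_seq b) * Jcoeff (int k) (ket_seq b) n)"
      by (subst sum.reindex) (auto simp: inj_on_def ket_seq_eq_iff)
    finally show ?thesis by (simp add: v_ket)
  qed
  have "J (int k) v n = 0" if "k > M" for k n
    unfolding J using Jcoeff_ket_seq_large that by (intro sum.neutral) auto
  then have "H_plus N s v n = (\<Sum>k=1..M. if k \<ge> 1 then \<Sum>j=1..N. s j (int k) * J (int k) v n else 0)" for n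
    unfolding H_plus_def
    by (intro Sum_any.expand_superset) (auto intro: ccontr simp: not_le[symmetric])
  also have "\<dots> n = (\<Sum>k=1..M. S k * J (int k) v n)" for n
    by (simp add: S_def sum_distrib_right)
  also have "\<dots> n = (\<Sum>k=1..M. \<Sum>b\<in>?Y. \<Sum>d\<in>?Y.
      S k * (?c b * Jcoeff (int k) (ket_seq b) (ket_seq d)) * of_bool (n = ket_seq d))" for n
  proof (intro sum.cong refl)
    fix k assume "k \<in> {1..M}"
    then have k: "k \<ge> 1" by simp
    have "S k * J (int k) v n = (\<Sum>b\<in>?Y. S k * (?c b *
      (\<Sum>d\<in>?Y. Jcoeff (int k) (ket_seq b) (ket_seq d) * of_bool (n = ket_seq d))))"
      unfolding J sum_distrib_left by (intro sum.cong refl) (subst Jcoeff_expand, use k in \<open>auto simp: sum_distrib_left\<close>)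
    then show "S k * J (int k) v n = (\<Sum>b\<in>?Y. \<Sum>d\<in>?Y.
      S k * (?c b * Jcoeff (int k) (ket_seq b) (ket_seq d)) * of_bool (n = ket_seq d))"
      by (simp only: sum_distrib_left mult.assoc)
  qed
  also have "\<dots> n = (\<Sum>d\<in>?Y. (\<Sum>b\<in>?Y. ?c b * Hmat S M b d) * of_bool (n = ket_seq d))" for n
  proof -
    have "(\<Sum>k=1..M. \<Sum>b\<in>?Y. \<Sum>d\<in>?Y. f k b d) = (\<Sum>d\<in>?Y. \<Sum>b\<in>?Y. \<Sum>k=1..M. f k b d)"
      for f :: "nat \<Rightarrow> nat list \<Rightarrow> nat list \<Rightarrow> complex"
      by (subst (2) sum.swap, subst sum.swap, subst (2) sum.swap) (rule refl)
    then show ?thesis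
      by (simp add: Hmat_def sum_distrib_left sum_distrib_right mult_ac)
  qed
  also have "\<dots> n = (\<Sum>d\<in>?Y. Hpow S l M (Suc m) a d * of_bool (n = ket_seq d))" for n
    by (intro sum.cong refl arg_cong2[of _ _ _ _ "(*)"] Hpow_Suc_right[symmetric] a)
  finally show ?case using Suc.IH by (simp add: v_def del: Hpow.simps)
qed

text \<open>The vector itself may be an infinite combination, so only its coefficients at sequences
  of one sector are followed. By adjointness a new coefficient at \<open>a\<close> involves only old
  coefficients at the wedges reached from \<open>a\<close> by lowering, and these stay in the
  sector.\<close>

lemma H_minus_power_ket:
  fixes s :: "nat \<Rightarrow> int \<Rightarrow> complex" and N :: nat
  assumes b: "strict_partition b"
  defines "S \<equiv> \<lambda>k. \<Sum>j=1..N. s j (- int k)"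
  shows "a \<in> strict_partitions l M \<Longrightarrow> (H_minus N s ^^ m) (ket b) (ket_seq a) = Hpow S l M m a b"
proof (induction m arbitrary: a)
  case 0
  then show ?case using b by (auto simp: ket_strict ket_seq_eq_iff)
next
  case (Suc m)
  let ?Y = "strict_partitions l M"
  define v where "v = (H_minus N s ^^ m) (ket b)"
  \<comment> \<open>\<open>J\<close> sums over all sequences, while adjointness is available only
    inside \<open>fock_basis\<close>.\<close>
  have v_zero: "v n = 0" if n: "n \<notin> fock_basis" for n
  proof (cases m)
    case 0
    then show ?thesis using n by (simp add: v_def ket_def wedge_not_fock_basis)
  next
    case (Suc m')
    have "J k w n = 0" for k w
      using n by (simp add: J_def wedge_not_fock_basis)
    then show ?thesis by (simp add: v_def Suc H_minus_def cong: if_cong)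
  qed
  have J: "J (- int k) v (ket_seq a) = (\<Sum>d\<in>?Y. Jcoeff (int k) (ket_seq a) (ket_seq d) * v (ket_seq d))"
    if k: "k \<ge> 1" for k
  proof -
    have eq: "v m * Jcoeff (- int k) m (ket_seq a) = Jcoeff (int k) (ket_seq a) m * v m" for m
      using Jcoeff_adjoint[of m "ket_seq a" "int k"] v_zero[of m] k
        ket_seq_fock_basis[OF strict_partitionsD[OF Suc.prems]]
      by (cases "m \<in> fock_basis") auto
    have "Jcoeff (int k) (ket_seq a) m = 0" if "m \<notin> ket_seq ` ?Y" for m
      by (subst Jcoeff_expand[OF Suc.prems k]) (use that in \<open>auto intro!: sum.neutral\<close>)
    then have "J (- int k) v (ket_seq a) = (\<Sum>m\<in>ket_seq ` ?Y. Jcoeff (int k) (ket_seq a) m * v m)"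
      unfolding J_Jcoeff eq by (intro Sum_any.expand_superset) (auto simp: finite_strict_partitions)
    then show ?thesis
      by (subst (asm) sum.reindex) (auto simp: inj_on_def ket_seq_eq_iff)
  qed
  have "J (- int k) v (ket_seq a) = 0" if "k > M" for k
    using that J[of k] Jcoeff_ket_seq_large[OF Suc.prems] by simp
  then have "H_minus N s v (ket_seq a) =
      (\<Sum>k=1..M. if k \<ge> 1 then \<Sum>j=1..N. s j (- int k) * J (- int k) v (ket_seq a) else 0)"
    unfolding H_minus_def
    by (intro Sum_any.expand_superset) (auto intro: ccontr simp: not_le[symmetric])
  also have "\<dots> = (\<Sum>k=1..M. \<Sum>d\<in>?Y. S k * Jcoeff (int k) (ket_seq a) (ket_seq d) * v (ket_seq d))"
    by (intro sum.cong refl) (simp add: S_def J sum_distrib_left[symmetric] sum_distrib_right[symmetric] mult.assoc)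
  also have "\<dots> = (\<Sum>d\<in>?Y. Hmat S M a d * v (ket_seq d))"
    by (subst sum.swap) (simp add: Hmat_def sum_distrib_right)
  also have "\<dots> = (\<Sum>d\<in>?Y. Hmat S M a d * Hpow S l M m d b)"
    by (intro sum.cong refl) (simp add: v_def Suc.IH)
  finally show ?case by (simp add: v_def)
qed

theorem matrix_coeff_exp_H_plus:
  assumes a: "strict_partition a" and b: "strict_partition b"
    and S: "S $ 0 = 0" "\<And>k. k \<ge> 1 \<Longrightarrow> S $ k = (\<Sum>j=1..N. s j (int k))"
  shows "matrix_coeff b (exp_op (H_plus N s)) a = toeplitz_det (fps_exp 1 oo S) a b"
proof -
  let ?l = "length a" and ?M = "part a 0"
  define S' where "S' = (\<lambda>k. \<Sum>j=1..N. s j (int k))"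
  have aY: "a \<in> strict_partitions ?l ?M" by (rule strict_partition_bound[OF a]) simp
  \<comment> \<open>The two sequences may differ at k = 0, which \<open>Hmat\<close> never
    reads.\<close>
  have Hpow: "Hpow S' ?l ?M m c d = Hpow (fps_nth S) ?l ?M m c d" for m c d
    by (induction m arbitrary: c) (auto simp: Hmat_def S S'_def)
  have "(H_plus N s ^^ m) (ket a) (ket_seq b) = Hpow (fps_nth S) ?l ?M m a b" for m
  proof -
    have "(H_plus N s ^^ m) (ket a) (ket_seq b) =
        (\<Sum>d\<in>strict_partitions ?l ?M. if b = d then Hpow S' ?l ?M m a b else 0)"
      unfolding H_plus_power_ket[OF aY] S'_def[symmetric]
      by (intro sum.cong refl) (auto simp: ket_seq_eq_iff)
    \<comment> \<open>If \<open>b\<close> lies outside the sector of \<open>a\<close>, the sum has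
      no term for it, and \<open>Hpow_outside\<close> makes the other side vanish as well.\<close>
    then show ?thesis
      using Hpow_outside[OF aY, of b] by (simp add: finite_strict_partitions Hpow)
  qed
  then show ?thesis
    using Sum_any_Hpow[OF S(1) aY b] by (simp add: matrix_coeff_def exp_op_def)
qed

theorem matrix_coeff_exp_H_minus:
  assumes a: "strict_partition a" and b: "strict_partition b"
    and S: "S $ 0 = 0" "\<And>k. k \<ge> 1 \<Longrightarrow> S $ k = (\<Sum>j=1..N. s j (- int k))"
  shows "matrix_coeff a (exp_op (H_minus N s)) b = toeplitz_det (fps_exp 1 oo S) a b"
proof -
  let ?l = "length a" and ?M = "part a 0"
  define S' where "S' = (\<lambda>k. \<Sum>j=1..N. s j (- int k))"
  have aY: "a \<in> strict_partitions ?l ?M" by (rule strict_partition_bound[OF a]) simp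
  have "Hpow S' ?l ?M m c d = Hpow (fps_nth S) ?l ?M m c d" for m c d
    by (induction m arbitrary: c) (auto simp: Hmat_def S S'_def)
  then have "(H_minus N s ^^ m) (ket b) (ket_seq a) = Hpow (fps_nth S) ?l ?M m a b" for m
    using H_minus_power_ket[OF b aY] by (simp add: S'_def)
  then show ?thesis
    using Sum_any_Hpow[OF S(1) aY b] by (simp add: matrix_coeff_def exp_op_def)
qed

section \<open>Row transfer and grids\<close>

definition desc_list :: "nat set \<Rightarrow> nat list" where
  "desc_list A = rev (sorted_list_of_set A)"

lemma desc_list_empty [simp]: "desc_list {} = []"
  by (simp add: desc_list_def)

lemma desc_list_set:
  assumes "strict_partition a"
  shows "desc_list (set a) = a"
proof -
  have "sorted (rev a)" "distinct (rev a)"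
    using assms strict_sorted_iff[of "rev a"] by (simp_all add: strict_partition_def sorted_wrt_rev)
  then have "sorted_list_of_set (set (rev a)) = rev a"
    by (rule sorted_list_of_set.idem_if_sorted_distinct)
  then show ?thesis by (simp add: desc_list_def)
qed

lemma strict_partition_desc_list: "strict_partition (desc_list A)"
  by (simp add: strict_partition_def desc_list_def sorted_wrt_rev)

lemma set_desc_list: "finite A \<Longrightarrow> set (desc_list A) = A"
  by (simp add: desc_list_def)

lemma desc_list_insert:
  assumes "A \<subseteq> {..<m}"
  shows "desc_list (insert m A) = m # desc_list A"
proof -
  have "finite A" using assms finite_subset by blast
  moreover from this have "strict_partition (m # desc_list A)"
    using assms strict_partition_desc_list[of A] set_desc_list[of A]
    by (auto simp: strict_partition_def)
  ultimately show ?thesis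
    using desc_list_set[of "m # desc_list A"] set_desc_list[of A] by simp
qed

section \<open>Transfer weights of one row\<close>

definition vertex_weight :: "(vertex \<Rightarrow> complex) \<Rightarrow> vertex option \<Rightarrow> complex" where
  "vertex_weight f x = (case x of None \<Rightarrow> 0 | Some t \<Rightarrow> f t)"

definition spin_of :: "nat set \<Rightarrow> nat \<Rightarrow> spin" where
  "spin_of A c = (if c \<in> A then Minus else Plus)"

text \<open>Only the first m columns are summed: \<open>s\<close> is the spin to their right, and
  \<open>A\<close> and \<open>B\<close> are the columns with a minus spin below and above the
  row.\<close>

fun row_Z :: "(vertex \<Rightarrow> complex) \<Rightarrow> nat \<Rightarrow> spin \<Rightarrow> nat set \<Rightarrow> nat set \<Rightarrow> complex" where
  "row_Z f 0 s A B = of_bool (s = Plus)"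
| "row_Z f (Suc m) s A B =
     row_Z f m Plus A B * vertex_weight f (vertex_S Plus (spin_of B m) s (spin_of A m)) +
     row_Z f m Minus A B * vertex_weight f (vertex_S Minus (spin_of B m) s (spin_of A m))"

lemma row_Z_simps:
  "row_Z f (Suc m) Plus A B =
     (if m \<in> A then if m \<in> B then row_Z f m Plus A B * f B1 else row_Z f m Minus A B * f C1
      else if m \<in> B then 0 else row_Z f m Plus A B * f A1)"
  "row_Z f (Suc m) Minus A B =
     (if m \<in> A then if m \<in> B then row_Z f m Minus A B * f A2 else 0
      else if m \<in> B then row_Z f m Plus A B * f C2 else row_Z f m Minus A B * f B2)"
  by (auto simp: spin_of_def vertex_weight_def)

lemma row_Z_cong:
  "A \<inter> {..<m} = A' \<inter> {..<m} \<Longrightarrow> B \<inter> {..<m} = B' \<inter> {..<m} \<Longrightarrow> row_Z f m s A B = row_Z f m s A' B'"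
proof (induction m arbitrary: s)
  case (Suc m)
  then have "A \<inter> {..<m} = A' \<inter> {..<m}" "B \<inter> {..<m} = B' \<inter> {..<m}"
    "m \<in> A \<longleftrightarrow> m \<in> A'" "m \<in> B \<longleftrightarrow> m \<in> B'"
    by (auto simp: set_eq_iff less_Suc_eq)
  then show ?case using Suc.IH by (simp add: spin_of_def)
qed simp

lemma card_Int_lessThan_Suc:
  "card (A \<inter> {..<Suc m}) = card (A \<inter> {..<m}) + of_bool (m \<in> A)"
  by (auto simp: lessThan_Suc Int_insert_right)

text \<open>Ice rule: an admissible vertex has as many minus spins on its left and top edges as on
  its right and bottom edges, and the left boundary spin of the row is plus.\<close>

lemma row_Z_nonzero_card:
  "row_Z f m s A B \<noteq> 0 \<Longrightarrow> card (B \<inter> {..<m}) = card (A \<inter> {..<m}) + of_bool (s = Minus)"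
proof (induction m arbitrary: s)
  case (Suc m)
  show ?case
    using Suc.prems Suc.IH[of Plus] Suc.IH[of Minus]
    by (cases s) (auto simp: row_Z_simps card_Int_lessThan_Suc split: if_splits simp del: row_Z.simps)
qed (simp split: if_splits)

text \<open>The normalisation a1 = b1 = 1, under which the free fermion condition becomes
  \<open>c * d = x + y\<close>.\<close>

definition row_weights :: "complex \<Rightarrow> complex \<Rightarrow> complex \<Rightarrow> complex \<Rightarrow> vertex \<Rightarrow> complex" where
  "row_weights x y c d t = (case t of A1 \<Rightarrow> 1 | A2 \<Rightarrow> y | B1 \<Rightarrow> 1 | B2 \<Rightarrow> x | C1 \<Rightarrow> c | C2 \<Rightarrow> d)"

lemma sum_Pow_lessThan_Suc:
  fixes m :: nat
  shows "(\<Sum>B\<in>Pow {..<Suc m}. f B) = (\<Sum>B\<in>Pow {..<m}. f B) + (\<Sum>B\<in>Pow {..<m}. f (insert m B))"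
proof -
  have "(\<Sum>B\<in>Pow {..<Suc m}. f B) = (\<Sum>B\<in>Pow {..<m}. f B) + (\<Sum>B\<in>insert m ` Pow {..<m}. f B)"
    unfolding lessThan_Suc Pow_insert by (rule sum.union_disjoint) auto
  also have "(\<Sum>B\<in>insert m ` Pow {..<m}. f B) = (\<Sum>B\<in>Pow {..<m}. f (insert m B))"
    by (subst sum.reindex) (auto simp: inj_on_def)
  finally show ?thesis .
qed

text \<open>
  A row acts on wedges of arbitrary vectors, \<open>v n\<close> being sent to \<open>w n\<close>; the vector \<open>u m\<close>
  stands for the path which leaves the first \<open>m\<close> columns on the right. Free fermionicity enters
  where two such paths meet in a vertex of type \<open>A2\<close>.
\<close>

lemma sum_row_Z_ldet:
  assumes ff: "c * d = x + y"
    and u: "u 0 = (\<lambda>q. 0)" "\<And>n. u (Suc n) = (\<lambda>q. x * u n q + d * v n q)"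
    and w: "\<And>n. w n = (\<lambda>q. v n q + c * u n q)"
  defines "f \<equiv> row_weights x y c d"
  shows "(\<Sum>B\<in>Pow {..<m}. row_Z f m Plus A B * ldet (p @ map v (desc_list B)) cs) =
      ldet (p @ map w (desc_list (A \<inter> {..<m}))) cs \<and>
    (\<Sum>B\<in>Pow {..<m}. row_Z f m Minus A B * ldet (p @ map v (desc_list B)) cs) =
      ldet (p @ u m # map w (desc_list (A \<inter> {..<m}))) cs"
\<comment> \<open>\<open>desc_list\<close> puts the largest column first, so \<open>p\<close> must
  be able to absorb the factors of the columns further to the right.\<close>
proof (induction m arbitrary: p)
  case 0
  then show ?case by (simp add: u ldet_zero)
next
  case (Suc m)
  let ?A = "map w (desc_list (A \<inter> {..<m}))"
  let ?S = "\<lambda>s p. \<Sum>B\<in>Pow {..<m}. row_Z f m s A B * ldet (p @ map v (desc_list B)) cs"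
  have f: "f A1 = 1" "f A2 = y" "f B1 = 1" "f B2 = x" "f C1 = c" "f C2 = d"
    by (simp_all add: f_def row_weights_def)
  have IH: "?S Plus p = ldet (p @ ?A) cs" "?S Minus p = ldet (p @ u m # ?A) cs" for p
    using Suc.IH by auto
  have split: "(\<Sum>B\<in>Pow {..<Suc m}. row_Z f (Suc m) s A B * ldet (p @ map v (desc_list B)) cs) =
     (\<Sum>B\<in>Pow {..<m}. row_Z f (Suc m) s A B * ldet (p @ map v (desc_list B)) cs) +
     (\<Sum>B\<in>Pow {..<m}. row_Z f (Suc m) s A (insert m B) * ldet ((p @ [v m]) @ map v (desc_list B)) cs)"
    for s
    by (auto simp: sum_Pow_lessThan_Suc desc_list_insert intro!: sum.cong simp del: row_Z.simps)
  have ins: "row_Z f m s A (insert m B) = row_Z f m s A B" for s B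
    by (rule row_Z_cong) auto
  have row:
    "row_Z f (Suc m) Plus A B = (if m \<in> A then c * row_Z f m Minus A B else row_Z f m Plus A B)"
    "row_Z f (Suc m) Plus A (insert m B) = (if m \<in> A then row_Z f m Plus A B else 0)"
    "row_Z f (Suc m) Minus A B = (if m \<in> A then 0 else x * row_Z f m Minus A B)"
    "row_Z f (Suc m) Minus A (insert m B) =
      (if m \<in> A then y * row_Z f m Minus A B else d * row_Z f m Plus A B)"
    if "B \<in> Pow {..<m}" for B
    using that by (auto simp: row_Z_simps ins f simp del: row_Z.simps)
  have sums:
    "(\<Sum>B\<in>Pow {..<m}. row_Z f (Suc m) Plus A B * ldet (p @ map v (desc_list B)) cs) =
      (if m \<in> A then c * ?S Minus p else ?S Plus p)"
    "(\<Sum>B\<in>Pow {..<m}. row_Z f (Suc m) Plus A (insert m B) * ldet (p @ map v (desc_list B)) cs) =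
      (if m \<in> A then ?S Plus p else 0)"
    "(\<Sum>B\<in>Pow {..<m}. row_Z f (Suc m) Minus A B * ldet (p @ map v (desc_list B)) cs) =
      (if m \<in> A then 0 else x * ?S Minus p)"
    "(\<Sum>B\<in>Pow {..<m}. row_Z f (Suc m) Minus A (insert m B) * ldet (p @ map v (desc_list B)) cs) =
      (if m \<in> A then y * ?S Minus p else d * ?S Plus p)"
    for p
    by (auto simp: row sum_distrib_left mult.assoc intro!: sum.cong sum.neutral simp del: row_Z.simps)
  show ?case
  proof (cases "m \<in> A")
    case True
    then have A: "map w (desc_list (A \<inter> {..<Suc m})) = w m # ?A"
      by (simp add: lessThan_Suc Int_insert_right desc_list_insert)
    have "(\<Sum>B\<in>Pow {..<Suc m}. row_Z f (Suc m) Plus A B * ldet (p @ map v (desc_list B)) cs) =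
        c * ?S Minus p + ?S Plus (p @ [v m])"
      unfolding split sums using True by simp
    also have "\<dots> = ldet (p @ w m # ?A) cs"
      unfolding IH w ldet_add ldet_scale by simp
    finally have P: "(\<Sum>B\<in>Pow {..<Suc m}. row_Z f (Suc m) Plus A B * ldet (p @ map v (desc_list B)) cs) =
        ldet (p @ w m # ?A) cs" .
    have "(\<Sum>B\<in>Pow {..<Suc m}. row_Z f (Suc m) Minus A B * ldet (p @ map v (desc_list B)) cs) =
        y * ?S Minus (p @ [v m])"
      unfolding split sums using True by simp
    also have "\<dots> = y * ldet (p @ v m # u m # ?A) cs"
      unfolding IH by simp
    \<comment> \<open>Antisymmetry turns \<open>y = c * d - x\<close> into two terms: the path
      carried on with weight x past the new factor, and a fresh path started with weight d while the
      old one ends with weight c.\<close>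
    also have "\<dots> = x * ldet (p @ u m # v m # ?A) cs + d * (c * ldet (p @ v m # u m # ?A) cs)"
      using ff by (subst ldet_swap[of p "u m"]) (simp add: algebra_simps flip: ring_distribs)
    also have "\<dots> = ldet (p @ u (Suc m) # w m # ?A) cs"
    proof -
      have "ldet (p @ u m # w m # ?A) cs = ldet (p @ u m # v m # ?A) cs"
        using ldet_add[of "p @ [u m]" "v m" "\<lambda>q. c * u m q" ?A cs]
          ldet_scale[of "p @ [u m]" c "u m" ?A cs]
        by (simp add: w[of m] ldet_adjacent_equal)
      moreover have "ldet (p @ v m # w m # ?A) cs = c * ldet (p @ v m # u m # ?A) cs"
        using ldet_add[of "p @ [v m]" "v m" "\<lambda>q. c * u m q" ?A cs]
          ldet_scale[of "p @ [v m]" c "u m" ?A cs]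
        by (simp add: w[of m] ldet_adjacent_equal)
      ultimately show ?thesis
        unfolding u(2)[of m] ldet_add ldet_scale by simp
    qed
    finally show ?thesis using P A by simp
  next
    case False
    then have A: "A \<inter> {..<Suc m} = A \<inter> {..<m}"
      by (simp add: lessThan_Suc)
    have "(\<Sum>B\<in>Pow {..<Suc m}. row_Z f (Suc m) Plus A B * ldet (p @ map v (desc_list B)) cs) = ?S Plus p"
      unfolding split sums using False by simp
    moreover have "(\<Sum>B\<in>Pow {..<Suc m}. row_Z f (Suc m) Minus A B * ldet (p @ map v (desc_list B)) cs) =
        x * ?S Minus p + d * ?S Plus (p @ [v m])"
      unfolding split sums using False by simp
    ultimately show ?thesis
      unfolding A IH u ldet_add ldet_scale by simp
  qed
qed

definition row_series :: "complex \<Rightarrow> complex \<Rightarrow> complex fps" where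
  "row_series x y = (1 + fps_const y * fps_X) * inverse (1 - fps_const x * fps_X)"

lemma inverse_row_denominator:
  "inverse (1 - fps_const x * fps_X) * (1 - fps_const x * fps_X) = (1 :: complex fps)"
  by (rule inverse_mult_eq_1) simp

lemma sum_row_Z_toeplitz_det:
  assumes ff: "c * d = x + y" and A: "A \<subseteq> {..<m}"
  shows "(\<Sum>B\<in>Pow {..<m}. row_Z (row_weights x y c d) m Plus A B * toeplitz_det g (desc_list B) cs) =
    toeplitz_det (g * row_series x y) (desc_list A) cs"
proof -
  \<comment> \<open>The series of a path: it enters with weight d and picks up x in each column it
    crosses. It leaves with weight c one column later, so F is g times 1 + c d z / (1 - x z), and
    \<open>c * d = x + y\<close> turns this into (1 + y z) / (1 - x z).\<close>
  define U where "U = fps_const d * g * inverse (1 - fps_const x * fps_X)"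
  define F where "F = g + fps_const c * fps_X * U"
  have dg: "toeplitz (fps_const d * g) n = (\<lambda>q. d * toeplitz g n q)" for n
    by (auto simp: toeplitz_def)
  have "U * (1 - fps_const x * fps_X) = fps_const d * g"
    by (simp add: U_def mult.assoc inverse_row_denominator)
  then have U: "U = fps_const d * g + fps_const x * fps_X * U"
    by (simp add: algebra_simps)
  define u where "u n = (case n of 0 \<Rightarrow> \<lambda>q. 0 | Suc k \<Rightarrow> toeplitz U k)" for n
  have u: "u 0 = (\<lambda>q. 0)" "u (Suc n) = (\<lambda>q. x * u n q + d * toeplitz g n q)" for n
    using toeplitz_shift[OF U] by (cases n; simp add: u_def dg add.commute)+
  have w: "toeplitz F n = (\<lambda>q. toeplitz g n q + c * u n q)" for n
    using toeplitz_shift[OF F_def] by (cases n) (simp_all add: u_def)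
  let ?i = "inverse (1 - fps_const x * fps_X :: complex fps)"
  have "F = g * (?i * (1 - fps_const x * fps_X)) + fps_const (c * d) * fps_X * g * ?i"
    unfolding inverse_row_denominator F_def U_def by (simp add: mult_ac flip: fps_const_mult)
  also have "\<dots> = g * row_series x y"
    unfolding ff row_series_def by (simp add: algebra_simps flip: fps_const_add)
  finally have "F = g * row_series x y" .
  moreover have "A \<inter> {..<m} = A" using A by auto
  ultimately show ?thesis
    using sum_row_Z_ldet[OF ff u w, where p = "[]" and m = m and A = A and cs = cs]
    by (simp add: toeplitz_det_def)
qed

text \<open>Rows are stacked upwards: \<open>A\<close> lies below row 1 and \<open>B\<close> above
  row N.\<close>

fun grid_Z :: "(nat \<Rightarrow> vertex \<Rightarrow> complex) \<Rightarrow> nat \<Rightarrow> nat \<Rightarrow> nat set \<Rightarrow> nat set \<Rightarrow> complex" where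
  "grid_Z f m 0 A B = of_bool (A = B)"
| "grid_Z f m (Suc N) A B = (\<Sum>C\<in>Pow {..<m}. grid_Z f m N A C * row_Z (f (Suc N)) m Plus C B)"

text \<open>The top row acts on the minors directly and multiplies their series by its own factor,
  so \<open>g\<close> has to be arbitrary in the induction.\<close>

lemma sum_grid_Z_toeplitz_det:
  assumes ff: "\<And>i. i \<ge> 1 \<Longrightarrow> c i * d i = x i + y i" and A: "A \<subseteq> {..<m}"
  shows "(\<Sum>B\<in>Pow {..<m}. grid_Z (\<lambda>i. row_weights (x i) (y i) (c i) (d i)) m N A B *
      toeplitz_det g (desc_list B) cs) =
    toeplitz_det (g * (\<Prod>i=1..N. row_series (x i) (y i))) (desc_list A) cs"
proof (induction N arbitrary: g)
  case 0
  have "(\<Sum>B\<in>Pow {..<m}. of_bool (A = B) * toeplitz_det g (desc_list B) cs) =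
      (\<Sum>B\<in>Pow {..<m}. if A = B then toeplitz_det g (desc_list B) cs else 0)"
    by (intro sum.cong) auto
  then show ?case using A by simp
next
  case (Suc N)
  let ?f = "\<lambda>i. row_weights (x i) (y i) (c i) (d i)"
  have "(\<Sum>B\<in>Pow {..<m}. grid_Z ?f m (Suc N) A B * toeplitz_det g (desc_list B) cs) =
      (\<Sum>C\<in>Pow {..<m}. grid_Z ?f m N A C *
        (\<Sum>B\<in>Pow {..<m}. row_Z (?f (Suc N)) m Plus C B * toeplitz_det g (desc_list B) cs))"
    unfolding grid_Z.simps sum_distrib_right sum_distrib_left
    by (subst sum.swap) (simp add: mult.assoc)
  also have "\<dots> = (\<Sum>C\<in>Pow {..<m}. grid_Z ?f m N A C *
        toeplitz_det (g * row_series (x (Suc N)) (y (Suc N))) (desc_list C) cs)"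
    by (intro sum.cong refl arg_cong2[of _ _ _ _ "(*)"] sum_row_Z_toeplitz_det ff) auto
  also have "\<dots> = toeplitz_det (g * row_series (x (Suc N)) (y (Suc N)) *
      (\<Prod>i=1..N. row_series (x i) (y i))) (desc_list A) cs"
    by (rule Suc.IH)
  finally show ?case by (simp add: mult_ac)
qed

text \<open>For g = 1 the minors form the identity matrix, so the weighted sum over the top boundary
  isolates the single entry with boundary \<open>set b\<close>.\<close>

lemma grid_Z_toeplitz_det:
  assumes ff: "\<And>i. i \<ge> 1 \<Longrightarrow> c i * d i = x i + y i"
    and a: "strict_partition a" "set a \<subseteq> {..<m}" and b: "strict_partition b" "set b \<subseteq> {..<m}"
  shows "grid_Z (\<lambda>i. row_weights (x i) (y i) (c i) (d i)) m N (set a) (set b) =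
    toeplitz_det (\<Prod>i=1..N. row_series (x i) (y i)) a b"
proof -
  let ?Z = "grid_Z (\<lambda>i. row_weights (x i) (y i) (c i) (d i)) m N (set a)"
  have "?Z B * toeplitz_det 1 (desc_list B) b = (if set b = B then ?Z (set b) else 0)"
    if "B \<in> Pow {..<m}" for B
  proof -
    have "desc_list B = b \<longleftrightarrow> set b = B"
      using that finite_subset[of B "{..<m}"] set_desc_list[of B] desc_list_set[OF b(1)] by auto
    then show ?thesis
      using b toeplitz_det_1[OF strict_partition_desc_list b(1), of B, where 'a = complex] by auto
  qed
  then have "(\<Sum>B\<in>Pow {..<m}. ?Z B * toeplitz_det 1 (desc_list B) b) =
      (\<Sum>B\<in>Pow {..<m}. if set b = B then ?Z (set b) else 0)"
    by (intro sum.cong) auto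
  also have "\<dots> = ?Z (set b)" using b by simp
  finally show ?thesis
    using sum_grid_Z_toeplitz_det[OF ff a(2), where N = N and g = 1 and cs = b]
      desc_list_set[OF a(1)] by simp
qed

text \<open>Every weight is divided by a1 or b1 according to the spin below the vertex, so the
  factor extracted from a row depends only on its bottom boundary.\<close>

definition normalized :: "(vertex \<Rightarrow> complex) \<Rightarrow> vertex \<Rightarrow> complex" where
  "normalized f = row_weights (f B2 / f A1) (f A2 / f B1) (f C1 / f B1) (f C2 / f A1)"

lemma row_Z_normalized:
  assumes "f A1 \<noteq> 0" "f B1 \<noteq> 0"
  shows "row_Z f m s A B =
    f A1 ^ (m - card (A \<inter> {..<m})) * f B1 ^ card (A \<inter> {..<m}) * row_Z (normalized f) m s A B"
proof -
  have "row_Z f m s A B = (\<Prod>c<m. if c \<in> A then f B1 else f A1) * row_Z (normalized f) m s A B"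
  proof (induction m arbitrary: s)
    case (Suc m)
    show ?case
      using assms
      by (cases s) (auto simp: row_Z_simps Suc.IH normalized_def row_weights_def simp del: row_Z.simps)
  qed simp
  moreover have "(\<Prod>c<m. if c \<in> A then f B1 else f A1) =
      f A1 ^ (m - card (A \<inter> {..<m})) * f B1 ^ card (A \<inter> {..<m})"
  proof -
    have "{..<m} \<inter> {c. c \<in> A} = A \<inter> {..<m}" "{..<m} \<inter> - {c. c \<in> A} = {..<m} - A \<inter> {..<m}"
      by auto
    then show ?thesis
      by (simp add: prod.If_cases card_Diff_subset)
  qed
  ultimately show ?thesis by simp
qed

lemma grid_Z_nonzero_card:
  "grid_Z f m N A B \<noteq> 0 \<Longrightarrow> A \<subseteq> {..<m} \<Longrightarrow> B \<subseteq> {..<m} \<Longrightarrow> card A = card B"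
proof (induction N arbitrary: B)
  case (Suc N)
  then obtain C where C: "C \<subseteq> {..<m}" "grid_Z f m N A C \<noteq> 0" "row_Z (f (Suc N)) m Plus C B \<noteq> 0"
    by (auto elim!: sum.not_neutral_contains_not_neutral)
  moreover have "C \<inter> {..<m} = C" "B \<inter> {..<m} = B" using C Suc.prems by auto
  ultimately show ?case
    using row_Z_nonzero_card[OF C(3)] Suc.IH[of C] Suc.prems by simp
qed (auto split: if_splits)

text \<open>The number of minus spins is the same on every horizontal cut, so the exponents
  extracted from each row are those of the bottom boundary \<open>A\<close>.\<close>

lemma grid_Z_normalized:
  assumes nz: "\<And>i. i \<ge> 1 \<Longrightarrow> f i A1 \<noteq> 0" "\<And>i. i \<ge> 1 \<Longrightarrow> f i B1 \<noteq> 0"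
    and A: "A \<subseteq> {..<m}"
  shows "grid_Z f m N A B =
    (\<Prod>i=1..N. f i A1 ^ (m - card A) * f i B1 ^ card A) * grid_Z (\<lambda>i. normalized (f i)) m N A B"
proof (induction N arbitrary: B)
  case (Suc N)
  let ?g = "\<lambda>i. normalized (f i)" and ?F = "\<lambda>i. f i A1 ^ (m - card A) * f i B1 ^ card A"
  have "grid_Z f m N A C * row_Z (f (Suc N)) m Plus C B =
      (\<Prod>i=1..N. ?F i) * ?F (Suc N) * (grid_Z ?g m N A C * row_Z (?g (Suc N)) m Plus C B)"
    if C: "C \<in> Pow {..<m}" for C
  proof (cases "grid_Z ?g m N A C = 0")
    case True
    then show ?thesis by (simp add: Suc.IH)
  next
    case False
    then have "card C = card A" using grid_Z_nonzero_card[OF False A] C by simp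
    moreover have "C \<inter> {..<m} = C" using C by auto
    ultimately show ?thesis
      using row_Z_normalized[of "f (Suc N)" m Plus C B] nz by (simp add: Suc.IH mult_ac)
  qed
  then show ?case by (simp add: sum_distrib_left)
qed simp

section \<open>Sums over paths as products of transfer matrices\<close>

definition path_sum :: "'a set \<Rightarrow> nat \<Rightarrow> (nat \<Rightarrow> 'a \<Rightarrow> 'a \<Rightarrow> complex) \<Rightarrow> 'a \<Rightarrow> 'a \<Rightarrow> complex" where
  "path_sum X n K a b =
     (\<Sum>g | g \<in> {0..n} \<rightarrow>\<^sub>E X \<and> g 0 = a \<and> g n = b. \<Prod>i<n. K i (g i) (g (Suc i)))"

lemma path_sum_0: "a \<in> X \<Longrightarrow> path_sum X 0 K a b = of_bool (a = b)"
proof -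
  assume "a \<in> X"
  then have "{g. g \<in> {0..0::nat} \<rightarrow>\<^sub>E X \<and> g 0 = a \<and> g 0 = b} = (if a = b then {\<lambda>i\<in>{0}. a} else {})"
    by (auto simp: PiE_def extensional_def fun_eq_iff)
  then show ?thesis unfolding path_sum_def by simp
qed

lemma path_sum_Suc:
  assumes "finite X" "b \<in> X"
  shows "path_sum X (Suc n) K a b = (\<Sum>c\<in>X. path_sum X n K a c * K n c b)"
proof -
  let ?P = "\<lambda>n a b. {g. g \<in> {0..n} \<rightarrow>\<^sub>E X \<and> g 0 = a \<and> g n = b}"
  have fin: "finite (?P n a c)" for c
    by (rule finite_subset[of _ "{0..n} \<rightarrow>\<^sub>E X"]) (auto intro: finite_PiE assms)
  have "(\<Sum>c\<in>X. path_sum X n K a c * K n c b) =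
      (\<Sum>(c, g)\<in>(SIGMA c:X. ?P n a c). (\<Prod>i<n. K i (g i) (g (Suc i))) * K n c b)"
    unfolding path_sum_def sum_distrib_right
    by (rule sum.Sigma) (use assms fin in auto)
  also have "\<dots> = path_sum X (Suc n) K a b"
    unfolding path_sum_def
  proof (rule sum.reindex_bij_witness[where j = "\<lambda>(c, g). g(Suc n := b)"
        and i = "\<lambda>g. (g n, restrict g {0..n})"])
    fix cg assume "cg \<in> (SIGMA c:X. ?P n a c)"
    then obtain c g where cg: "cg = (c, g)" "c \<in> X" "g \<in> {0..n} \<rightarrow>\<^sub>E X" "g 0 = a" "g n = c" by auto
    show "(case cg of (c, g) \<Rightarrow> g(Suc n := b)) \<in> ?P (Suc n) a b"
      using cg assms by (auto simp: PiE_def extensional_def Pi_def le_Suc_eq)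
    show "(case (case cg of (c, g) \<Rightarrow> g(Suc n := b)) of g \<Rightarrow> (g n, restrict g {0..n})) = cg"
      using cg by (auto simp: fun_eq_iff PiE_def extensional_def)
    show "(\<Prod>i<Suc n. K i ((case cg of (c, g) \<Rightarrow> g(Suc n := b)) i) ((case cg of (c, g) \<Rightarrow> g(Suc n := b)) (Suc i))) =
        (case cg of (c, g) \<Rightarrow> (\<Prod>i<n. K i (g i) (g (Suc i))) * K n c b)"
      using cg by auto
  next
    fix g assume "g \<in> ?P (Suc n) a b"
    then have g: "g \<in> {0..Suc n} \<rightarrow>\<^sub>E X" "g 0 = a" "g (Suc n) = b" by auto
    then show "(g n, restrict g {0..n}) \<in> (SIGMA c:X. ?P n a c)" by auto
    show "(case (g n, restrict g {0..n}) of (c, g) \<Rightarrow> g(Suc n := b)) = g"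
      using g by (auto simp: fun_eq_iff PiE_def extensional_def)
  qed
  finally show ?thesis ..
qed

text \<open>\<open>states\<close> counts rows from the top, while \<open>grid_Z\<close> builds them
  from the bottom; reversing the path and transposing each kernel mediates between the two.\<close>

lemma path_sum_reverse:
  "path_sum X n K a b = path_sum X n (\<lambda>i s t. K (n - Suc i) t s) b a"
  unfolding path_sum_def
proof (rule sum.reindex_bij_witness[where j = "\<lambda>g. \<lambda>i\<in>{0..n}. g (n - i)"
        and i = "\<lambda>g. \<lambda>i\<in>{0..n}. g (n - i)"])
  fix g assume g: "g \<in> {g. g \<in> {0..n} \<rightarrow>\<^sub>E X \<and> g 0 = a \<and> g n = b}"
  have "(\<Prod>i<n. K (n - Suc i) (g (n - Suc i)) (g (n - i))) = (\<Prod>i<n. K i (g i) (g (Suc i)))"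
    by (rule prod.reindex_bij_witness[where i = "\<lambda>i. n - Suc i" and j = "\<lambda>i. n - Suc i"])
      (auto simp: Suc_diff_Suc)
  then show "(\<Prod>i<n. K (n - Suc i) ((\<lambda>i\<in>{0..n}. g (n - i)) (Suc i)) ((\<lambda>i\<in>{0..n}. g (n - i)) i)) =
      (\<Prod>i<n. K i (g i) (g (Suc i)))"
    by simp
qed (auto simp: fun_eq_iff PiE_def extensional_def)

lemma UNIV_spin: "UNIV = {Plus, Minus}"
  using spin.exhaust by auto

lemma sum_UNIV_spin: "(\<Sum>t\<in>UNIV. h t) = h Plus + h Minus"
  by (simp add: UNIV_spin)

lemma finite_UNIV_spin [simp]: "finite (UNIV :: spin set)"
  by (simp add: UNIV_spin)

text \<open>Here a path is the sequence of horizontal spins along one row; in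
  \<open>path_sum_grid\<close> it is the sequence of rows of vertical spins.\<close>

lemma path_sum_row:
  "path_sum UNIV m (\<lambda>c s t. vertex_weight f (vertex_S s (spin_of B c) t (spin_of A c))) Plus s =
    row_Z f m s A B"
proof (induction m arbitrary: s)
  case 0
  show ?case by (simp add: path_sum_0 eq_commute)
next
  case (Suc m)
  then show ?case by (subst path_sum_Suc) (simp_all add: sum_UNIV_spin)
qed

lemma path_sum_grid:
  assumes "A \<subseteq> {..<m}"
  shows "B \<subseteq> {..<m} \<Longrightarrow>
    path_sum (Pow {..<m}) N (\<lambda>i C D. row_Z (f (Suc i)) m Plus C D) A B = grid_Z f m N A B"
proof (induction N arbitrary: B)
  case 0
  show ?case using assms by (simp add: path_sum_0)
next
  case (Suc N)
  then show ?case by (subst path_sum_Suc) simp_all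
qed

section \<open>Partition functions of the lattice models\<close>

lemma path_sum_bij:
  assumes fin: "finite X" and bij: "bij_betw \<phi> X Y" and a: "a \<in> X"
    and K: "\<And>i c d. i < n \<Longrightarrow> c \<in> X \<Longrightarrow> d \<in> X \<Longrightarrow> K i c d = K' i (\<phi> c) (\<phi> d)"
    and b: "b \<in> X"
  shows "path_sum X n K a b = path_sum Y n K' (\<phi> a) (\<phi> b)"
  using K b
proof (induction n arbitrary: b)
  case 0
  then show ?case using a bij by (auto simp: path_sum_0 bij_betw_def inj_on_eq_iff)
next
  case (Suc n)
  have Y: "finite Y" "\<phi> b \<in> Y" using bij fin Suc.prems bij_betw_finite[OF bij] by (auto simp: bij_betw_def)
  have "path_sum X (Suc n) K a b = (\<Sum>c\<in>X. path_sum Y n K' (\<phi> a) (\<phi> c) * K' n (\<phi> c) (\<phi> b))"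
    using Suc.prems by (subst path_sum_Suc[OF fin]) (auto intro!: sum.cong Suc.IH)
  also have "\<dots> = (\<Sum>d\<in>Y. path_sum Y n K' (\<phi> a) d * K' n d (\<phi> b))"
    by (rule sum.reindex_bij_betw[OF bij])
  finally show ?case using Y by (simp add: path_sum_Suc)
qed

lemma path_sum_cong:
  assumes "finite X" "a \<in> X" "b \<in> X"
    and "\<And>i c d. i < n \<Longrightarrow> c \<in> X \<Longrightarrow> d \<in> X \<Longrightarrow> K i c d = K' i c d"
  shows "path_sum X n K a b = path_sum X n K' a b"
  using path_sum_bij[of X "\<lambda>x. x" X a n K K' b] assms by (simp add: bij_betw_def)

definition row_sum :: "nat \<Rightarrow> (nat \<Rightarrow> spin \<Rightarrow> spin \<Rightarrow> spin \<Rightarrow> spin \<Rightarrow> complex) \<Rightarrow> nat \<Rightarrow>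
    (nat \<Rightarrow> spin) \<Rightarrow> (nat \<Rightarrow> spin) \<Rightarrow> complex" where
  "row_sum M \<omega> r C D = path_sum UNIV (Suc M) (\<lambda>c s t. \<omega> r s (C c) t (D c)) Plus Plus"

lemma row_sum_cong:
  assumes "\<And>c. c \<le> M \<Longrightarrow> C c = C' c" "\<And>c. c \<le> M \<Longrightarrow> D c = D' c"
  shows "row_sum M \<omega> r C D = row_sum M \<omega> r C' D'"
  unfolding row_sum_def by (rule path_sum_cong) (use assms in auto)

text \<open>Once the vertical spins \<open>C\<close> and \<open>D\<close> are fixed the rows do not
  interact, so the sum over all horizontal spins is a product of sums over single rows.\<close>

lemma sum_row_states:
  "(\<Sum>h | h \<in> ({1..N} \<times> {0..M + 1}) \<rightarrow>\<^sub>E UNIV \<and> (\<forall>r\<in>{1..N}. h (r, 0) = Plus \<and> h (r, M + 1) = Plus).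
      \<Prod>r=1..N. \<Prod>c=0..M. \<omega> r (h (r, c)) (C r c) (h (r, c + 1)) (D r c)) =
   (\<Prod>r=1..N. row_sum M \<omega> r (C r) (D r))"
proof -
  let ?R = "{g :: nat \<Rightarrow> spin. g \<in> {0..Suc M} \<rightarrow>\<^sub>E UNIV \<and> g 0 = Plus \<and> g (Suc M) = Plus}"
  let ?F = "\<lambda>r g. \<Prod>c<Suc M. \<omega> r (g c) (C r c) (g (Suc c)) (D r c)"
  have "(\<Prod>r=1..N. row_sum M \<omega> r (C r) (D r)) = (\<Prod>r=1..N. \<Sum>g\<in>?R. ?F r g)"
    by (simp only: row_sum_def path_sum_def)
  also have "\<dots> = (\<Sum>\<phi>\<in>{1..N} \<rightarrow>\<^sub>E ?R. \<Prod>r=1..N. ?F r (\<phi> r))"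
  proof (rule prod_sum_PiE)
    show "finite ?R"
      by (rule finite_subset[of _ "{0..Suc M} \<rightarrow>\<^sub>E UNIV"]) (auto intro: finite_PiE)
  qed simp
  also have "\<dots> = (\<Sum>h | h \<in> ({1..N} \<times> {0..M + 1}) \<rightarrow>\<^sub>E UNIV \<and>
      (\<forall>r\<in>{1..N}. h (r, 0) = Plus \<and> h (r, M + 1) = Plus).
      \<Prod>r=1..N. \<Prod>c=0..M. \<omega> r (h (r, c)) (C r c) (h (r, c + 1)) (D r c))"
  proof (rule sum.reindex_bij_witness[
        where i = "\<lambda>h. \<lambda>r\<in>{1..N}. \<lambda>c\<in>{0..Suc M}. h (r, c)"
          and j = "\<lambda>\<phi>. \<lambda>(r, c)\<in>{1..N} \<times> {0..M + 1}. \<phi> r c"])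
    fix \<phi> assume \<phi>: "\<phi> \<in> {1..N} \<rightarrow>\<^sub>E ?R"
    then have row: "\<phi> r \<in> ?R" if "r \<in> {1..N}" for r using that by (rule PiE_mem)
    show "(\<lambda>(r, c)\<in>{1..N} \<times> {0..M + 1}. \<phi> r c) \<in> {h. h \<in> ({1..N} \<times> {0..M + 1}) \<rightarrow>\<^sub>E UNIV \<and>
      (\<forall>r\<in>{1..N}. h (r, 0) = Plus \<and> h (r, M + 1) = Plus)}"
      using row by auto
    show "(\<lambda>r\<in>{1..N}. \<lambda>c\<in>{0..Suc M}. (\<lambda>(r, c)\<in>{1..N} \<times> {0..M + 1}. \<phi> r c) (r, c)) = \<phi>"
    proof
      fix r
      show "(\<lambda>r\<in>{1..N}. \<lambda>c\<in>{0..Suc M}. (\<lambda>(r, c)\<in>{1..N} \<times> {0..M + 1}. \<phi> r c) (r, c)) r = \<phi> r"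
      proof (cases "r \<in> {1..N}")
        case True
        then have "\<phi> r c = undefined" if "c \<notin> {0..Suc M}" for c
          using row[OF True] that by (auto simp: PiE_def extensional_def)
        then show ?thesis using True by (auto simp: fun_eq_iff)
      next
        case False
        then show ?thesis using \<phi> by (auto simp: PiE_def extensional_def)
      qed
    qed
    show "(\<Prod>r=1..N. \<Prod>c=0..M. \<omega> r ((\<lambda>(r, c)\<in>{1..N} \<times> {0..M + 1}. \<phi> r c) (r, c)) (C r c)
        ((\<lambda>(r, c)\<in>{1..N} \<times> {0..M + 1}. \<phi> r c) (r, c + 1)) (D r c)) = (\<Prod>r=1..N. ?F r (\<phi> r))"
      unfolding atLeast0AtMost lessThan_Suc_atMost by (intro prod.cong refl) auto
  next
    fix h assume h: "h \<in> {h :: nat \<times> nat \<Rightarrow> spin. h \<in> ({1..N} \<times> {0..M + 1}) \<rightarrow>\<^sub>E UNIV \<and>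
      (\<forall>r\<in>{1..N}. h (r, 0) = Plus \<and> h (r, M + 1) = Plus)}"
    then show "(\<lambda>r\<in>{1..N}. \<lambda>c\<in>{0..Suc M}. h (r, c)) \<in> {1..N} \<rightarrow>\<^sub>E ?R" by auto
    show "(\<lambda>(r, c)\<in>{1..N} \<times> {0..M + 1}. (\<lambda>r\<in>{1..N}. \<lambda>c\<in>{0..Suc M}. h (r, c)) r c) = h"
      using h by (auto simp: fun_eq_iff PiE_def extensional_def)
  qed
  finally show ?thesis ..
qed

text \<open>The conditions on \<open>h\<close> and \<open>v\<close> are independent, so
  \<open>h\<close> can be summed out for each \<open>v\<close>; what remains is a path of rows of
  vertical spins between the two boundaries.\<close>

lemma sum_states:
  "(\<Sum>(h, v) \<in> states N M T B. \<Prod>r=1..N. \<Prod>c=0..M.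
      \<omega> r (h (r, c)) (v (r - 1, c)) (h (r, c + 1)) (v (r, c))) =
   path_sum ({0..M} \<rightarrow>\<^sub>E UNIV) N (\<lambda>i. row_sum M \<omega> (Suc i)) (restrict T {0..M}) (restrict B {0..M})"
proof -
  let ?H = "{h :: nat \<times> nat \<Rightarrow> spin. h \<in> ({1..N} \<times> {0..M + 1}) \<rightarrow>\<^sub>E UNIV \<and>
    (\<forall>r\<in>{1..N}. h (r, 0) = Plus \<and> h (r, M + 1) = Plus)}"
  let ?V = "{v :: nat \<times> nat \<Rightarrow> spin. v \<in> ({0..N} \<times> {0..M}) \<rightarrow>\<^sub>E UNIV \<and>
    (\<forall>c\<in>{0..M}. v (0, c) = T c \<and> v (N, c) = B c)}"
  let ?X = "{0..M} \<rightarrow>\<^sub>E (UNIV :: spin set)"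
  let ?T = "restrict T {0..M}" and ?B = "restrict B {0..M}"
  have "states N M T B = ?H \<times> ?V"
    by (auto simp: states_def)
  then have "(\<Sum>(h, v) \<in> states N M T B. \<Prod>r=1..N. \<Prod>c=0..M.
        \<omega> r (h (r, c)) (v (r - 1, c)) (h (r, c + 1)) (v (r, c))) =
      (\<Sum>v\<in>?V. \<Sum>h\<in>?H. \<Prod>r=1..N. \<Prod>c=0..M.
        \<omega> r (h (r, c)) (v (r - 1, c)) (h (r, c + 1)) (v (r, c)))"
    by (simp only: sum.cartesian_product[symmetric] sum.swap[of _ ?V ?H])
  also have "\<dots> = (\<Sum>v\<in>?V. \<Prod>r=1..N. row_sum M \<omega> r (\<lambda>c. v (r - 1, c)) (\<lambda>c. v (r, c)))"
    by (intro sum.cong refl sum_row_states)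
  also have "\<dots> = path_sum ?X N (\<lambda>i. row_sum M \<omega> (Suc i)) ?T ?B"
    unfolding path_sum_def
  proof (rule sum.reindex_bij_witness[
        where j = "\<lambda>v. \<lambda>r\<in>{0..N}. \<lambda>c\<in>{0..M}. v (r, c)"
          and i = "\<lambda>\<phi>. \<lambda>(r, c)\<in>{0..N} \<times> {0..M}. \<phi> r c"])
    fix v assume v: "v \<in> ?V"
    then show "(\<lambda>(r, c)\<in>{0..N} \<times> {0..M}. (\<lambda>r\<in>{0..N}. \<lambda>c\<in>{0..M}. v (r, c)) r c) = v"
      by (auto simp: fun_eq_iff PiE_def extensional_def)
    show "(\<lambda>r\<in>{0..N}. \<lambda>c\<in>{0..M}. v (r, c)) \<in> {g. g \<in> {0..N} \<rightarrow>\<^sub>E ?X \<and> g 0 = ?T \<and> g N = ?B}"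
      using v by (auto simp: fun_eq_iff)
    let ?g = "\<lambda>r\<in>{0..N}. \<lambda>c\<in>{0..M}. v (r, c)"
    have "(\<Prod>i<N. row_sum M \<omega> (Suc i) (?g i) (?g (Suc i))) =
        (\<Prod>i<N. row_sum M \<omega> (Suc i) (\<lambda>c. v (i, c)) (\<lambda>c. v (Suc i, c)))"
      by (intro prod.cong refl row_sum_cong) auto
    also have "\<dots> = (\<Prod>r=1..N. row_sum M \<omega> r (\<lambda>c. v (r - 1, c)) (\<lambda>c. v (r, c)))"
      by (simp add: prod.atLeast1_atMost_eq)
    finally show "(\<Prod>i<N. row_sum M \<omega> (Suc i) (?g i) (?g (Suc i))) =
        (\<Prod>r=1..N. row_sum M \<omega> r (\<lambda>c. v (r - 1, c)) (\<lambda>c. v (r, c)))" .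
  next
    fix \<phi> assume \<phi>: "\<phi> \<in> {g. g \<in> {0..N} \<rightarrow>\<^sub>E ?X \<and> g 0 = ?T \<and> g N = ?B}"
    then have row: "\<phi> r \<in> ?X" if "r \<in> {0..N}" for r using that by (auto dest: PiE_mem)
    show "(\<lambda>r\<in>{0..N}. \<lambda>c\<in>{0..M}. (\<lambda>(r, c)\<in>{0..N} \<times> {0..M}. \<phi> r c) (r, c)) = \<phi>"
    proof
      fix r
      show "(\<lambda>r\<in>{0..N}. \<lambda>c\<in>{0..M}. (\<lambda>(r, c)\<in>{0..N} \<times> {0..M}. \<phi> r c) (r, c)) r = \<phi> r"
      proof (cases "r \<in> {0..N}")
        case True
        then have "\<phi> r c = undefined" if "c \<notin> {0..M}" for c
          using row[OF True] that by (auto simp: PiE_def extensional_def)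
        then show ?thesis using True by (auto simp: fun_eq_iff)
      next
        case False
        then show ?thesis using \<phi> by (auto simp: PiE_def extensional_def)
      qed
    qed
    show "(\<lambda>(r, c)\<in>{0..N} \<times> {0..M}. \<phi> r c) \<in> ?V"
      using \<phi> by auto
  qed
  finally show ?thesis .
qed

definition minus_set :: "nat \<Rightarrow> (nat \<Rightarrow> spin) \<Rightarrow> nat set" where
  "minus_set M C = {c \<in> {..<Suc M}. C c = Minus}"

lemma bij_betw_minus_set: "bij_betw (minus_set M) ({0..M} \<rightarrow>\<^sub>E UNIV) (Pow {..<Suc M})"
proof (rule bij_betw_byWitness[where f' = "\<lambda>A. \<lambda>c\<in>{0..M}. spin_of A c"])
  show "\<forall>C\<in>{0..M} \<rightarrow>\<^sub>E UNIV. (\<lambda>c\<in>{0..M}. spin_of (minus_set M C) c) = C"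
  proof (intro ballI ext)
    fix C c assume "C \<in> {0..M} \<rightarrow>\<^sub>E (UNIV :: spin set)"
    then show "(\<lambda>c\<in>{0..M}. spin_of (minus_set M C) c) c = C c"
      by (cases "C c") (auto simp: spin_of_def minus_set_def PiE_def extensional_def)
  qed
qed (auto simp: minus_set_def spin_of_def split: if_splits)

lemma spin_of_minus_set: "c \<le> M \<Longrightarrow> spin_of (minus_set M C) c = C c"
  by (cases "C c") (auto simp: spin_of_def minus_set_def)

lemma minus_set_boundary:
  "set a \<subseteq> {..<Suc M} \<Longrightarrow> minus_set M (restrict (boundary_spin a) {0..M}) = set a"
  by (auto simp: minus_set_def boundary_spin_def split: if_splits)

lemma row_sum_row_Z:
  "row_sum M (\<lambda>r l t rr b. vertex_weight (f r) (vertex_S l t rr b)) r C D =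
    row_Z (f r) (Suc M) Plus (minus_set M D) (minus_set M C)"
proof -
  have "row_sum M (\<lambda>r l t rr b. vertex_weight (f r) (vertex_S l t rr b)) r C D =
    row_sum M (\<lambda>r l t rr b. vertex_weight (f r) (vertex_S l t rr b)) r
      (spin_of (minus_set M C)) (spin_of (minus_set M D))"
    by (rule row_sum_cong) (simp_all add: spin_of_minus_set)
  then show ?thesis by (simp add: row_sum_def path_sum_row del: row_Z.simps)
qed

lemma Z_S_grid:
  assumes "set lam \<subseteq> {..<Suc M}" "set mu \<subseteq> {..<Suc M}"
  shows "Z_S w N M lam mu = grid_Z (\<lambda>i t. w t i) (Suc M) N (set lam) (set mu)"
proof -
  let ?\<omega> = "\<lambda>r l t rr b. vertex_weight (\<lambda>t. w t (N + 1 - r)) (vertex_S l t rr b)"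
  let ?X = "{0..M} \<rightarrow>\<^sub>E (UNIV :: spin set)" and ?P = "Pow {..<Suc M}"
  have "Z_S w N M lam mu = path_sum ?X N (\<lambda>i. row_sum M ?\<omega> (Suc i))
      (restrict (boundary_spin mu) {0..M}) (restrict (boundary_spin lam) {0..M})"
    unfolding Z_S_def boltzmann_def vertex_weight_def[symmetric] by (rule sum_states)
  also have "\<dots> = path_sum ?P N
      (\<lambda>i C D. row_Z (\<lambda>t. w t (N - i)) (Suc M) Plus D C) (set mu) (set lam)"
    using assms
    by (subst path_sum_bij[OF _ bij_betw_minus_set])
      (auto simp: row_sum_row_Z minus_set_boundary finite_PiE simp del: row_Z.simps)
  \<comment> \<open>The row in position i + 1 from the top has label N - i. After the reversal,
    position and label agree.\<close>
  also have "\<dots> = path_sum ?P N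
      (\<lambda>i C D. row_Z (\<lambda>t. w t (N - (N - Suc i))) (Suc M) Plus C D) (set lam) (set mu)"
    by (rule path_sum_reverse)
  also have "\<dots> = path_sum ?P N
      (\<lambda>i C D. row_Z (\<lambda>t. w t (Suc i)) (Suc M) Plus C D) (set lam) (set mu)"
    by (rule path_sum_cong) (use assms in \<open>auto simp: Suc_leI\<close>)
  also have "\<dots> = grid_Z (\<lambda>i t. w t i) (Suc M) N (set lam) (set mu)"
    by (rule path_sum_grid[where f = "\<lambda>i t. w t i"]) (use assms in auto)
  finally show ?thesis .
qed

text \<open>Reflecting a state of the dual model vertically exchanges the two vertices of type \<open>c\<close>.\<close>

fun swap_c :: "vertex \<Rightarrow> vertex" where
  "swap_c C1 = C2"
| "swap_c C2 = C1"
| "swap_c t = t"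

lemma vertex_S_star_reflect:
  "vertex_weight f (vertex_S_star l t r b) = vertex_weight (\<lambda>t. f (swap_c t)) (vertex_S l b r t)"
  by (cases l; cases t; cases r; cases b) (simp_all add: vertex_weight_def)

lemma row_sum_reflect:
  "row_sum M (\<lambda>r l t rr b. \<omega> r l b rr t) r C D = row_sum M \<omega> r D C"
  by (simp add: row_sum_def)

text \<open>The labels of this model grow downwards, so the reflected model has them growing upwards
  as in \<open>grid_Z\<close>, and no path needs to be reversed.\<close>

lemma Z_S_star_grid:
  assumes "set lam \<subseteq> {..<Suc M}" "set mu \<subseteq> {..<Suc M}"
  shows "Z_S_star w N M lam mu = grid_Z (\<lambda>i t. w (swap_c t) i) (Suc M) N (set lam) (set mu)"
proof -
  let ?\<omega> = "\<lambda>r l t rr b. vertex_weight (\<lambda>t. w (swap_c t) r) (vertex_S l t rr b)"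
  let ?X = "{0..M} \<rightarrow>\<^sub>E (UNIV :: spin set)" and ?P = "Pow {..<Suc M}"
  have row: "row_sum M (\<lambda>r l t rr b. ?\<omega> r l b rr t) r C D =
      row_Z (\<lambda>t. w (swap_c t) r) (Suc M) Plus (minus_set M C) (minus_set M D)" for r C D
    by (subst row_sum_reflect) (rule row_sum_row_Z)
  have "Z_S_star w N M lam mu = path_sum ?X N (\<lambda>i. row_sum M (\<lambda>r l t rr b. ?\<omega> r l b rr t) (Suc i))
      (restrict (boundary_spin lam) {0..M}) (restrict (boundary_spin mu) {0..M})"
    unfolding Z_S_star_def boltzmann_def vertex_weight_def[symmetric] vertex_S_star_reflect
    by (rule sum_states)
  also have "\<dots> = path_sum ?P N
      (\<lambda>i C D. row_Z (\<lambda>t. w (swap_c t) (Suc i)) (Suc M) Plus C D) (set lam) (set mu)"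
    using assms
    by (subst path_sum_bij[OF _ bij_betw_minus_set])
      (auto simp: row minus_set_boundary finite_PiE simp del: row_Z.simps)
  also have "\<dots> = grid_Z (\<lambda>i t. w (swap_c t) i) (Suc M) N (set lam) (set mu)"
    by (rule path_sum_grid[where f = "\<lambda>i t. w (swap_c t) i"]) (use assms in auto)
  finally show ?thesis .
qed

section \<open>Strips and tableaux\<close>

lemma part_antimono:
  assumes "is_partition p" "i \<le> j"
  shows "part p j \<le> part p i"
proof (cases "i = j \<or> j \<ge> length p")
  case False
  then show ?thesis
    using assms by (auto simp: Defs.part_def is_partition_def sorted_wrt_iff_nth_less)
qed (auto simp: Defs.part_def)

lemma part_nth: "i < length p \<Longrightarrow> part p i = p ! i"
  by (simp add: Defs.part_def)

lemma part_eqI: "length p = length q \<Longrightarrow> (\<And>i. part p i = part q i) \<Longrightarrow> p = q"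
  by (metis nth_equalityI part_nth)

lemma is_partition_iff_part: "is_partition p \<longleftrightarrow> (\<forall>i. part p (Suc i) \<le> part p i)"
proof
  assume "\<forall>i. part p (Suc i) \<le> part p i"
  then have "part p j \<le> part p i" if "i \<le> j" for i j
    using lift_Suc_antimono_le[of "part p" i j] that by blast
  then show "is_partition p"
    unfolding is_partition_def sorted_wrt_iff_nth_less
    by (metis less_imp_le order.strict_trans part_nth)
qed (simp add: part_antimono)

lemma part_Cons [simp]: "part (a # as) 0 = a" "part (a # as) (Suc i) = part as i"
  by (simp_all add: Defs.part_def)

lemma plus_rho_Cons [simp]: "plus_rho (a # as) = (a + length as) # plus_rho as"
  unfolding plus_rho_def
  by (simp add: map_upt_Suc del: upt_Suc)

lemma plus_rho_Nil [simp]: "plus_rho [] = []"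
  by (simp add: plus_rho_def)

lemma length_plus_rho [simp]: "length (plus_rho a) = length a"
  by (simp add: plus_rho_def)

lemma strict_partition_plus_rho: "is_partition a \<Longrightarrow> strict_partition (plus_rho a)"
proof (induction a)
  case (Cons a as)
  have "x < a + length as" if x: "x \<in> set (plus_rho as)" for x
  proof -
    obtain i where i: "i < length as" "x = as ! i + (length as - 1 - i)"
      using x by (auto simp: plus_rho_def)
    moreover have "as ! i \<le> a" using i Cons.prems by (auto simp: is_partition_def)
    ultimately show ?thesis by simp
  qed
  then show ?case using Cons by (auto simp: is_partition_def strict_partition_def)
qed (simp add: strict_partition_def)

lemma plus_rho_inject: "length a = length b \<Longrightarrow> plus_rho a = plus_rho b \<longleftrightarrow> a = b"
  by (induction a b rule: list_induct2) auto

definition horizontal_strips :: "nat list \<Rightarrow> nat list set" where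
  "horizontal_strips a =
     {k. length k = length a \<and> (\<forall>i<length a. part a (Suc i) \<le> k ! i \<and> k ! i \<le> a ! i)}"

text \<open>The result need not be a partition: letting every part drop by 0 or 1 independently
  makes the sum over steps an iterated sum. Adding 1 to \<open>k ! i\<close> avoids a truncated
  subtraction.\<close>

definition vertical_steps :: "nat list \<Rightarrow> nat list set" where
  "vertical_steps a = {k. length k = length a \<and> (\<forall>i<length a. a ! i \<le> k ! i + 1 \<and> k ! i \<le> a ! i)}"

definition strip_weight :: "'a :: comm_ring_1 \<Rightarrow> nat list \<Rightarrow> nat list \<Rightarrow> 'a" where
  "strip_weight x a k = (\<Prod>i<length a. x ^ (a ! i - k ! i))"

lemma strip_weight_Cons [simp]:
  "strip_weight x (a # as) (k # ks) = x ^ (a - k) * strip_weight x as ks"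
  unfolding strip_weight_def by (simp add: prod.lessThan_Suc_shift del: prod.lessThan_Suc)

lemma horizontal_strips_Nil [simp]: "horizontal_strips [] = {[]}"
  by (auto simp: horizontal_strips_def)

lemma vertical_steps_Nil [simp]: "vertical_steps [] = {[]}"
  by (auto simp: vertical_steps_def)

lemma horizontal_strips_Cons:
  "horizontal_strips (a # as) = (\<lambda>(k, ks). k # ks) ` ({part as 0..a} \<times> horizontal_strips as)"
  (is "?L = ?R")
proof (intro set_eqI iffI)
  fix \<kappa> assume \<kappa>: "\<kappa> \<in> ?L"
  then obtain k ks where "\<kappa> = k # ks" by (cases \<kappa>) (auto simp: horizontal_strips_def)
  then show "\<kappa> \<in> ?R" using \<kappa> by (auto simp: horizontal_strips_def All_less_Suc2)
qed (auto simp: horizontal_strips_def All_less_Suc2)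

lemma vertical_steps_Cons:
  "vertical_steps (a # as) = (\<lambda>(k, ks). k # ks) ` ({a - 1..a} \<times> vertical_steps as)"
  (is "?L = ?R")
proof (intro set_eqI iffI)
  fix \<kappa> assume \<kappa>: "\<kappa> \<in> ?L"
  then obtain k ks where "\<kappa> = k # ks" by (cases \<kappa>) (auto simp: vertical_steps_def)
  then show "\<kappa> \<in> ?R" using \<kappa> by (auto simp: vertical_steps_def All_less_Suc2)
qed (auto simp: vertical_steps_def All_less_Suc2)

lemma finite_vertical_steps: "finite (vertical_steps a)"
  by (induction a) (auto simp: vertical_steps_Cons)

lemma sum_Cons_image:
  "(\<Sum>\<kappa>\<in>(\<lambda>(k, ks). k # ks) ` (A \<times> B). f \<kappa>) = (\<Sum>k\<in>A. \<Sum>ks\<in>B. f (k # ks))"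
  by (subst sum.reindex) (auto simp: inj_on_def sum.cartesian_product case_prod_beta)

text \<open>The recursion is unrolled down to b + m because this is the entry that a following part
  b, with m parts after it, contributes to \<open>plus_rho\<close>. The remainder is then a multiple
  of the neighbouring row.\<close>

lemma telescope:
  fixes v w :: "nat \<Rightarrow> 'b \<Rightarrow> 'a :: comm_ring_1"
  assumes "\<And>n. w (Suc n) = (\<lambda>q. v (Suc n) q + x * w n q)" and "b \<le> a"
  shows "w (a + Suc m) = (\<lambda>q. (\<Sum>k=b..a. x ^ (a - k) * v (k + Suc m) q) + x ^ Suc (a - b) * w (b + m) q)"
  using assms(2)
proof (induction a rule: dec_induct)
  case base
  then show ?case using assms(1)[of "b + m"] by simp
next
  case (step a)
  have "(\<Sum>k=b..a. x ^ (Suc a - k) * v (k + Suc m) q) = x * (\<Sum>k=b..a. x ^ (a - k) * v (k + Suc m) q)" for q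
    by (auto simp: sum_distrib_left Suc_diff_le mult.assoc intro!: sum.cong)
  then show ?case
    using step assms(1)[of "a + Suc m"]
    by (simp add: algebra_simps Suc_diff_le)
qed

text \<open>
  Summing \<open>v\<close> over the interval allowed by the next part completes to \<open>w\<close> modulo the
  neighbouring \<open>w\<close>, which does not change the wedge.
\<close>

lemma sum_horizontal_strips_ldet:
  assumes w: "w 0 = v 0" "\<And>n. w (Suc n) = (\<lambda>q. v (Suc n) q + x * w n q)"
    and "is_partition a"
  shows "(\<Sum>k\<in>horizontal_strips a. strip_weight x a k * ldet (p @ map v (plus_rho k)) cs) =
    ldet (p @ map w (plus_rho a)) cs"
  using assms(3)
proof (induction a arbitrary: p)
  case Nil
  then show ?case by (simp add: strip_weight_def)
next
  case (Cons a as)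
  let ?n = "length as" and ?W = "map w (plus_rho as)"
  have as: "is_partition as" using Cons.prems by (simp add: is_partition_def)
  have "(\<Sum>k\<in>horizontal_strips (a # as). strip_weight x (a # as) k * ldet (p @ map v (plus_rho k)) cs) =
      (\<Sum>k=part as 0..a. \<Sum>ks\<in>horizontal_strips as. x ^ (a - k) *
        (strip_weight x as ks * ldet ((p @ [v (k + ?n)]) @ map v (plus_rho ks)) cs))"
    unfolding horizontal_strips_Cons sum_Cons_image
    by (intro sum.cong refl) (auto simp: horizontal_strips_def mult.assoc)
  also have "\<dots> = (\<Sum>k=part as 0..a. x ^ (a - k) * ldet (p @ v (k + ?n) # ?W) cs)"
    unfolding sum_distrib_left[symmetric] Cons.IH[OF as] by simp
  also have "\<dots> = ldet (p @ (\<lambda>q. \<Sum>k=part as 0..a. x ^ (a - k) * v (k + ?n) q) # ?W) cs"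
    by (simp only: ldet_sum finite_atLeastAtMost ldet_scale)
  also have "\<dots> = ldet (p @ w (a + ?n) # ?W) cs"
  proof (cases as)
    \<comment> \<open>The last part has no neighbour to absorb a remainder; its interval reaches
      down to 0, where \<open>w 0 = v 0\<close> ends the recursion.\<close>
    case Nil
    have "w a q = (\<Sum>k=0..a. x ^ (a - k) * v k q)" for q
    proof (cases a)
      case 0
      then show ?thesis by (simp add: w(1))
    next
      case (Suc a')
      have "w a q = (\<Sum>k=0..a'. x ^ (a' - k) * v (Suc k) q) + x ^ Suc a' * v 0 q"
        using telescope[where w = w and v = v and x = x, OF w(2), of 0 a' 0] Suc by (simp add: w(1))
      also have "(\<Sum>k=0..a'. x ^ (a' - k) * v (Suc k) q) = (\<Sum>k=Suc 0..a. x ^ (a - k) * v k q)"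
        unfolding Suc by (subst sum.shift_bounds_cl_Suc_ivl) simp
      finally show ?thesis by (subst sum.atLeast_Suc_atMost) (simp_all add: Suc add.commute)
    qed
    then have "w a = (\<lambda>q. \<Sum>k=0..a. x ^ (a - k) * v k q)" by blast
    then show ?thesis using Nil by (simp add: Defs.part_def)
  next
    case (Cons b bs)
    have "b \<le> a" using Cons.prems Cons \<open>is_partition (a # as)\<close> by (simp add: is_partition_def)
    then have "w (a + ?n) = (\<lambda>q. (\<Sum>k=b..a. x ^ (a - k) * v (k + ?n) q) +
        x ^ Suc (a - b) * w (b + length bs) q)"
      using telescope[where w = w and v = v and x = x, OF w(2), of b a "length bs"] Cons by simp
    then show ?thesis
      unfolding Cons by (simp only: ldet_add ldet_scale) (simp add: ldet_adjacent_equal)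
  qed
  finally show ?case by simp
qed

text \<open>A positive part may stay or drop by one independently of the others, so its row sums to
  v n + y v (n - 1), which is w n. Only parts equal to 0 need a separate argument.\<close>

lemma sum_vertical_steps_ldet:
  assumes w: "w 0 = v 0" "\<And>n. w (Suc n) = (\<lambda>q. v (Suc n) q + y * v n q)"
    and "is_partition a"
  shows "(\<Sum>k\<in>vertical_steps a. strip_weight y a k * ldet (p @ map v (plus_rho k)) cs) =
    ldet (p @ map w (plus_rho a)) cs"
  using assms(3)
proof (induction a arbitrary: p)
  case Nil
  then show ?case by (simp add: strip_weight_def)
next
  case (Cons a as)
  let ?n = "length as" and ?W = "map w (plus_rho as)"
  have as: "is_partition as" using Cons.prems by (simp add: is_partition_def)
  have "(\<Sum>k\<in>vertical_steps (a # as). strip_weight y (a # as) k * ldet (p @ map v (plus_rho k)) cs) =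
      (\<Sum>k=a - 1..a. \<Sum>ks\<in>vertical_steps as. y ^ (a - k) *
        (strip_weight y as ks * ldet ((p @ [v (k + ?n)]) @ map v (plus_rho ks)) cs))"
    unfolding vertical_steps_Cons sum_Cons_image
    by (intro sum.cong refl) (auto simp: vertical_steps_def mult.assoc)
  also have "\<dots> = (\<Sum>k=a - 1..a. y ^ (a - k) * ldet (p @ v (k + ?n) # ?W) cs)"
    unfolding sum_distrib_left[symmetric] Cons.IH[OF as] by simp
  also have "\<dots> = ldet (p @ w (a + ?n) # ?W) cs"
  proof (cases a)
    case (Suc a')
    then show ?thesis by (simp add: w(2) ldet_add ldet_scale atLeastAtMostSuc_conv)
  next
    case 0
    \<comment> \<open>The part cannot decrease, but the missing \<open>v (length as - 1)\<close> already occurs in the wedge.\<close>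
    show ?thesis
    proof (cases as)
      case Nil
      then show ?thesis using 0 by (simp add: w(1))
    next
      case (Cons b bs)
      have zero: "i < ?n \<Longrightarrow> as ! i = 0" for i
        using \<open>is_partition (a # as)\<close> 0 by (auto simp: is_partition_def)
      then have "vertical_steps as = {as}"
        by (auto simp: vertical_steps_def intro: nth_equalityI)
      moreover have "strip_weight y as as = 1" by (simp add: strip_weight_def)
      ultimately have "ldet (p @ [u] @ map v (plus_rho as)) cs = ldet (p @ [u] @ ?W) cs" for u
        using Cons.IH[OF as, of "p @ [u]"] by simp
      moreover have "ldet (p @ v ?n # map v (plus_rho as)) cs = ldet (p @ w ?n # map v (plus_rho as)) cs"
        using zero[of 0] unfolding Cons
        by (simp add: w(2) ldet_add ldet_scale ldet_adjacent_equal)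
      ultimately show ?thesis using 0 by simp
    qed
  qed
  finally show ?case by simp
qed

definition vertical_strips :: "nat list \<Rightarrow> nat list set" where
  "vertical_strips a = {k \<in> vertical_steps a. is_partition k}"

text \<open>A step that leaves the partitions has a part exceeding its predecessor by exactly one.
  Adding rho makes these two entries equal, and the determinant vanishes.\<close>

lemma sum_vertical_strips_ldet:
  assumes w: "w 0 = v 0" "\<And>n. w (Suc n) = (\<lambda>q. v (Suc n) q + y * v n q)"
    and a: "is_partition a"
  shows "(\<Sum>k\<in>vertical_strips a. strip_weight y a k * ldet (map v (plus_rho k)) cs) =
    ldet (map w (plus_rho a)) cs"
proof -
  have "ldet (map v (plus_rho k)) cs = 0" if k: "k \<in> vertical_steps a" "\<not> is_partition k" for k
  proof -
    have len: "length k = length a" using k by (simp add: vertical_steps_def)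
    obtain i where i: "Suc i < length k" "k ! i < k ! Suc i"
      using k(2) unfolding is_partition_def
      by (subst (asm) sorted_wrt_iff_nth_Suc_transp) (auto simp: transp_def not_le)
    have "a ! Suc i \<le> a ! i"
      using a i len by (auto simp: is_partition_def sorted_wrt_iff_nth_less)
    moreover have "k ! Suc i \<le> a ! Suc i" "a ! i \<le> k ! i + 1"
      using k(1) i len by (auto simp: vertical_steps_def)
    ultimately have "k ! Suc i = Suc (k ! i)" using i by simp
    then have "plus_rho k ! i = plus_rho k ! Suc i"
      using i by (simp add: plus_rho_def)
    then have "\<not> distinct (plus_rho k)"
      using i nth_eq_iff_index_eq[of "plus_rho k" i "Suc i"] by auto
    then show ?thesis by (intro ldet_not_distinct) (simp add: distinct_map)
  qed
  then have "(\<Sum>k\<in>vertical_strips a. strip_weight y a k * ldet (map v (plus_rho k)) cs) =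
      (\<Sum>k\<in>vertical_steps a. strip_weight y a k * ldet (map v (plus_rho k)) cs)"
    by (intro sum.mono_neutral_left finite_vertical_steps) (auto simp: vertical_strips_def)
  then show ?thesis
    using sum_vertical_steps_ldet[OF w a, where p = "[]"] by simp
qed

section \<open>Removal of the largest letter from a tableau\<close>

definition tableaux :: "entry set \<Rightarrow> nat list \<Rightarrow> nat list \<Rightarrow> (nat \<times> nat \<Rightarrow> entry) set" where
  "tableaux E lam mu =
     {T \<in> skew_diagram lam mu \<rightarrow>\<^sub>E E.
        (\<forall>i j j'. (i, j) \<in> skew_diagram lam mu \<and> (i, j') \<in> skew_diagram lam mu \<and> j < j' \<longrightarrow>
           entry_le (T (i, j)) (T (i, j')) \<and>
           (\<forall>k. \<not> (T (i, j) = Primed k \<and> T (i, j') = Primed k))) \<and>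
        (\<forall>i i' j. (i, j) \<in> skew_diagram lam mu \<and> (i', j) \<in> skew_diagram lam mu \<and> i < i' \<longrightarrow>
           entry_le (T (i, j)) (T (i', j)) \<and>
           (\<forall>k. \<not> (T (i, j) = Unprimed k \<and> T (i', j) = Unprimed k)))}"

definition tableau_sum :: "(entry \<Rightarrow> complex) \<Rightarrow> entry set \<Rightarrow> nat list \<Rightarrow> nat list \<Rightarrow> complex" where
  "tableau_sum f E lam mu =
     (if contained mu lam then \<Sum>T\<in>tableaux E lam mu. \<Prod>b\<in>skew_diagram lam mu. f (T b) else 0)"

text \<open>One condition for both kinds of letters, so that removing a letter is treated only once;
  \<open>strips_Unprimed\<close> and \<open>strips_Primed\<close> specialise it.\<close>

definition strip_ok :: "entry \<Rightarrow> nat list \<Rightarrow> nat list \<Rightarrow> bool" where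
  "strip_ok e lam kap \<longleftrightarrow>
     (\<forall>i j j' k. (i, j) \<in> skew_diagram lam kap \<and> (i, j') \<in> skew_diagram lam kap \<and> j < j' \<longrightarrow> e \<noteq> Primed k) \<and>
     (\<forall>i i' j k. (i, j) \<in> skew_diagram lam kap \<and> (i', j) \<in> skew_diagram lam kap \<and> i < i' \<longrightarrow> e \<noteq> Unprimed k)"

definition strips :: "entry \<Rightarrow> nat list \<Rightarrow> nat list set" where
  "strips e lam = {kap. length kap = length lam \<and> is_partition kap \<and> contained kap lam \<and> strip_ok e lam kap}"

lemma mem_skew_diagram [simp]: "(i, j) \<in> skew_diagram lam mu \<longleftrightarrow> part mu i \<le> j \<and> j < part lam i"
  by (simp add: skew_diagram_def)

lemma skew_diagram_Sigma: "skew_diagram lam mu = (SIGMA i:{..<length lam}. {part mu i..<part lam i})"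
  by (auto simp: skew_diagram_def Defs.part_def split: if_splits)

lemma finite_skew_diagram [simp]: "finite (skew_diagram lam mu)"
  by (simp add: skew_diagram_Sigma)

lemma power_card_skew_diagram:
  assumes "length k = length a"
  shows "x ^ card (skew_diagram a k) = strip_weight x a k"
  using assms unfolding skew_diagram_Sigma strip_weight_def
  by (auto simp: Defs.part_def power_sum intro!: prod.cong)

lemma downward_closed_eq_lessThan:
  assumes "finite S" "\<And>i j :: nat. j \<in> S \<Longrightarrow> i < j \<Longrightarrow> i \<in> S"
  shows "S = {..<card S}"
proof -
  have "S = {..<n}" if "n = (if S = {} then 0 else Suc (Max S))" for n
  proof (cases "S = {}")
    case False
    then have "Max S \<in> S" using assms(1) by simp
    moreover have "i \<le> Max S" if "i \<in> S" for i using that assms(1) by simp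
    ultimately show ?thesis using that False assms(2)[of "Max S"] by (auto simp: less_Suc_eq_le le_less)
  qed (use that in auto)
  then show ?thesis by (metis card_lessThan)
qed

lemma entry_le_refl: "entry_le e e"
  by (cases e) auto

lemma tableaux_row:
  assumes "T \<in> tableaux E lam mu" "part mu i \<le> j" "j < j'" "j' < part lam i"
  shows "entry_le (T (i, j)) (T (i, j'))" "\<not> (T (i, j) = Primed k \<and> T (i, j') = Primed k)"
proof -
  have "(i, j) \<in> skew_diagram lam mu" "(i, j') \<in> skew_diagram lam mu" using assms by auto
  then show "entry_le (T (i, j)) (T (i, j'))" "\<not> (T (i, j) = Primed k \<and> T (i, j') = Primed k)"
    using assms(1,3) unfolding tableaux_def by blast+
qed

lemma tableaux_column:
  assumes "T \<in> tableaux E lam mu" "i < i'" "part mu i \<le> j" "part mu i' \<le> j"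
    "j < part lam i" "j < part lam i'"
  shows "entry_le (T (i, j)) (T (i', j))" "\<not> (T (i, j) = Unprimed k \<and> T (i', j) = Unprimed k)"
proof -
  have "(i, j) \<in> skew_diagram lam mu" "(i', j) \<in> skew_diagram lam mu" using assms by auto
  then show "entry_le (T (i, j)) (T (i', j))" "\<not> (T (i, j) = Unprimed k \<and> T (i', j) = Unprimed k)"
    using assms(1,2) unfolding tableaux_def by blast+
qed

text \<open>The letter \<open>e\<close> exceeds all of \<open>E\<close>, and \<open>kap\<close> is
  weakly decreasing; hence a cell to the right of or below a new cell is again new, and the order of
  entries is preserved.\<close>

lemma tableaux_extend:
  assumes E: "\<And>f. f \<in> E \<Longrightarrow> entry_le f e \<and> \<not> entry_le e f"
    and kap: "kap \<in> strips e lam" "contained mu kap" and T: "T \<in> tableaux E kap mu"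
  shows "(\<lambda>b\<in>skew_diagram lam mu. if b \<in> skew_diagram kap mu then T b else e)
    \<in> tableaux (insert e E) lam mu"
proof -
  have sub: "part kap i \<le> part lam i" for i using kap by (simp add: strips_def contained_def)
  have mu: "part mu i \<le> part kap i" for i using kap by (simp add: contained_def)
  have anti: "part kap i' \<le> part kap i" if "i < i'" for i i'
    using kap that by (intro part_antimono) (auto simp: strips_def)
  have TE: "T b \<in> E" if "b \<in> skew_diagram kap mu" for b
    using T that by (auto simp: tableaux_def)
  have row: "entry_le (T (i, j)) (T (i, j'))" "\<not> (T (i, j) = Primed k \<and> T (i, j') = Primed k)"
    if "part mu i \<le> j" "j < j'" "j' < part kap i" for i j j' k
    by (rule tableaux_row[OF T that])+
  have col: "entry_le (T (i, j)) (T (i', j))" "\<not> (T (i, j) = Unprimed k \<and> T (i', j) = Unprimed k)"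
    if "i < i'" "part mu i \<le> j" "part mu i' \<le> j" "j < part kap i" "j < part kap i'" for i i' j k
    by (rule tableaux_column[OF T that])+
  have neq: "T (i, j) \<noteq> e" "entry_le (T (i, j)) e" if "part mu i \<le> j" "j < part kap i" for i j
    using E[OF TE[of "(i, j)"]] that entry_le_refl[of e] by auto
  have ok: "strip_ok e lam kap" using kap by (simp add: strips_def)
  show ?thesis
    unfolding tableaux_def
  proof (intro CollectI conjI allI impI PiE_I; (elim conjE)?)
    fix b assume "b \<in> skew_diagram lam mu"
    then show "(\<lambda>b\<in>skew_diagram lam mu. if b \<in> skew_diagram kap mu then T b else e) b \<in> insert e E"
      using TE by auto
  next
    fix i j j' assume "(i, j) \<in> skew_diagram lam mu" "(i, j') \<in> skew_diagram lam mu" "j < j'"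
    moreover from this have "e \<noteq> Primed k" if "part kap i \<le> j" for k
      using ok that sub unfolding strip_ok_def by fastforce
    ultimately show "entry_le ((\<lambda>b\<in>skew_diagram lam mu. if b \<in> skew_diagram kap mu then T b else e) (i, j))
        ((\<lambda>b\<in>skew_diagram lam mu. if b \<in> skew_diagram kap mu then T b else e) (i, j'))"
      and "\<not> ((\<lambda>b\<in>skew_diagram lam mu. if b \<in> skew_diagram kap mu then T b else e) (i, j) = Primed k \<and>
        (\<lambda>b\<in>skew_diagram lam mu. if b \<in> skew_diagram kap mu then T b else e) (i, j') = Primed k)" for k
      using row[of i j j'] neq[of i j] entry_le_refl[of e] by (auto simp: not_less)
  next
    fix i i' j assume "(i, j) \<in> skew_diagram lam mu" "(i', j) \<in> skew_diagram lam mu" "i < i'"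
    moreover from this have "e \<noteq> Unprimed k" if "part kap i \<le> j" "part kap i' \<le> j" for k
      using ok that unfolding strip_ok_def by fastforce
    ultimately show "entry_le ((\<lambda>b\<in>skew_diagram lam mu. if b \<in> skew_diagram kap mu then T b else e) (i, j))
        ((\<lambda>b\<in>skew_diagram lam mu. if b \<in> skew_diagram kap mu then T b else e) (i', j))"
      and "\<not> ((\<lambda>b\<in>skew_diagram lam mu. if b \<in> skew_diagram kap mu then T b else e) (i, j) = Unprimed k \<and>
        (\<lambda>b\<in>skew_diagram lam mu. if b \<in> skew_diagram kap mu then T b else e) (i', j) = Unprimed k)" for k
      using col[of i i' j] neq[of i j] entry_le_refl[of e] anti[of i i'] by (auto simp: not_less)
  qed auto
qed

text \<open>The shape left after erasing \<open>e\<close>. Its rows are defined as cardinalities;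
  that the counted columns form initial segments is a property of tableaux.\<close>

definition inner_shape :: "entry \<Rightarrow> nat list \<Rightarrow> nat list \<Rightarrow> (nat \<times> nat \<Rightarrow> entry) \<Rightarrow> nat list" where
  "inner_shape e lam mu T =
     map (\<lambda>i. card {j. j < part lam i \<and> (j < part mu i \<or> T (i, j) \<noteq> e)}) [0..<length lam]"

lemma part_inner_shape:
  "part (inner_shape e lam mu T) i = card {j. j < part lam i \<and> (j < part mu i \<or> T (i, j) \<noteq> e)}"
  by (auto simp: inner_shape_def Defs.part_def)

text \<open>In a row, everything to the right of an \<open>e\<close> is again \<open>e\<close>,
  since \<open>e\<close> is the largest letter.\<close>

lemma less_part_inner_shape:
  assumes E: "\<And>f. f \<in> E \<Longrightarrow> entry_le f e \<and> \<not> entry_le e f"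
    and T: "T \<in> tableaux (insert e E) lam mu"
  shows "j < part (inner_shape e lam mu T) i \<longleftrightarrow> j < part lam i \<and> (j < part mu i \<or> T (i, j) \<noteq> e)"
proof -
  let ?K = "{j. j < part lam i \<and> (j < part mu i \<or> T (i, j) \<noteq> e)}"
  have "?K = {..<card ?K}"
  proof (rule downward_closed_eq_lessThan)
    fix j' j assume j: "j \<in> ?K" "j' < j"
    show "j' \<in> ?K"
    proof (cases "j' < part mu i")
      case False
      then have "(i, j') \<in> skew_diagram lam mu" "(i, j) \<in> skew_diagram lam mu" using j by auto
      then have "entry_le (T (i, j')) (T (i, j))" "T (i, j) \<in> insert e E"
        using T j by (auto simp: tableaux_def)
      moreover have "T (i, j) \<noteq> e" using j False by auto
      ultimately show ?thesis using j E by auto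
    qed (use j in auto)
  qed simp
  then have "j \<in> {..<card ?K} \<longleftrightarrow> j \<in> ?K" by blast
  then show ?thesis by (simp add: part_inner_shape)
qed

lemma inner_shape_strip:
  assumes E: "\<And>f. f \<in> E \<Longrightarrow> entry_le f e \<and> \<not> entry_le e f"
    and lam: "is_partition lam" and mu: "is_partition mu" "contained mu lam"
    and T: "T \<in> tableaux (insert e E) lam mu"
  defines "kap \<equiv> inner_shape e lam mu T"
  shows "kap \<in> strips e lam" and "contained mu kap"
    and "restrict T (skew_diagram kap mu) \<in> tableaux E kap mu"
proof -
  have less: "j < part kap i \<longleftrightarrow> j < part lam i \<and> (j < part mu i \<or> T (i, j) \<noteq> e)" for i j
    unfolding kap_def by (rule less_part_inner_shape[OF E T])
  have row: "entry_le (T (i, j)) (T (i, j'))" "\<not> (T (i, j) = Primed k \<and> T (i, j') = Primed k)"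
    if "part mu i \<le> j" "j < j'" "j' < part lam i" for i j j' k
    by (rule tableaux_row[OF T that])+
  have col: "entry_le (T (i, j)) (T (i', j))" "\<not> (T (i, j) = Unprimed k \<and> T (i', j) = Unprimed k)"
    if "i < i'" "part mu i \<le> j" "part mu i' \<le> j" "j < part lam i" "j < part lam i'" for i i' j k
    by (rule tableaux_column[OF T that])+
  have TE: "T (i, j) \<in> insert e E" if "part mu i \<le> j" "j < part lam i" for i j
    using T that by (auto simp: tableaux_def)
  have sub: "part kap i \<le> part lam i" for i using less[of _ i] by (meson leI less_irrefl)
  have mu_le: "part mu i \<le> part lam i" for i using mu by (simp add: contained_def)
  show mu_kap: "contained mu kap"
    unfolding contained_def
  proof
    fix i show "part mu i \<le> part kap i"
      using less[of "part kap i" i] mu_le[of i] by (auto intro: leI)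
  qed
  have len: "length kap = length lam" by (simp add: kap_def inner_shape_def)
  have anti: "part kap i' \<le> part kap i" if "i < i'" for i i'
  proof (rule ccontr)
    assume "\<not> ?thesis"
    \<comment> \<open>Column \<open>part kap i\<close> gives the contradiction: its cell in row i
      carries \<open>e\<close>, while its cell in the lower row i' would carry a smaller
      letter.\<close>
    then have j: "part kap i < part kap i'" by simp
    let ?j = "part kap i"
    have i': "?j < part lam i'" "?j < part mu i' \<or> T (i', ?j) \<noteq> e" using less[of ?j i'] j by auto
    have le: "part lam i' \<le> part lam i" "part mu i' \<le> part mu i"
      using that lam mu by (simp_all add: part_antimono)
    then have i: "?j \<ge> part mu i" "T (i, ?j) = e" using less[of ?j i] i' by auto
    then have ne: "T (i', ?j) \<noteq> e" using i' le by auto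
    have "entry_le (T (i, ?j)) (T (i', ?j))" using i i' le that by (intro col) auto
    moreover have "T (i', ?j) \<in> E" using TE[of i' ?j] i i' le ne by auto
    ultimately show False using i E by auto
  qed
  have "is_partition kap"
    using anti by (simp add: is_partition_iff_part)
  moreover have "e \<noteq> Primed k" if "(i, j) \<in> skew_diagram lam kap" "(i, j') \<in> skew_diagram lam kap" "j < j'"
    for i j j' k
    using row(2)[of i j j' k] that less[of j i] less[of j' i] by auto
  moreover have "e \<noteq> Unprimed k" if "(i, j) \<in> skew_diagram lam kap" "(i', j) \<in> skew_diagram lam kap" "i < i'"
    for i i' j k
    using col(2)[of i i' j k] that less[of j i] less[of j i'] by auto
  ultimately show "kap \<in> strips e lam"
    using sub len unfolding strips_def strip_ok_def contained_def by blast
  let ?T = "restrict T (skew_diagram kap mu)"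
  have T_eq: "?T (i, j) = T (i, j)" if "(i, j) \<in> skew_diagram kap mu" for i j
    using that by simp
  have kap_lam: "j < part lam i" if "j < part kap i" for i j
    using that sub[of i] by linarith
  show "?T \<in> tableaux E kap mu"
    unfolding tableaux_def
  proof (intro CollectI conjI allI impI PiE_I; (elim conjE)?)
    fix b assume "b \<in> skew_diagram kap mu"
    then show "?T b \<in> E" using less TE kap_lam by (cases b) fastforce
  next
    fix i j j' assume ij: "(i, j) \<in> skew_diagram kap mu" "(i, j') \<in> skew_diagram kap mu" "j < j'"
    then have "part mu i \<le> j" "j' < part lam i" using kap_lam by auto
    then show "entry_le (?T (i, j)) (?T (i, j'))"
      and "\<not> (?T (i, j) = Primed k \<and> ?T (i, j') = Primed k)" for k
      unfolding T_eq[OF ij(1)] T_eq[OF ij(2)] using row ij(3) by blast+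
  next
    fix i i' j assume ij: "(i, j) \<in> skew_diagram kap mu" "(i', j) \<in> skew_diagram kap mu" "i < i'"
    then have "part mu i \<le> j" "part mu i' \<le> j" "j < part lam i" "j < part lam i'"
      using kap_lam by auto
    then show "entry_le (?T (i, j)) (?T (i', j))"
      and "\<not> (?T (i, j) = Unprimed k \<and> ?T (i', j) = Unprimed k)" for k
      unfolding T_eq[OF ij(1)] T_eq[OF ij(2)] using col ij(3) by blast+
  qed simp
qed

lemma finite_tableaux: "finite E \<Longrightarrow> finite (tableaux E lam mu)"
  by (rule finite_subset[of _ "skew_diagram lam mu \<rightarrow>\<^sub>E E"]) (auto simp: tableaux_def intro: finite_PiE)

lemma finite_strips: "finite (strips e lam)"
proof (rule finite_subset)
  show "strips e lam \<subseteq> {k. set k \<subseteq> {..Max (insert 0 (set lam))} \<and> length k = length lam}"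
  proof
    fix k assume k: "k \<in> strips e lam"
    have "x \<le> Max (insert 0 (set lam))" if x: "x \<in> set k" for x
    proof -
      obtain i where i: "i < length k" "x = k ! i" using x by (auto simp: in_set_conv_nth)
      have "part k i \<le> part lam i" using k by (simp add: strips_def contained_def)
      then have "x \<le> lam ! i" "lam ! i \<in> set lam" using i k by (auto simp: Defs.part_def strips_def)
      then show ?thesis by (meson List.finite_set Max_ge finite_insert insertI2 le_trans)
    qed
    then show "k \<in> {k. set k \<subseteq> {..Max (insert 0 (set lam))} \<and> length k = length lam}"
      using k by (auto simp: strips_def)
  qed
qed (rule finite_lists_length_eq, simp)

text \<open>A tableau is determined by its inner shape \<open>kap\<close> and its restriction to
  \<open>kap\<close>, because all other cells carry \<open>e\<close>. An arbitrary alphabet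
  \<open>E\<close> allows this to be iterated over letters of both kinds.\<close>

lemma tableau_sum_insert:
  assumes E: "\<And>g. g \<in> E \<Longrightarrow> entry_le g e \<and> \<not> entry_le e g" and fin: "finite E"
    and lam: "is_partition lam" and mu: "is_partition mu" and len: "length mu = length lam"
  shows "tableau_sum f (insert e E) lam mu =
    (\<Sum>kap\<in>strips e lam. strip_weight (f e) lam kap * tableau_sum f E kap mu)"
proof (cases "contained mu lam")
  case False
  then have "\<not> contained mu kap" if "kap \<in> strips e lam" for kap
    using that unfolding strips_def contained_def by (auto intro: le_trans)
  then show ?thesis using False by (simp add: tableau_sum_def)
next
  case True
  let ?S = "{kap \<in> strips e lam. contained mu kap}"
  let ?ext = "\<lambda>kap T. \<lambda>b\<in>skew_diagram lam mu. if b \<in> skew_diagram kap mu then T b else e"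
  let ?inner = "inner_shape e lam mu"
  have e: "e \<notin> E" using E entry_le_refl by blast
  have "(\<Sum>kap\<in>strips e lam. strip_weight (f e) lam kap * tableau_sum f E kap mu) =
      (\<Sum>kap\<in>?S. strip_weight (f e) lam kap * tableau_sum f E kap mu)"
    by (rule sum.mono_neutral_right) (auto simp: finite_strips tableau_sum_def)
  also have "\<dots> = (\<Sum>kap\<in>?S. \<Sum>T\<in>tableaux E kap mu.
      f e ^ card (skew_diagram lam kap) * (\<Prod>b\<in>skew_diagram kap mu. f (T b)))"
    by (intro sum.cong refl)
      (auto simp: tableau_sum_def sum_distrib_left strips_def power_card_skew_diagram)
  also have "\<dots> = (\<Sum>(kap, T)\<in>(SIGMA kap:?S. tableaux E kap mu).
      f e ^ card (skew_diagram lam kap) * (\<Prod>b\<in>skew_diagram kap mu. f (T b)))"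
    by (rule sum.Sigma) (auto simp: finite_strips finite_tableaux fin)
  also have "\<dots> = (\<Sum>T\<in>tableaux (insert e E) lam mu. \<Prod>b\<in>skew_diagram lam mu. f (T b))"
  proof (rule sum.reindex_bij_witness[where j = "\<lambda>(kap, T). ?ext kap T"
        and i = "\<lambda>T. (?inner T, restrict T (skew_diagram (?inner T) mu))"])
    fix T assume T: "T \<in> tableaux (insert e E) lam mu"
    note inner = inner_shape_strip[OF E lam mu True T] less_part_inner_shape[OF E T]
    then show "(?inner T, restrict T (skew_diagram (?inner T) mu)) \<in> (SIGMA kap:?S. tableaux E kap mu)"
      by auto
    show "(case (?inner T, restrict T (skew_diagram (?inner T) mu)) of (kap, T) \<Rightarrow> ?ext kap T) = T"
    proof
      fix b
      show "(case (?inner T, restrict T (skew_diagram (?inner T) mu)) of (kap, T) \<Rightarrow> ?ext kap T) b = T b"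
        using inner(4) T by (cases b) (auto simp: tableaux_def PiE_def extensional_def)
    qed
  next
    fix p assume "p \<in> (SIGMA kap:?S. tableaux E kap mu)"
    then obtain kap T where p: "p = (kap, T)" and kap: "kap \<in> strips e lam" "contained mu kap"
      and T: "T \<in> tableaux E kap mu" by auto
    have ext: "?ext kap T \<in> tableaux (insert e E) lam mu"
      by (rule tableaux_extend[OF E kap T])
    then show "(case p of (kap, T) \<Rightarrow> ?ext kap T) \<in> tableaux (insert e E) lam mu"
      by (simp add: p)
    have sub: "part kap i \<le> part lam i" for i using kap by (simp add: strips_def contained_def)
    have mu_kap: "part mu i \<le> part kap i" for i using kap by (simp add: contained_def)
    have TE: "T (i, j) \<noteq> e" if "part mu i \<le> j" "j < part kap i" for i j
      using T that e by (auto simp: tableaux_def dest: PiE_mem)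
    have "{j. j < part lam i \<and> (j < part mu i \<or> ?ext kap T (i, j) \<noteq> e)} = {..<part kap i}" for i
      using TE[of i] sub[of i] mu_kap[of i] by (auto simp: not_less)
    then have "part (?inner (?ext kap T)) i = part kap i" for i
      unfolding part_inner_shape by simp
    moreover have "length (?inner (?ext kap T)) = length kap"
      using kap by (simp add: inner_shape_def strips_def)
    ultimately have inner: "?inner (?ext kap T) = kap"
      by (intro part_eqI)
    have "restrict (?ext kap T) (skew_diagram kap mu) = T"
    proof
      fix b show "restrict (?ext kap T) (skew_diagram kap mu) b = T b"
        using T less_le_trans[OF _ sub]
        by (cases b; cases "b \<in> skew_diagram kap mu") (auto simp: tableaux_def PiE_def extensional_def)
    qed
    then show "(case (case p of (kap, T) \<Rightarrow> ?ext kap T) of T \<Rightarrow>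
        (?inner T, restrict T (skew_diagram (?inner T) mu))) = p"
      by (simp add: p inner)
    have D: "skew_diagram lam mu = skew_diagram kap mu \<union> skew_diagram lam kap"
      "skew_diagram kap mu \<inter> skew_diagram lam kap = {}"
      using sub mu_kap less_le_trans[OF _ sub] le_trans[OF mu_kap]
      by (auto simp: skew_diagram_def not_less)
    have "(\<Prod>b\<in>skew_diagram lam mu. f (?ext kap T b)) =
        (\<Prod>b\<in>skew_diagram kap mu. f (?ext kap T b)) * (\<Prod>b\<in>skew_diagram lam kap. f (?ext kap T b))"
      using D by (subst D(1)) (rule prod.union_disjoint, auto)
    also have "(\<Prod>b\<in>skew_diagram kap mu. f (?ext kap T b)) = (\<Prod>b\<in>skew_diagram kap mu. f (T b))"
      using D by (intro prod.cong) auto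
    also have "(\<Prod>b\<in>skew_diagram lam kap. f (?ext kap T b)) = (\<Prod>b\<in>skew_diagram lam kap. f e)"
      using D by (intro prod.cong) auto
    finally show "(\<Prod>b\<in>skew_diagram lam mu. f ((case p of (kap, T) \<Rightarrow> ?ext kap T) b)) =
        (case p of (kap, T) \<Rightarrow> f e ^ card (skew_diagram lam kap) * (\<Prod>b\<in>skew_diagram kap mu. f (T b)))"
      by (simp add: p mult.commute)
  qed
  finally show ?thesis using True by (simp add: tableau_sum_def)
qed

text \<open>If the next part of \<open>lam\<close> exceeded \<open>part k i\<close>, the column
  \<open>part k i\<close> would contain cells of rows i and i + 1. Conversely, interlacing forbids
  two cells in one column.\<close>

lemma strips_Unprimed:
  assumes "is_partition lam"
  shows "strips (Unprimed n) lam = horizontal_strips lam"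
proof (intro set_eqI iffI)
  fix k assume k: "k \<in> strips (Unprimed n) lam"
  have "part lam (Suc i) \<le> part k i" for i
  proof (rule ccontr)
    assume "\<not> ?thesis"
    moreover have "part lam (Suc i) \<le> part lam i" "part k (Suc i) \<le> part k i"
      using assms k by (auto intro: part_antimono simp: strips_def)
    ultimately have "(i, part k i) \<in> skew_diagram lam k" "(Suc i, part k i) \<in> skew_diagram lam k"
      by auto
    then show False using k unfolding strips_def strip_ok_def by blast
  qed
  moreover have "part k i \<le> part lam i" for i using k by (simp add: strips_def contained_def)
  ultimately show "k \<in> horizontal_strips lam"
    using k unfolding horizontal_strips_def strips_def by (auto simp flip: part_nth)
next
  fix k assume k: "k \<in> horizontal_strips lam"
  have len: "length k = length lam" using k by (simp add: horizontal_strips_def)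
  have sub: "part k i \<le> part lam i" "part lam (Suc i) \<le> part k i" for i
    using k by (cases "i < length lam"; force simp: horizontal_strips_def Defs.part_def)+
  have part: "is_partition k"
    unfolding is_partition_iff_part using le_trans[OF sub(1) sub(2)] by blast
  have "False" if "(i, j) \<in> skew_diagram lam k" "(i', j) \<in> skew_diagram lam k" "i < i'" for i i' j
    using that sub(2)[of i] part_antimono[OF assms, of "Suc i" i'] by simp
  then show "k \<in> strips (Unprimed n) lam"
    using len part sub unfolding strips_def strip_ok_def contained_def by blast
qed

lemma strips_Primed: "strips (Primed n) lam = vertical_strips lam"
proof (intro set_eqI iffI)
  fix k assume k: "k \<in> strips (Primed n) lam"
  have "part lam i \<le> part k i + 1" for i
  proof (rule ccontr)
    assume "\<not> ?thesis"
    then have "(i, part k i) \<in> skew_diagram lam k" "(i, Suc (part k i)) \<in> skew_diagram lam k"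
      by auto
    then show False using k unfolding strips_def strip_ok_def by blast
  qed
  moreover have "part k i \<le> part lam i" for i using k by (simp add: strips_def contained_def)
  ultimately show "k \<in> vertical_strips lam"
    using k unfolding vertical_strips_def vertical_steps_def strips_def
    by (auto simp flip: part_nth)
next
  fix k assume k: "k \<in> vertical_strips lam"
  have sub: "part k i \<le> part lam i" "part lam i \<le> part k i + 1" for i
    using k by (cases "i < length lam"; force simp: vertical_strips_def vertical_steps_def Defs.part_def)+
  have "False" if "(i, j) \<in> skew_diagram lam k" "(i, j') \<in> skew_diagram lam k" "j < j'" for i j j'
    using that sub(2)[of i] by simp
  then show "k \<in> strips (Primed n) lam"
    using k sub unfolding strips_def strip_ok_def contained_def vertical_strips_def vertical_steps_def
    by blast
qed

section \<open>Free fermionic weights and power series\<close>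

text \<open>Dividing by 1 - x z means solving F = g + x z F, and this is the recursion between the
  rows of F and g.\<close>

lemma sum_horizontal_strips_toeplitz_det:
  assumes "is_partition a"
  shows "(\<Sum>k\<in>horizontal_strips a. strip_weight x a k * toeplitz_det g (plus_rho k) cs) =
    toeplitz_det (g * row_series x 0) (plus_rho a) cs"
proof -
  let ?F = "g * row_series x 0" and ?i = "inverse (1 - fps_const x * fps_X :: complex fps)"
  have "?F = g * (?i * (1 - fps_const x * fps_X)) + fps_const x * fps_X * ?F"
    by (simp add: row_series_def algebra_simps)
  then have F: "?F = g + fps_const x * fps_X * ?F"
    unfolding inverse_row_denominator by simp
  show ?thesis
    using sum_horizontal_strips_ldet[where v = "toeplitz g" and w = "toeplitz ?F" and x = x,
        OF toeplitz_shift[OF F] assms, where p = "[]" and cs = cs]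
    by (simp add: toeplitz_det_def)
qed

lemma sum_vertical_strips_toeplitz_det:
  assumes "is_partition a"
  shows "(\<Sum>k\<in>vertical_strips a. strip_weight y a k * toeplitz_det g (plus_rho k) cs) =
    toeplitz_det (g * row_series 0 y) (plus_rho a) cs"
proof -
  let ?F = "g * row_series 0 y"
  have F: "?F = g + fps_const y * fps_X * g"
    by (simp add: row_series_def algebra_simps)
  show ?thesis
    using sum_vertical_strips_ldet[where v = "toeplitz g" and w = "toeplitz ?F" and y = y,
        OF toeplitz_shift[OF F] assms, where cs = cs]
    by (simp add: toeplitz_det_def)
qed

lemma tableaux_no_letters:
  assumes len: "length mu = length lam"
  shows "tableau_sum f {} lam mu = of_bool (lam = mu)"
proof (cases "lam = mu")
  case True
  then have "skew_diagram lam mu = {}" by (auto simp: skew_diagram_def)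
  then show ?thesis using True by (auto simp: tableau_sum_def contained_def tableaux_def)
next
  case False
  have "tableaux {} lam mu = {}" if sub: "contained mu lam"
  proof -
    have "\<exists>i. part lam i \<noteq> part mu i" using False part_eqI[of lam mu] len by auto
    then obtain i where "part mu i < part lam i"
      using sub unfolding contained_def by (metis le_neq_implies_less)
    then have "(i, part mu i) \<in> skew_diagram lam mu" by simp
    then have "skew_diagram lam mu \<rightarrow>\<^sub>E {} = ({} :: (nat \<times> nat \<Rightarrow> entry) set)"
      by (subst PiE_eq_empty_iff) blast
    then show ?thesis unfolding tableaux_def by simp
  qed
  then show ?thesis using False by (simp add: tableau_sum_def)
qed

lemma tableau_sum_unprimed:
  assumes "is_partition lam" "is_partition mu" "length mu = length lam"
  shows "tableau_sum f (Unprimed ` {1..n}) lam mu =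
    toeplitz_det (\<Prod>i=1..n. row_series (f (Unprimed i)) 0) (plus_rho lam) (plus_rho mu)"
  using assms(1,3)
proof (induction n arbitrary: lam)
  case 0
  then show ?case
    using assms(2) by (simp add: tableaux_no_letters toeplitz_det_1 strict_partition_plus_rho plus_rho_inject)
next
  case (Suc n)
  let ?g = "\<Prod>i=1..n. row_series (f (Unprimed i)) 0"
  have E: "Unprimed ` {1..Suc n} = insert (Unprimed (Suc n)) (Unprimed ` {1..n})"
    by (auto simp: atLeastAtMostSuc_conv)
  have "tableau_sum f (Unprimed ` {1..Suc n}) lam mu =
      (\<Sum>k\<in>strips (Unprimed (Suc n)) lam. strip_weight (f (Unprimed (Suc n))) lam k *
        tableau_sum f (Unprimed ` {1..n}) k mu)"
    unfolding E using assms(2) Suc.prems by (intro tableau_sum_insert) auto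
  also have "\<dots> = (\<Sum>k\<in>strips (Unprimed (Suc n)) lam. strip_weight (f (Unprimed (Suc n))) lam k *
        toeplitz_det ?g (plus_rho k) (plus_rho mu))"
    using Suc.prems by (intro sum.cong refl arg_cong2[of _ _ _ _ "(*)"] Suc.IH) (auto simp: strips_def)
  finally show ?case
    using Suc.prems by (simp add: strips_Unprimed sum_horizontal_strips_toeplitz_det)
qed

text \<open>Primed letters are the largest, so they are removed before any unprimed one; the base
  case is the tableau sum over unprimed letters.\<close>

lemma tableau_sum_primed:
  assumes "is_partition lam" "is_partition mu" "length mu = length lam"
  shows "tableau_sum f (Unprimed ` {1..N} \<union> Primed ` {1..n}) lam mu =
    toeplitz_det ((\<Prod>i=1..N. row_series (f (Unprimed i)) 0) * (\<Prod>i=1..n. row_series 0 (f (Primed i))))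
      (plus_rho lam) (plus_rho mu)"
  using assms(1,3)
proof (induction n arbitrary: lam)
  case 0
  then show ?case using tableau_sum_unprimed[of lam mu f N] assms(2) by simp
next
  case (Suc n)
  let ?E = "Unprimed ` {1..N} \<union> Primed ` {1..n}"
  let ?g = "(\<Prod>i=1..N. row_series (f (Unprimed i)) 0) * (\<Prod>i=1..n. row_series 0 (f (Primed i)))"
  have E: "Unprimed ` {1..N} \<union> Primed ` {1..Suc n} = insert (Primed (Suc n)) ?E"
    by (auto simp: atLeastAtMostSuc_conv)
  have "tableau_sum f (Unprimed ` {1..N} \<union> Primed ` {1..Suc n}) lam mu =
      (\<Sum>k\<in>strips (Primed (Suc n)) lam. strip_weight (f (Primed (Suc n))) lam k * tableau_sum f ?E k mu)"
    unfolding E using assms(2) Suc.prems by (intro tableau_sum_insert) auto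
  also have "\<dots> = (\<Sum>k\<in>strips (Primed (Suc n)) lam. strip_weight (f (Primed (Suc n))) lam k *
        toeplitz_det ?g (plus_rho k) (plus_rho mu))"
    using Suc.prems by (intro sum.cong refl arg_cong2[of _ _ _ _ "(*)"] Suc.IH) (auto simp: strips_def)
  finally show ?case
    using Suc.prems by (simp add: strips_Primed sum_vertical_strips_toeplitz_det mult.assoc)
qed

lemma super_schur_tableau_sum:
  "super_schur N lam mu x y =
    tableau_sum (case_entry x y) (Unprimed ` {1..N} \<union> Primed ` {1..N}) lam mu"
proof -
  let ?D = "skew_diagram lam mu" and ?f = "case_entry x y"
  let ?E = "Unprimed ` {1..N} \<union> Primed ` {1..N}"
  have "(\<Prod>b\<in>?D. ?f (T b)) = (\<Prod>i=1..N. x i ^ card {b \<in> ?D. T b = Unprimed i}) *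
      (\<Prod>j=1..N. y j ^ card {b \<in> ?D. T b = Primed j})" if T: "T \<in> ?D \<rightarrow>\<^sub>E ?E" for T
  proof -
    have "(\<Prod>b\<in>?D. ?f (T b)) = (\<Prod>e\<in>?E. \<Prod>b\<in>{b \<in> ?D. T b = e}. ?f (T b))"
      by (rule prod.group[symmetric]) (use T in \<open>auto dest: PiE_mem\<close>)
    also have "\<dots> = (\<Prod>e\<in>?E. ?f e ^ card {b \<in> ?D. T b = e})"
      by (intro prod.cong refl) simp
    also have "\<dots> = (\<Prod>e\<in>Unprimed ` {1..N}. ?f e ^ card {b \<in> ?D. T b = e}) *
        (\<Prod>e\<in>Primed ` {1..N}. ?f e ^ card {b \<in> ?D. T b = e})"
      by (rule prod.union_disjoint) auto
    finally show ?thesis by (simp add: prod.reindex inj_on_def)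
  qed
  then show ?thesis
    unfolding super_schur_def tableau_sum_def tableaux_def super_tableaux_def
    by (auto intro!: sum.cong)
qed

lemma row_series_split: "row_series x y = row_series x 0 * row_series 0 y"
  by (simp add: row_series_def mult.commute)

lemma super_schur_toeplitz_det:
  assumes "is_partition lam" "is_partition mu" "length mu = length lam"
  shows "super_schur N lam mu x y =
    toeplitz_det (\<Prod>i=1..N. row_series (x i) (y i)) (plus_rho lam) (plus_rho mu)"
  unfolding super_schur_tableau_sum tableau_sum_primed[OF assms]
  by (subst (3) row_series_split) (simp add: prod.distrib)

section \<open>Logarithms of power series and the choice of parameters\<close>

lemma fps_linear_ode_unique:
  fixes E G A :: "complex fps"
  assumes "fps_deriv E = E * A" "fps_deriv G = G * A" "E $ 0 = G $ 0"
  shows "E = G"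
proof (rule fps_ext)
  fix n show "E $ n = G $ n"
  proof (induction n rule: less_induct)
    case (less n)
    show ?case
    proof (cases n)
      case (Suc m)
      have "of_nat (Suc m) * E $ Suc m = (E * A) $ m" "of_nat (Suc m) * G $ Suc m = (G * A) $ m"
        unfolding assms(1,2)[symmetric] by simp_all
      moreover have "(E * A) $ m = (G * A) $ m"
        unfolding fps_mult_nth using less Suc by (intro sum.cong) auto
      ultimately show ?thesis unfolding Suc by (metis mult_cancel_left of_nat_neq_0)
    qed (use assms(3) in simp)
  qed
qed

text \<open>The logarithm of a series with constant term 1, as the primitive of its logarithmic
  derivative.\<close>

definition log_series :: "complex fps \<Rightarrow> complex fps" where
  "log_series R = fps_integral0 (fps_deriv R * inverse R)"

lemma log_series_nth_0 [simp]: "log_series R $ 0 = 0"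
  by (simp add: log_series_def)

text \<open>Both sides have constant term 1 and solve F' = F A, where A is the sum of the
  logarithmic derivatives of the \<open>R i\<close>.\<close>

lemma exp_sum_log_series:
  fixes R :: "nat \<Rightarrow> complex fps"
  assumes "\<And>i. i \<in> {1..N} \<Longrightarrow> R i $ 0 = 1"
  shows "fps_exp 1 oo (\<Sum>i=1..N. log_series (R i)) = (\<Prod>i=1..N. R i)"
proof (rule fps_linear_ode_unique)
  let ?L = "\<Sum>i=1..N. log_series (R i)"
  have L0: "?L $ 0 = 0" by (simp add: fps_sum_nth)
  have dL: "fps_deriv ?L = (\<Sum>i=1..N. fps_deriv (R i) * inverse (R i))"
    by (simp add: fps_deriv_sum log_series_def fps_deriv_fps_integral)
  show "fps_deriv (fps_exp 1 oo ?L) = (fps_exp 1 oo ?L) * fps_deriv ?L"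
    using L0 by (simp add: fps_compose_deriv)
  have "fps_deriv (\<Prod>i=1..n. R i) = (\<Prod>i=1..n. R i) * (\<Sum>i=1..n. fps_deriv (R i) * inverse (R i))"
    if "n \<le> N" for n
    using that
  proof (induction n)
    case (Suc n)
    have "inverse (R (Suc n)) * R (Suc n) = 1"
      using assms[of "Suc n"] Suc.prems by (intro inverse_mult_eq_1) auto
    then have "R (Suc n) * (fps_deriv (R (Suc n)) * inverse (R (Suc n))) = fps_deriv (R (Suc n))"
      by (metis mult.commute mult.left_commute mult_1_right)
    then show ?case
      using Suc by (simp add: distrib_left distrib_right mult.assoc)
  qed simp
  then show "fps_deriv (\<Prod>i=1..N. R i) = (\<Prod>i=1..N. R i) * fps_deriv ?L"
    unfolding dL by simp
  have "(\<Prod>i=1..n. R i) $ 0 = 1" if "n \<le> N" for n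
    using that assms by (induction n) auto
  then show "(fps_exp 1 oo ?L) $ 0 = (\<Prod>i=1..N. R i) $ 0" by simp
qed

lemma row_series_nth_0: "row_series x y $ 0 = 1"
  by (simp add: row_series_def)

lemma grid_Z_free_fermionic:
  assumes nz: "\<And>i. i \<ge> 1 \<Longrightarrow> f i A1 \<noteq> 0" "\<And>i. i \<ge> 1 \<Longrightarrow> f i B1 \<noteq> 0"
    and ff: "\<And>i. i \<ge> 1 \<Longrightarrow> f i A1 * f i A2 + f i B1 * f i B2 = f i C1 * f i C2"
    and a: "strict_partition a" "set a \<subseteq> {..<m}" and b: "strict_partition b" "set b \<subseteq> {..<m}"
  shows "grid_Z f m N (set a) (set b) =
    (\<Prod>i=1..N. f i A1 ^ (m - length a) * f i B1 ^ length a) *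
    toeplitz_det (\<Prod>i=1..N. row_series (f i B2 / f i A1) (f i A2 / f i B1)) a b"
proof -
  have "f i C1 / f i B1 * (f i C2 / f i A1) = f i B2 / f i A1 + f i A2 / f i B1" if "i \<ge> 1" for i
    using nz[OF that] ff[OF that] by (simp add: field_simps)
  then have "grid_Z (\<lambda>i. normalized (f i)) m N (set a) (set b) =
      toeplitz_det (\<Prod>i=1..N. row_series (f i B2 / f i A1) (f i A2 / f i B1)) a b"
    unfolding normalized_def by (intro grid_Z_toeplitz_det a b)
  moreover have "card (set a) = length a"
    using a(1) by (intro distinct_card) (metis desc_list_set desc_list_def distinct_rev distinct_sorted_list_of_set)
  ultimately show ?thesis
    using grid_Z_normalized[OF nz a(2)] by simp
qed

section \<open>Necessity of the free fermion condition\<close>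

lemma grid_Z_small:
  fixes x y c d :: "nat \<Rightarrow> complex"
  defines "G \<equiv> grid_Z (\<lambda>i. row_weights (x i) (y i) (c i) (d i)) (Suc (Suc (Suc 0)))"
  defines "p \<equiv> \<lambda>N. G N {Suc 0} {0}" and "q \<equiv> \<lambda>N. G N {Suc (Suc 0)} {0}"
    and "r \<equiv> \<lambda>N. G N {Suc (Suc 0), Suc 0} {Suc 0, 0}"
  shows "p (Suc N) = p N + c (Suc N) * d (Suc N)"
    and "q (Suc N) = q N + p N * (c (Suc N) * d (Suc N)) + c (Suc N) * d (Suc N) * x (Suc N)"
    and "r (Suc N) = r N + p N * (c (Suc N) * d (Suc N)) + c (Suc N) * d (Suc N) * y (Suc N)"
proof -
  have expand: "G (Suc N) A B = (\<Sum>C\<in>Pow {..<Suc (Suc (Suc 0))}. G N A C *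
      row_Z (row_weights (x (Suc N)) (y (Suc N)) (c (Suc N)) (d (Suc N))) (Suc (Suc (Suc 0))) Plus C B)"
    for N A B by (simp add: G_def)
  have zero: "G N A B = 0" if "A \<subseteq> {..<Suc (Suc (Suc 0))}" "B \<subseteq> {..<Suc (Suc (Suc 0))}" "card A \<noteq> card B"
    for N A B
    using grid_Z_nonzero_card that unfolding G_def by blast
  note compute = expand sum_Pow_lessThan_Suc row_Z_simps row_weights_def zero
  \<comment> \<open>The entries through which the recursion passes. Standing still has weight 1
    because a1 = b1 = 1, and one step to the neighbouring column has the same weight wherever it
    takes place.\<close>
  have diag: "G N {Suc 0} {Suc 0} = 1 \<and> G N {Suc 0} {Suc (Suc 0)} = 0 \<and>
      G N {Suc (Suc 0)} {Suc (Suc 0)} = 1 \<and> G N {Suc (Suc 0)} {Suc 0} = G N {Suc 0} {0} \<and>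
      G N {Suc (Suc 0), Suc 0} {Suc (Suc 0), Suc 0} = 1 \<and>
      G N {Suc (Suc 0), Suc 0} {Suc (Suc 0), 0} = G N {Suc 0} {0}" for N
  proof (induction N)
    case 0
    show ?case by (auto simp: G_def)
  next
    case (Suc N)
    then show ?case by (simp add: compute del: row_Z.simps(2))
  qed
  show "p (Suc N) = p N + c (Suc N) * d (Suc N)"
    using diag[of N] by (simp add: p_def compute del: row_Z.simps(2))
  \<comment> \<open>Crossing both columns within the new row passes a vertex of type
    \<open>B2\<close> in the middle, hence the factor x.\<close>
  show "q (Suc N) = q N + p N * (c (Suc N) * d (Suc N)) + c (Suc N) * d (Suc N) * x (Suc N)"
    using diag[of N] by (simp add: p_def q_def compute mult_ac del: row_Z.simps(2))
  \<comment> \<open>If both minus spins move within the new row, the middle column is a vertex of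
    type \<open>A2\<close>, hence y in place of x.\<close>
  show "r (Suc N) = r N + p N * (c (Suc N) * d (Suc N)) + c (Suc N) * d (Suc N) * y (Suc N)"
    using diag[of N] by (simp add: p_def r_def compute mult_ac del: row_Z.simps(2))
qed

text \<open>The series \<open>E N\<close> may vary with N without any rule; only the relation r =
  p^2 - q between three of its minors is used. Subtracting it for N from the one for N + 1 cancels
  everything but \<open>c * d * (x + y - c * d) = 0\<close> for the new row.\<close>

lemma free_fermionic_necessary:
  assumes nz: "\<And>i t. i \<ge> 1 \<Longrightarrow> f i t \<noteq> 0"
    and E: "\<And>N. E N $ 0 = 1"
    and Z: "\<And>N a b. N \<ge> 1 \<Longrightarrow> a \<in> {[1], [2], [2, 1]} \<Longrightarrow> b \<in> {[0], [1, 0]} \<Longrightarrow>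
      grid_Z f 3 N (set a) (set b) =
        (\<Prod>i=1..N. f i A1 ^ (3 - length a) * f i B1 ^ length a) * toeplitz_det (E N) a b"
    and i: "i \<ge> 1"
  shows "f i A1 * f i A2 + f i B1 * f i B2 = f i C1 * f i C2"
proof -
  define x where "x i = f i B2 / f i A1" for i
  define y where "y i = f i A2 / f i B1" for i
  define c where "c i = f i C1 / f i B1" for i
  define d where "d i = f i C2 / f i A1" for i
  let ?G = "grid_Z (\<lambda>i. row_weights (x i) (y i) (c i) (d i)) 3"
  have G: "?G N (set a) (set b) = toeplitz_det (E N) a b"
    if N: "N \<ge> 1" and a: "a \<in> {[1], [2], [2, 1]}" and b: "b \<in> {[0], [1, 0]}" for N a b
  proof -
    have "set a \<subseteq> {..<3}" "card (set a) = length a" using a by auto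
    then have "grid_Z f 3 N (set a) (set b) =
        (\<Prod>i=1..N. f i A1 ^ (3 - length a) * f i B1 ^ length a) * ?G N (set a) (set b)"
      using grid_Z_normalized[of f "set a" 3 N "set b"] nz
      by (simp add: normalized_def x_def y_def c_def d_def)
    then have eq: "(\<Prod>i=1..N. f i A1 ^ (3 - length a) * f i B1 ^ length a) * ?G N (set a) (set b) =
        (\<Prod>i=1..N. f i A1 ^ (3 - length a) * f i B1 ^ length a) * toeplitz_det (E N) a b"
      using Z[OF N a b] by (simp only:)
    have "(\<Prod>i=1..N. f i A1 ^ (3 - length a) * f i B1 ^ length a) \<noteq> 0"
      using nz by simp
    from mult_left_cancel[OF this] eq show ?thesis by blast
  qed
  define p where "p N = ?G N {1} {0}" for N
  define q where "q N = ?G N {2} {0}" for N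
  define r where "r N = ?G N {2, 1} {1, 0}" for N
  have rel: "r N = p N ^ 2 - q N" for N
  proof (cases N)
    \<comment> \<open>The hypothesis starts at N = 1; for the empty grid all three entries are
      0.\<close>
    case 0
    have "(2 :: nat) \<notin> {1, 0}" by simp
    then have "{2, 1} \<noteq> {1, 0 :: nat}" by blast
    then show ?thesis using 0 by (simp add: p_def q_def r_def)
  next
    case (Suc M)
    then have N: "N \<ge> 1" by simp
    \<comment> \<open>In the 2 by 2 minor the entry in row 1 and column 1 is \<open>E N $ 0\<close>,
      which is 1; hence h_2 enters with coefficient -1.\<close>
    have "p N = E N $ 1" "q N = E N $ 2" "r N = E N $ 1 * E N $ 1 - E N $ 2"
      using G[OF N, of "[1]" "[0]"] G[OF N, of "[2]" "[0]"] G[OF N, of "[2, 1]" "[1, 0]"]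
      by (simp_all add: p_def q_def r_def toeplitz_det_def toeplitz_def delete_nth_def E
          lessThan_Suc numeral_2_eq_2)
    then show ?thesis by (simp add: power2_eq_square)
  qed
  obtain N where N: "i = Suc N" using i by (cases i) auto
  have rec: "p (Suc N) = p N + c i * d i"
    "q (Suc N) = q N + p N * (c i * d i) + c i * d i * x i"
    "r (Suc N) = r N + p N * (c i * d i) + c i * d i * y i"
    using grid_Z_small[of x y c d N] unfolding p_def q_def r_def N
    by (simp_all add: numeral_2_eq_2 numeral_3_eq_3 del: grid_Z.simps)
  have "c i * d i * y i = c i * d i * (c i * d i - x i)"
    using rel[of "Suc N"] unfolding rec rel[of N] by (simp add: algebra_simps power2_eq_square)
  moreover have "c i * d i \<noteq> 0" using nz[OF i] by (simp add: c_def d_def)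
  ultimately have "y i + x i = c i * d i" by simp
  then show ?thesis
    using nz[OF i] by (simp add: x_def y_def c_def d_def field_simps)
qed

lemma strict_partition_subset:
  "strict_partition a \<Longrightarrow> part a 0 \<le> M \<Longrightarrow> set a \<subseteq> {..<Suc M}"
  using strict_partition_bound[of a M] by (auto simp: strict_partitions_def less_Suc_eq_le)

definition parameter_series :: "nat \<Rightarrow> (nat \<Rightarrow> nat \<Rightarrow> complex) \<Rightarrow> complex fps" where
  "parameter_series N s = Abs_fps (\<lambda>k. if k = 0 then 0 else \<Sum>j=1..N. s j k)"

lemma matrix_coeff_plus:
  assumes "strict_partition a" "strict_partition b"
  shows "matrix_coeff b (exp_op (H_plus N s)) a =
    toeplitz_det (fps_exp 1 oo parameter_series N (\<lambda>j k. s j (int k))) a b"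
  by (rule matrix_coeff_exp_H_plus) (use assms in \<open>auto simp: parameter_series_def\<close>)

lemma matrix_coeff_minus:
  assumes "strict_partition a" "strict_partition b"
  shows "matrix_coeff a (exp_op (H_minus N s)) b =
    toeplitz_det (fps_exp 1 oo parameter_series N (\<lambda>j k. s j (- int k))) a b"
  by (rule matrix_coeff_exp_H_minus) (use assms in \<open>auto simp: parameter_series_def\<close>)

text \<open>Stated for abstract weights \<open>f\<close>, so that it applies both to
  \<open>w\<close> and to the weights of the reflected dual model.\<close>

lemma free_fermionic_iff_exponential:
  fixes f :: "nat \<Rightarrow> vertex \<Rightarrow> complex"
  assumes nz: "\<And>i t. i \<ge> 1 \<Longrightarrow> f i t \<noteq> 0"
  shows "(\<exists>s :: nat \<Rightarrow> nat \<Rightarrow> complex. \<forall>a b N M.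
      strict_partition a \<and> strict_partition b \<and> N \<ge> 1 \<and> M \<ge> max (part a 0) (part b 0) \<longrightarrow>
      grid_Z f (Suc M) N (set a) (set b) =
        (\<Prod>i=1..N. f i A1 ^ (M + 1 - length a) * f i B1 ^ length a) *
        toeplitz_det (fps_exp 1 oo parameter_series N s) a b) \<longleftrightarrow>
    (\<forall>i\<ge>1. f i A1 * f i A2 + f i B1 * f i B2 = f i C1 * f i C2)" (is "(\<exists>s. ?P s) \<longleftrightarrow> ?ff")
proof
  assume "\<exists>s. ?P s"
  then obtain s where s: "?P s" ..
  show ?ff
  proof (intro allI impI)
    fix i :: nat assume i: "i \<ge> 1"
    show "f i A1 * f i A2 + f i B1 * f i B2 = f i C1 * f i C2"
    proof (rule free_fermionic_necessary[where E = "\<lambda>N. fps_exp 1 oo parameter_series N s", OF nz _ _ i])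
      fix N :: nat and a b :: "nat list"
      assume N: "N \<ge> 1" and a: "a \<in> {[1], [2], [2, 1]}" and b: "b \<in> {[0], [1, 0]}"
      have "strict_partition a" "strict_partition b" "2 \<ge> max (part a 0) (part b 0)"
        using a b by (auto simp: strict_partition_def)
      then have "grid_Z f (Suc 2) N (set a) (set b) =
        (\<Prod>i=1..N. f i A1 ^ (2 + 1 - length a) * f i B1 ^ length a) *
        toeplitz_det (fps_exp 1 oo parameter_series N s) a b" using s N by blast
      then show "grid_Z f 3 N (set a) (set b) =
        (\<Prod>i=1..N. f i A1 ^ (3 - length a) * f i B1 ^ length a) *
        toeplitz_det (fps_exp 1 oo parameter_series N s) a b" by simp
    qed simp_all
  qed
next
  assume ff: ?ff
  let ?R = "\<lambda>i. row_series (f i B2 / f i A1) (f i A2 / f i B1)"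
  \<comment> \<open>The parameters of row j are the coefficients of the logarithm of its own series,
    so the sum over j \<le> N exponentiates to the product of the first N rows.\<close>
  have "?P (\<lambda>j k. log_series (?R j) $ k)"
  proof (intro allI impI; elim conjE)
    fix a b N M
    assume a: "strict_partition a" and b: "strict_partition b" and M: "M \<ge> max (part a 0) (part b 0)"
    have "parameter_series N (\<lambda>j k. log_series (?R j) $ k) = (\<Sum>j=1..N. log_series (?R j))"
      by (rule fps_ext) (simp add: parameter_series_def fps_sum_nth)
    then have "fps_exp 1 oo parameter_series N (\<lambda>j k. log_series (?R j) $ k) = (\<Prod>j=1..N. ?R j)"
      by (simp only: exp_sum_log_series row_series_nth_0)
    moreover have "set a \<subseteq> {..<Suc M}" "set b \<subseteq> {..<Suc M}"
      using M a b by (auto dest!: strict_partition_subset[rotated, of _ M])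
    ultimately show "grid_Z f (Suc M) N (set a) (set b) =
        (\<Prod>i=1..N. f i A1 ^ (M + 1 - length a) * f i B1 ^ length a) *
        toeplitz_det (fps_exp 1 oo parameter_series N (\<lambda>j k. log_series (?R j) $ k)) a b"
      using grid_Z_free_fermionic[of f a "Suc M" b N] nz ff a b by simp
  qed
  then show "\<exists>s. ?P s" by (rule exI[of ?P])
qed

text \<open>\<open>H_plus\<close> and \<open>H_minus\<close> each read the parameters on one half of
  the integers, so a family indexed by naturals can be extended arbitrarily to the other
  half.\<close>

lemma ex_int_indexed:
  "(\<exists>s :: 'a \<Rightarrow> int \<Rightarrow> 'b. Q (\<lambda>j k. s j (int k))) \<longleftrightarrow> (\<exists>s. Q s)"
  "(\<exists>s :: 'a \<Rightarrow> int \<Rightarrow> 'b. Q (\<lambda>j k. s j (- int k))) \<longleftrightarrow> (\<exists>s. Q s)"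
proof -
  show "(\<exists>s :: 'a \<Rightarrow> int \<Rightarrow> 'b. Q (\<lambda>j k. s j (int k))) \<longleftrightarrow> (\<exists>s. Q s)"
  proof
    assume "\<exists>s. Q s"
    then obtain s where "Q s" ..
    then show "\<exists>s :: 'a \<Rightarrow> int \<Rightarrow> 'b. Q (\<lambda>j k. s j (int k))"
      by (intro exI[of _ "\<lambda>j k. s j (nat k)"]) simp
  qed blast
  show "(\<exists>s :: 'a \<Rightarrow> int \<Rightarrow> 'b. Q (\<lambda>j k. s j (- int k))) \<longleftrightarrow> (\<exists>s. Q s)"
  proof
    assume "\<exists>s. Q s"
    then obtain s where "Q s" ..
    then show "\<exists>s :: 'a \<Rightarrow> int \<Rightarrow> 'b. Q (\<lambda>j k. s j (- int k))"
      by (intro exI[of _ "\<lambda>j k. s j (nat (- k))"]) simp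
  qed blast
qed

theorem theorem1p1:
  fixes w :: weights
  assumes nonzero: "\<And>t i. i \<ge> 1 \<Longrightarrow> w t i \<noteq> 0"
  shows
    "((\<exists>s :: nat \<Rightarrow> int \<Rightarrow> complex. \<forall>lam mu N M.
         strict_partition lam \<and> strict_partition mu \<and> N \<ge> 1 \<and> M \<ge> max (part lam 0) (part mu 0) \<longrightarrow>
         Z_S w N M lam mu =
           (\<Prod>i=1..N. w A1 i ^ (M + 1 - length lam) * w B1 i ^ length lam) *
           matrix_coeff mu (exp_op (H_plus N s)) lam)
       \<longleftrightarrow> free_fermionic w)
     \<and>
     ((\<exists>s :: nat \<Rightarrow> int \<Rightarrow> complex. \<forall>lam mu N M.
         strict_partition lam \<and> strict_partition mu \<and> N \<ge> 1 \<and> M \<ge> max (part lam 0) (part mu 0) \<longrightarrow>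
         Z_S_star w N M lam mu =
           (\<Prod>i=1..N. w A1 i ^ (M + 1 - length lam) * w B1 i ^ length lam) *
           matrix_coeff lam (exp_op (H_minus N s)) mu)
       \<longleftrightarrow> free_fermionic w)
     \<and>
     (free_fermionic w \<longrightarrow>
       (\<forall>lam mu l N M.
          is_partition lam \<and> is_partition mu \<and> length lam = l \<and> length mu = l \<and> N \<ge> 1 \<and>
          M \<ge> max (part (plus_rho lam) 0) (part (plus_rho mu) 0) \<longrightarrow>
          Z_S w N M (plus_rho lam) (plus_rho mu) =
            (\<Prod>i=1..N. w A1 i ^ (M + 1 - l) * w B1 i ^ l) *
            super_schur N lam mu (\<lambda>i. w B2 i / w A1 i) (\<lambda>i. w A2 i / w B1 i) \<and>
          Z_S_star w N M (plus_rho lam) (plus_rho mu) =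
            (\<Prod>i=1..N. w A1 i ^ (M + 1 - l) * w B1 i ^ l) *
            super_schur N lam mu (\<lambda>i. w B2 i / w A1 i) (\<lambda>i. w A2 i / w B1 i)))"
proof (intro conjI)
  let ?f = "\<lambda>i t. w t i" and ?f' = "\<lambda>i t. w (swap_c t) i"
  \<comment> \<open>Only the product of the two c weights enters the condition, so exchanging them
    by reflection does not change it.\<close>
  have ff: "free_fermionic w \<longleftrightarrow>
      (\<forall>i\<ge>1. ?f i A1 * ?f i A2 + ?f i B1 * ?f i B2 = ?f i C1 * ?f i C2)"
    and ff': "free_fermionic w \<longleftrightarrow>
      (\<forall>i\<ge>1. ?f' i A1 * ?f' i A2 + ?f' i B1 * ?f' i B2 = ?f' i C1 * ?f' i C2)"
    by (simp_all add: free_fermionic_def mult.commute[of "w C2 _"])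
  have Z: "Z_S w N M a b = grid_Z ?f (Suc M) N (set a) (set b)"
      "Z_S_star w N M a b = grid_Z ?f' (Suc M) N (set a) (set b)"
    if "strict_partition a" "strict_partition b" "M \<ge> max (part a 0) (part b 0)" for a b N M
    using that by (simp_all add: Z_S_grid Z_S_star_grid strict_partition_subset)
  let ?c = "\<lambda>N M a. \<Prod>i=1..N. w A1 i ^ (M + 1 - length a) * w B1 i ^ length a"
  let ?P = "\<lambda>f s. \<forall>a b N M.
      strict_partition a \<and> strict_partition b \<and> N \<ge> 1 \<and> M \<ge> max (part a 0) (part b 0) \<longrightarrow>
      grid_Z f (Suc M) N (set a) (set b) =
        (\<Prod>i=1..N. f i A1 ^ (M + 1 - length a) * f i B1 ^ length a) *
        toeplitz_det (fps_exp 1 oo parameter_series N s) a b"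
  let ?plus = "\<lambda>s. \<forall>lam mu N M.
      strict_partition lam \<and> strict_partition mu \<and> N \<ge> 1 \<and> M \<ge> max (part lam 0) (part mu 0) \<longrightarrow>
      Z_S w N M lam mu = ?c N M lam * matrix_coeff mu (exp_op (H_plus N s)) lam"
  let ?minus = "\<lambda>s. \<forall>lam mu N M.
      strict_partition lam \<and> strict_partition mu \<and> N \<ge> 1 \<and> M \<ge> max (part lam 0) (part mu 0) \<longrightarrow>
      Z_S_star w N M lam mu = ?c N M lam * matrix_coeff lam (exp_op (H_minus N s)) mu"
  have plus: "?plus s \<longleftrightarrow> ?P ?f (\<lambda>j k. s j (int k))" for s
    by (simp add: Z matrix_coeff_plus cong: imp_cong)
  have "(\<exists>s. ?plus s) \<longleftrightarrow> (\<exists>s. ?P ?f s)"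
    unfolding plus by (rule ex_int_indexed(1)[of "?P ?f"])
  also have "\<dots> \<longleftrightarrow> free_fermionic w"
    unfolding ff by (rule free_fermionic_iff_exponential[of ?f, OF nonzero])
  finally show "(\<exists>s. ?plus s) \<longleftrightarrow> free_fermionic w" .
  have minus: "?minus s \<longleftrightarrow> ?P ?f' (\<lambda>j k. s j (- int k))" for s
    by (simp add: Z matrix_coeff_minus cong: imp_cong)
  have "(\<exists>s. ?minus s) \<longleftrightarrow> (\<exists>s. ?P ?f' s)"
    unfolding minus by (rule ex_int_indexed(2)[of "?P ?f'"])
  also have "\<dots> \<longleftrightarrow> free_fermionic w"
    unfolding ff' by (rule free_fermionic_iff_exponential[of ?f', OF nonzero])
  finally show "(\<exists>s. ?minus s) \<longleftrightarrow> free_fermionic w" .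
  show "free_fermionic w \<longrightarrow>
       (\<forall>lam mu l N M.
          is_partition lam \<and> is_partition mu \<and> length lam = l \<and> length mu = l \<and> N \<ge> 1 \<and>
          M \<ge> max (part (plus_rho lam) 0) (part (plus_rho mu) 0) \<longrightarrow>
          Z_S w N M (plus_rho lam) (plus_rho mu) =
            (\<Prod>i=1..N. w A1 i ^ (M + 1 - l) * w B1 i ^ l) *
            super_schur N lam mu (\<lambda>i. w B2 i / w A1 i) (\<lambda>i. w A2 i / w B1 i) \<and>
          Z_S_star w N M (plus_rho lam) (plus_rho mu) =
            (\<Prod>i=1..N. w A1 i ^ (M + 1 - l) * w B1 i ^ l) *
            super_schur N lam mu (\<lambda>i. w B2 i / w A1 i) (\<lambda>i. w A2 i / w B1 i))"
  proof (intro impI allI; elim conjE)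
    fix lam mu l N M
    assume free: "free_fermionic w" and part: "is_partition lam" "is_partition mu"
      and l: "length lam = l" "length mu = l"
      and M: "M \<ge> max (part (plus_rho lam) 0) (part (plus_rho mu) 0)"
    let ?a = "plus_rho lam" and ?b = "plus_rho mu"
    have strict: "strict_partition ?a" "strict_partition ?b"
      using part by (simp_all add: strict_partition_plus_rho)
    then have sub: "set ?a \<subseteq> {..<Suc M}" "set ?b \<subseteq> {..<Suc M}"
      using M by (simp_all add: strict_partition_subset)
    have schur: "super_schur N lam mu (\<lambda>i. w B2 i / w A1 i) (\<lambda>i. w A2 i / w B1 i) =
        toeplitz_det (\<Prod>i=1..N. row_series (w B2 i / w A1 i) (w A2 i / w B1 i)) ?a ?b"
      using part l by (simp add: super_schur_toeplitz_det)
    show "Z_S w N M ?a ?b = (\<Prod>i=1..N. w A1 i ^ (M + 1 - l) * w B1 i ^ l) *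
          super_schur N lam mu (\<lambda>i. w B2 i / w A1 i) (\<lambda>i. w A2 i / w B1 i) \<and>
        Z_S_star w N M ?a ?b = (\<Prod>i=1..N. w A1 i ^ (M + 1 - l) * w B1 i ^ l) *
          super_schur N lam mu (\<lambda>i. w B2 i / w A1 i) (\<lambda>i. w A2 i / w B1 i)"
      unfolding schur Z(1)[OF strict M] Z(2)[OF strict M]
      using grid_Z_free_fermionic[of ?f ?a "Suc M" ?b N] grid_Z_free_fermionic[of ?f' ?a "Suc M" ?b N]
        nonzero free strict sub l
      by (simp add: free_fermionic_def mult.commute[of "w C2 _"])
  qed
qed

end
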